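(* There are no tight chiral $5$-polytopes.
   Context: An abstract $n$-polytope is a partially ordered set with a unique least face (rank $-1$) and greatest face (rank $n$) in which every maximal chain (flag) has $n+2$ elements, satisfying the diamond condition (whenever $F<G$ with ranks differing by $2$ there are exactly two faces strictly between them) and strong connectivity. Faces of rank $0$ are vertices, of rank $n-1$ facets. A polytope is equivelar of (Schläfli) type $\{p_1,\dots,p_{n-1}\}$ if for each $i$ every section between an $(i-2)$-face and an incident $(i+1)$-face is a $p_i$-gon. An automorphism is an order-preserving bijection; $\Gamma(\mathcal P)$ is the automorphism group. $\mathcal P$ is regular if $\Gamma(\mathcal P)$ is transitive on flags, and chiral if $\Gamma(\mathcal P)$ has exactly two orbits on flags with any two flags differing in exactly one face lying in different orbits. A polytope of type $\{p_1,\dots,p_{n-1}\}$ has at least $2p_1\cdots p_{n-1}$ flags, and it is called tight if it has exactly $2p_1\cdots p_{n-1}$ flags. *)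

theory Defs
  imports Main
begin

definition is_chain :: "'a set \<Rightarrow> ('a \<Rightarrow> 'a \<Rightarrow> bool) \<Rightarrow> 'a set \<Rightarrow> bool" where
  "is_chain F le C \<longleftrightarrow> C \<subseteq> F \<and> (\<forall>x\<in>C. \<forall>y\<in>C. le x y \<or> le y x)"

definition is_flag :: "'a set \<Rightarrow> ('a \<Rightarrow> 'a \<Rightarrow> bool) \<Rightarrow> 'a set \<Rightarrow> bool" where
  "is_flag F le C \<longleftrightarrow> is_chain F le C \<and> (\<forall>D. is_chain F le D \<and> C \<subseteq> D \<longrightarrow> D = C)"

definition flags :: "'a set \<Rightarrow> ('a \<Rightarrow> 'a \<Rightarrow> bool) \<Rightarrow> 'a set set" where
  "flags F le = {C. is_flag F le C}"

text \<open>Rank of a face x: (number of elements of a maximal chain of faces below x) - 2.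
  In a polytope this does not depend on the chosen chain.\<close>
definition face_rank :: "'a set \<Rightarrow> ('a \<Rightarrow> 'a \<Rightarrow> bool) \<Rightarrow> 'a \<Rightarrow> int" where
  "face_rank F le x = int (card (SOME C. is_flag {y\<in>F. le y x} le C)) - 2"

definition partial_order_on_set :: "'a set \<Rightarrow> ('a \<Rightarrow> 'a \<Rightarrow> bool) \<Rightarrow> bool" where
  "partial_order_on_set F le \<longleftrightarrow>
     (\<forall>x\<in>F. le x x) \<and>
     (\<forall>x\<in>F. \<forall>y\<in>F. le x y \<and> le y x \<longrightarrow> x = y) \<and>
     (\<forall>x\<in>F. \<forall>y\<in>F. \<forall>z\<in>F. le x y \<and> le y z \<longrightarrow> le x z)"

definition open_section :: "'a set \<Rightarrow> ('a \<Rightarrow> 'a \<Rightarrow> bool) \<Rightarrow> 'a \<Rightarrow> 'a \<Rightarrow> 'a set" where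
  "open_section F le x y = {z\<in>F. le x z \<and> z \<noteq> x \<and> le z y \<and> z \<noteq> y}"

text \<open>Strong connectivity: every section y/x of rank at least 2 (i.e.
  rank y - rank x - 1 \<ge> 2) is connected: any two proper faces of the section can be
  joined by a sequence of proper faces of the section, consecutive ones incident.
  Sections of rank \<le> 1 are connected by convention.\<close>
definition strongly_connected :: "'a set \<Rightarrow> ('a \<Rightarrow> 'a \<Rightarrow> bool) \<Rightarrow> bool" where
  "strongly_connected F le \<longleftrightarrow>
     (\<forall>x\<in>F. \<forall>y\<in>F. le x y \<and> face_rank F le y - face_rank F le x \<ge> 3 \<longrightarrow>
        (\<forall>a\<in>open_section F le x y. \<forall>b\<in>open_section F le x y.
           (\<lambda>u v. u \<in> open_section F le x y \<and> v \<in> open_section F le x y \<and> (le u v \<or> le v u))\<^sup>*\<^sup>* a b))"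

definition abstract_polytope :: "'a set \<Rightarrow> ('a \<Rightarrow> 'a \<Rightarrow> bool) \<Rightarrow> nat \<Rightarrow> bool" where
  "abstract_polytope F le n \<longleftrightarrow>
     partial_order_on_set F le \<and>
     (\<exists>m\<in>F. \<forall>x\<in>F. le m x) \<and>
     (\<exists>M\<in>F. \<forall>x\<in>F. le x M) \<and>
     (\<forall>C\<in>flags F le. finite C \<and> card C = n + 2) \<and>
     (\<forall>x\<in>F. \<forall>y\<in>F. le x y \<and> face_rank F le y = face_rank F le x + 2 \<longrightarrow>
        card (open_section F le x y) = 2) \<and>
     strongly_connected F le"

text \<open>Equivelar of Schlaefli type {p_1,...,p_(n-1)} (ps ! (i-1) = p_i): each section between
  an (i-2)-face and an incident (i+1)-face (a rank 2 polytope) is a p_i-gon, i.e. has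
  exactly p_i vertices (faces of rank i-1).\<close>
definition equivelar :: "'a set \<Rightarrow> ('a \<Rightarrow> 'a \<Rightarrow> bool) \<Rightarrow> nat \<Rightarrow> nat list \<Rightarrow> bool" where
  "equivelar F le n ps \<longleftrightarrow>
     length ps = n - 1 \<and>
     (\<forall>i\<in>{1..n-1}. \<forall>x\<in>F. \<forall>y\<in>F.
        le x y \<and> face_rank F le x = int i - 2 \<and> face_rank F le y = int i + 1 \<longrightarrow>
        card {z\<in>F. le x z \<and> le z y \<and> face_rank F le z = int i - 1} = ps ! (i - 1))"

definition tight :: "'a set \<Rightarrow> ('a \<Rightarrow> 'a \<Rightarrow> bool) \<Rightarrow> nat \<Rightarrow> nat list \<Rightarrow> bool" where
  "tight F le n ps \<longleftrightarrow> equivelar F le n ps \<and> finite (flags F le) \<and>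
     card (flags F le) = 2 * prod_list ps"

definition is_automorphism :: "'a set \<Rightarrow> ('a \<Rightarrow> 'a \<Rightarrow> bool) \<Rightarrow> ('a \<Rightarrow> 'a) \<Rightarrow> bool" where
  "is_automorphism F le \<phi> \<longleftrightarrow> bij_betw \<phi> F F \<and>
     (\<forall>x\<in>F. \<forall>y\<in>F. le x y \<longleftrightarrow> le (\<phi> x) (\<phi> y))"

definition flag_orbit :: "'a set \<Rightarrow> ('a \<Rightarrow> 'a \<Rightarrow> bool) \<Rightarrow> 'a set \<Rightarrow> 'a set set" where
  "flag_orbit F le C = {\<phi> ` C | \<phi>. is_automorphism F le \<phi>}"

definition chiral :: "'a set \<Rightarrow> ('a \<Rightarrow> 'a \<Rightarrow> bool) \<Rightarrow> bool" where
  "chiral F le \<longleftrightarrow>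
     card (flag_orbit F le ` flags F le) = 2 \<and>
     (\<forall>C\<in>flags F le. \<forall>D\<in>flags F le. card (C - D) = 1 \<and> card (D - C) = 1 \<longrightarrow>
        flag_orbit F le C \<noteq> flag_orbit F le D)"

end

theory Submission
  imports Defs "HOL-Library.Set_Algebras"
begin

text \<open>
  The rotation group \<open>\<Gamma>\<close> is generated by \<open>x = \<rho>\<^sub>0\<rho>\<^sub>1\<close>, \<open>y = \<rho>\<^sub>1\<rho>\<^sub>2\<close>, \<open>z = \<rho>\<^sub>2\<rho>\<^sub>3\<close>, \<open>w = \<rho>\<^sub>3\<rho>\<^sub>4\<close>, and
  tightness means that \<open>\<Gamma> = \<langle>x\<rangle>\<langle>y\<rangle>\<langle>z\<rangle>\<langle>w\<rangle>\<close>, with \<open>\<langle>x,y\<rangle> = \<langle>x\<rangle>\<langle>y\<rangle>\<close> and likewise for the other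
  consecutive pairs. A pair with \<open>\<langle>y,z\<rangle> = \<langle>y\<rangle>\<langle>z\<rangle>\<close> admits an automorphism inverting both generators
  exactly if \<open>y\<^sup>2\<close> and \<open>z\<^sup>2\<close> commute; the harder direction rests on Ito's theorem, by which the
  commutator subgroup is abelian. The sections of types \<open>{p\<^sub>1,p\<^sub>2}\<close> and \<open>{p\<^sub>3,p\<^sub>4}\<close> are regular, because
  \<open>\<rho>\<^sub>1\<rho>\<^sub>4\<close> and \<open>\<rho>\<^sub>0\<rho>\<^sub>3\<close> belong to \<open>\<Gamma>\<close> and invert their generators.

  The medial section is regular as well. Conjugation by \<open>zw = \<rho>\<^sub>2\<rho>\<^sub>4\<close> inverts \<open>y\<close> and, by regularity
  of \<open>\<langle>z,w\<rangle>\<close>, maps \<open>z\<^sup>2\<close> to a power of \<open>z\<^sup>2\<close> up to a normal subgroup meeting \<open>\<langle>y,z\<rangle>\<close> trivially.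
  This forces \<open>[z\<^sup>2,y\<^sup>2] \<in> \<langle>y\<rangle>\<close>; the dual argument gives \<open>[z\<^sup>2,y\<^sup>2] \<in> \<langle>z\<rangle>\<close>, so the commutator is
  trivial. When all three consecutive pairs are regular, the would-be conjugation by \<open>\<rho>\<^sub>2\<close> is well
  defined on \<open>\<Gamma>\<close>, and it induces an automorphism of the polytope that maps the base flag to its
  2-adjacent flag, contradicting chirality.
\<close>

section \<open>Groups\<close>

text \<open>A chiral polytope has no single \<open>\<rho>\<^sub>i\<close>, only products of two. An
  element inverting both generators of a consecutive pair must therefore be the middle
  \<open>\<rho>\<^sub>i\<close> times some \<open>\<rho>\<^sub>k\<close> that commutes with all
  three indices involved. For the outer pairs 4 and 0 are such indices; for \<open>y, z\<close>
  there is none, and this is the obstacle. The substitute \<open>z * w\<close> inverts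
  \<open>y\<close> but need not even normalize \<open><y, z>\<close>. To make it usable one also
  divides by the core of \<open><y>\<close> in \<open><y, z>\<close>: afterwards no nontrivial power
  of \<open>y\<close> is centralized or inverted by \<open>z\<close>, which kills the correction
  terms one after another. The price is that the commutator of the squares is at first only known to
  lie in \<open><y>\<close>. Conjugation by \<open>\<rho>\<^sub>2\<close> is handled through its
  graph, a subgroup of pairs in the direct product of the group with itself. Well-definedness means
  that 1 is paired only with 1. This is read off from a factorization of the graph into four cyclic
  groups, where every exchange of factors has to hold in both coordinates with the same
  exponents.\<close>

class mult_group = monoid_mult +
  fixes ginv :: "'a \<Rightarrow> 'a"
  assumes ginv_left [simp]: "ginv a * a = 1"
begin

lemma ginv_left_assoc [simp]: "ginv a * (a * b) = b"
  by (metis ginv_left mult.assoc mult_1_left)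

lemma ginv_right [simp]: "a * ginv a = 1"
  by (metis ginv_left ginv_left_assoc mult_1_right)

lemma ginv_right_assoc [simp]: "a * (ginv a * b) = b"
  by (metis ginv_right mult.assoc mult_1_left)

lemma group_cancel_left [simp]: "a * b = a * c \<longleftrightarrow> b = c"
  by (metis ginv_left_assoc)

lemma group_cancel_right [simp]: "b * a = c * a \<longleftrightarrow> b = c"
  by (metis ginv_right mult.assoc mult_1_right)

lemma ginv_unique: "a * b = 1 \<Longrightarrow> ginv a = b"
  by (metis ginv_left_assoc mult_1_right)

lemma ginv_ginv [simp]: "ginv (ginv a) = a"
  by (rule ginv_unique) simp

lemma ginv_one [simp]: "ginv 1 = 1"
  by (rule ginv_unique) simp

lemma ginv_mult [simp]: "ginv (a * b) = ginv b * ginv a"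
  by (rule ginv_unique) (simp add: mult.assoc)

lemma ginv_eq_iff [simp]: "ginv a = ginv b \<longleftrightarrow> a = b"
  by (metis ginv_ginv)

lemma ginv_eq_one_iff [simp]: "ginv a = 1 \<longleftrightarrow> a = 1"
  by (metis ginv_ginv ginv_one)

section \<open>Integer powers\<close>

definition gpow :: "'a \<Rightarrow> int \<Rightarrow> 'a" (infixr "\<up>" 80)
  where "x \<up> k = (if 0 \<le> k then x ^ nat k else ginv x ^ nat (- k))"

lemma gpow_0 [simp]: "x \<up> 0 = 1"
  by (simp add: gpow_def)

lemma gpow_1 [simp]: "x \<up> 1 = x"
  by (simp add: gpow_def)

lemma gpow_Suc: "x \<up> (k + 1) = x * x \<up> k"
proof (cases "0 \<le> k")
  case True
  then show ?thesis by (simp add: gpow_def nat_add_distrib)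
next
  case False
  define m where "m = nat (- k - 1)"
  have "nat (- k) = Suc m" "nat (- (k + 1)) = m" "0 \<le> k + 1 \<Longrightarrow> m = 0" "nat (k + 1) = 0"
    using False by (auto simp: m_def)
  then show ?thesis using False by (simp add: gpow_def)
qed

lemma gpow_add: "x \<up> (m + n) = x \<up> m * x \<up> n"
proof (induction m rule: int_induct[where k = 0])
  case base
  show ?case by simp
next
  case (step1 i)
  have "x \<up> (i + 1 + n) = x * x \<up> (i + n)"
    using gpow_Suc[of x "i + n"] by (simp add: algebra_simps)
  then show ?case by (simp add: step1 gpow_Suc mult.assoc)
next
  case (step2 i)
  have "x * x \<up> (i - 1 + n) = x * (x \<up> (i - 1) * x \<up> n)"
    using gpow_Suc[of x "i - 1 + n"] gpow_Suc[of x "i - 1"] step2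
    by (simp add: algebra_simps flip: mult.assoc)
  then show ?case by simp
qed

lemma gpow_minus: "x \<up> (- n) = ginv (x \<up> n)"
  by (metis add.right_inverse ginv_unique gpow_0 gpow_add)

lemma gpow_minus_1 [simp]: "x \<up> (- 1) = ginv x"
  using gpow_minus[of x 1] by simp

lemma gpow_diff: "x \<up> (m - n) = x \<up> m * ginv (x \<up> n)"
  using gpow_add[of x m "- n"] by (simp add: gpow_minus)

lemma gpow_2: "x \<up> 2 = x * x"
  using gpow_add[of x 1 1] by simp

lemma gpow_one [simp]: "1 \<up> n = 1"
  by (simp add: gpow_def power_one)

lemma gpow_mult: "x \<up> (m * n) = (x \<up> m) \<up> n"
proof (induction n rule: int_induct[where k = 0])
  case base
  show ?case by simp
next
  case (step1 i)
  then show ?case by (simp add: distrib_left gpow_add)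
next
  case (step2 i)
  then show ?case by (simp add: right_diff_distrib gpow_diff)
qed

lemma gpow_swap: "(x \<up> m) \<up> n = (x \<up> n) \<up> m"
  by (metis gpow_mult mult.commute)

lemma gpow_ginv: "ginv x \<up> n = ginv (x \<up> n)"
  by (metis gpow_minus gpow_minus_1 gpow_mult mult.commute)

lemma gpow_gpow_commute: "x \<up> m * x \<up> n = x \<up> n * x \<up> m"
  by (metis add.commute gpow_add)

lemma gpow_of_nat: "x \<up> int n = x ^ n"
  by (simp add: gpow_def)

text \<open>Stated for a predicate, so that one induction in both directions serves generated
  subgroups, cores, normalizers, \<open>Aut\<close> and face stabilizers.\<close>

lemma gpow_closed:
  assumes "P 1" "\<And>a b. P a \<Longrightarrow> P b \<Longrightarrow> P (a * b)" "\<And>a. P a \<Longrightarrow> P (ginv a)" "P x"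
  shows "P (x \<up> n)"
proof (induction n rule: int_induct[where k = 0])
  case base
  show ?case by (simp add: assms(1))
next
  case (step1 i)
  then show ?case by (simp add: gpow_add assms)
next
  case (step2 i)
  then show ?case by (simp add: gpow_diff assms)
qed

section \<open>Conjugation\<close>

definition cj :: "'a \<Rightarrow> 'a \<Rightarrow> 'a"
  where "cj g x = g * x * ginv g"

lemma cj_mult [simp]: "cj g (a * b) = cj g a * cj g b"
  by (simp add: cj_def mult.assoc)

lemma cj_one [simp]: "cj g 1 = 1" "cj 1 g = g"
  by (simp_all add: cj_def)

lemma cj_self [simp]: "cj g g = g"
  by (simp add: cj_def mult.assoc)

lemma cj_ginv [simp]: "cj g (ginv a) = ginv (cj g a)"
  by (simp add: cj_def mult.assoc)

lemma cj_cj: "cj g (cj h a) = cj (g * h) a"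
  by (simp add: cj_def mult.assoc)

lemma cj_ginv_cj [simp]: "cj (ginv g) (cj g a) = a" "cj g (cj (ginv g) a) = a"
  by (simp_all add: cj_cj)

lemma cj_inj [simp]: "cj g a = cj g b \<longleftrightarrow> a = b"
  by (metis cj_ginv_cj(1))

lemma cj_eq_one [simp]: "cj g a = 1 \<longleftrightarrow> a = 1"
  by (metis cj_inj cj_one(1))

lemma cj_gpow [simp]: "cj g (a \<up> n) = cj g a \<up> n"
proof (induction n rule: int_induct[where k = 0])
  case base
  show ?case by simp
next
  case (step1 i)
  then show ?case by (simp add: gpow_add)
next
  case (step2 i)
  then show ?case by (simp add: gpow_diff)
qed

lemma cj_fix_iff: "cj g a = a \<longleftrightarrow> g * a = a * g"
  by (metis cj_def ginv_right mult.assoc mult_1_right group_cancel_right ginv_left)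

lemma cj_fix_sym: "cj g a = a \<longleftrightarrow> cj a g = g"
  unfolding cj_fix_iff by metis

lemma cj_mult_left: "cj g a * g = g * a"
  by (simp add: cj_def mult.assoc)

lemma cj_fix_gpow: "cj g a = a \<Longrightarrow> cj (g \<up> n) a = a"
  by (metis cj_fix_sym cj_gpow)

lemma cj_fix_gpow2: "cj g a = a \<Longrightarrow> cj (g \<up> m) (a \<up> n) = a \<up> n"
  by (simp add: cj_fix_gpow)

lemma cj_fix_ginv: "cj g a = a \<Longrightarrow> cj (ginv g) a = a"
  by (metis cj_ginv_cj(1))

lemma gpow_mult_distrib:
  assumes "a * b = b * a"
  shows "(a * b) \<up> n = a \<up> n * b \<up> n"
proof -
  have *: "b \<up> m * a = a * b \<up> m" for m
    using assms cj_fix_gpow[of b a m] by (simp add: cj_fix_iff)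
  show ?thesis
  proof (induction n rule: int_induct[where k = 0])
    case base
    show ?case by simp
  next
    case (step1 i)
    have "(a * b) \<up> (i + 1) = a \<up> i * b \<up> i * (a * b)" by (simp add: gpow_add step1)
    also have "\<dots> = a \<up> i * (b \<up> i * a) * b" by (simp add: mult.assoc)
    also have "\<dots> = a \<up> (i + 1) * b \<up> (i + 1)" by (simp only: *) (simp add: gpow_add mult.assoc)
    finally show ?case .
  next
    case (step2 i)
    have "(a * b) \<up> (i - 1) * (a * b) = a \<up> i * b \<up> i"
      by (metis diff_add_cancel gpow_1 gpow_add step2(2))
    also have "\<dots> = a \<up> (i - 1) * a * (b \<up> (i - 1) * b)"
      by (metis diff_add_cancel gpow_1 gpow_add)
    also have "\<dots> = a \<up> (i - 1) * (b \<up> (i - 1) * a) * b" by (simp only: * mult.assoc)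
    also have "\<dots> = a \<up> (i - 1) * b \<up> (i - 1) * (a * b)" by (simp add: mult.assoc)
    finally show ?case by simp
  qed
qed

end

text \<open>Words grow only on the left, so an induction needs just that the target is stable under
  left multiplication by generators and their inverses; \<open>gen_pair_normal_form\<close> and
  \<open>gen_in_P\<close> rest on this.\<close>

inductive_set gen :: "'a::mult_group set \<Rightarrow> 'a set" for S where
  gen_one: "1 \<in> gen S"
| gen_mult: "s \<in> S \<Longrightarrow> a \<in> gen S \<Longrightarrow> s * a \<in> gen S"
| gen_inv: "s \<in> S \<Longrightarrow> a \<in> gen S \<Longrightarrow> ginv s * a \<in> gen S"

lemma gen_incl: "s \<in> S \<Longrightarrow> s \<in> gen S"
  using gen_mult[OF _ gen_one] by fastforce

lemma gen_times: "a \<in> gen S \<Longrightarrow> b \<in> gen S \<Longrightarrow> a * b \<in> gen S"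
  by (induction rule: gen.induct) (auto simp: mult.assoc intro: gen.intros)

lemma gen_ginv: "a \<in> gen S \<Longrightarrow> ginv a \<in> gen S"
proof (induction rule: gen.induct)
  case gen_one
  then show ?case by (simp add: gen.gen_one)
next
  case (gen_mult s a)
  have "ginv s \<in> gen S" using gen_inv[OF gen_mult(1) gen_one] by simp
  then show ?case using gen_mult gen_times by simp
next
  case (gen_inv s a)
  then show ?case using gen_times[OF gen_inv(3) gen_incl[OF gen_inv(1)]] by simp
qed

lemma gen_gpow: "a \<in> gen S \<Longrightarrow> a \<up> n \<in> gen S"
  by (rule gpow_closed) (auto intro: gen_one gen_times gen_ginv simp del: ginv_mult)

lemma gen_cj_closed:
  assumes "\<And>s. s \<in> S \<Longrightarrow> cj g s \<in> gen S" and "a \<in> gen S"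
  shows "cj g a \<in> gen S"
  using assms(2)
  by (induction rule: gen.induct) (auto simp: gen_one assms(1) gen_times gen_ginv)

lemma gen_centralized:
  assumes "\<And>s. s \<in> S \<Longrightarrow> cj g s = s" and "a \<in> gen S"
  shows "cj g a = a"
  using assms(2) by (induction rule: gen.induct) (auto simp: assms(1))

lemma gen_commute:
  assumes "\<And>s t. s \<in> S \<Longrightarrow> t \<in> S \<Longrightarrow> s * t = t * s" and "a \<in> gen S" and "b \<in> gen S"
  shows "a * b = b * a"
proof -
  have "cj a s = s" if "s \<in> S" for s
    using gen_centralized[of S s a] assms(1,2) that by (metis cj_fix_iff)
  then show ?thesis using gen_centralized[of S a b] assms(3) by (metis cj_fix_iff)
qed

section \<open>Products of two cyclic groups\<close>

definition commut :: "'a::mult_group \<Rightarrow> 'a \<Rightarrow> 'a"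
  where "commut a b = a * b * ginv a * ginv b"

text \<open>The exchange law makes the product of the two cyclic groups stable under left
  multiplication by either generator. It is applied to \<open>y, z\<close> and also to
  \<open>y\<close> with the square of \<open>z\<close>.\<close>

lemma gen_pair_normal_form:
  assumes closed: "\<And>i j. \<exists>k l. z \<up> i * y \<up> j = y \<up> k * z \<up> l"
  shows "a \<in> gen {y, z} \<Longrightarrow> \<exists>k l. a = y \<up> k * z \<up> l"
proof (induction rule: gen.induct)
  case gen_one
  have "1 = y \<up> 0 * z \<up> 0" by simp
  then show ?case by blast
next
  case (gen_mult s a)
  then obtain k l where a: "a = y \<up> k * z \<up> l" by blast
  show ?case
  proof (cases "s = y")
    case True
    then have "s * a = y \<up> (1 + k) * z \<up> l" by (simp add: a gpow_add mult.assoc)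
    then show ?thesis by blast
  next
    case False
    then have s: "s = z \<up> 1" using gen_mult by simp
    obtain k' l' where "z \<up> 1 * y \<up> k = y \<up> k' * z \<up> l'" using closed by blast
    then have "s * a = y \<up> k' * z \<up> (l' + l)" by (simp add: s a gpow_add flip: mult.assoc)
    then show ?thesis by blast
  qed
next
  case (gen_inv s a)
  then obtain k l where a: "a = y \<up> k * z \<up> l" by blast
  show ?case
  proof (cases "s = y")
    case True
    then have "ginv s * a = y \<up> (- 1 + k) * z \<up> l" unfolding a gpow_add by (simp add: mult.assoc)
    then show ?thesis by blast
  next
    case False
    then have s: "ginv s = z \<up> (- 1)" using gen_inv by simp
    obtain k' l' where *: "z \<up> (- 1) * y \<up> k = y \<up> k' * z \<up> l'" using closed by blast
    have "ginv s * a = y \<up> k' * z \<up> (l' + l)"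
      unfolding s a gpow_add by (simp only: * flip: mult.assoc)
    then show ?thesis by blast
  qed
qed

text \<open>The rotations of a tight polyhedron: \<open>y * z\<close> is the involution
  \<open>\<rho>\<^sub>1\<rho>\<^sub>3\<close>, \<open>closed\<close> is what tightness provides, and
  \<open>triv\<close> makes the factors of a normal form unique. Orders of the generators do not
  occur, so the locale passes to a quotient as soon as \<open>triv\<close> survives there.\<close>

locale rot_pair =
  fixes y z :: "'a::mult_group"
  assumes inv_yz: "y * z * y * z = 1"
    and closed: "\<exists>k l. z \<up> i * y \<up> j = y \<up> k * z \<up> l"
    and triv: "y \<up> i = z \<up> j \<Longrightarrow> y \<up> i = 1"
begin

lemma closed': "\<exists>k l. y \<up> i * z \<up> j = z \<up> k * y \<up> l"
proof -
  obtain k l where "z \<up> (- j) * y \<up> (- i) = y \<up> k * z \<up> l" using closed by blast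
  then have "ginv (z \<up> (- j) * y \<up> (- i)) = ginv (y \<up> k * z \<up> l)" by simp
  then show ?thesis by (simp add: gpow_minus) (metis gpow_minus)
qed

lemma normal_form_eq:
  assumes "y \<up> i * z \<up> j = y \<up> k * z \<up> l"
  shows "y \<up> i = y \<up> k" "z \<up> j = z \<up> l"
proof -
  have "y \<up> (- k) * (y \<up> i * z \<up> j) * z \<up> (- j) = y \<up> (- k) * (y \<up> k * z \<up> l) * z \<up> (- j)"
    using assms by simp
  then have *: "y \<up> (i - k) = z \<up> (l - j)"
    by (simp add: gpow_add gpow_minus gpow_diff mult.assoc) (metis gpow_gpow_commute gpow_minus)
  with triv have "y \<up> (i - k) = 1" by blast
  then show "y \<up> i = y \<up> k" by (metis add.commute diff_add_cancel gpow_add mult_1_right)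
  with assms show "z \<up> j = z \<up> l" by simp
qed

lemma normal_form_one:
  assumes "y \<up> i * z \<up> j = 1"
  shows "y \<up> i = 1" "z \<up> j = 1"
  using normal_form_eq[of i j 0 0] assms by simp_all

lemma gen_normal_form: "a \<in> gen {y, z} \<Longrightarrow> \<exists>k l. a = y \<up> k * z \<up> l"
  by (rule gen_pair_normal_form[OF closed])

text \<open>Ito's argument: conjugating a commutator by \<open>a\<^sub>1 b\<^sub>1\<close> and by \<open>b\<^sub>1 a\<^sub>1\<close> gives the same result.\<close>

lemma commut_commute:
  "commut (y \<up> i) (z \<up> j) * commut (y \<up> m) (z \<up> n) = commut (y \<up> m) (z \<up> n) * commut (y \<up> i) (z \<up> j)"
proof -
  \<comment> \<open>The negative exponents make the discrepancy between the two orders of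
    conjugation, \<open>ginv (b1 * a1) * (a1 * b1)\<close>, equal to
    \<open>commut (y \<up> m) (z \<up> n)\<close>.\<close>
  define a b a1 b1 where "a = y \<up> i" and "b = z \<up> j" and "a1 = y \<up> (- m)" and "b1 = z \<up> (- n)"
  obtain k l where "y \<up> (- m) * z \<up> j = z \<up> k * y \<up> l" using closed' by blast
  then have "a1 * b * ginv a1 = z \<up> k * y \<up> (l + m)"
    by (simp add: a1_def b_def gpow_add gpow_minus mult.assoc)
  then obtain b2 a2 where b: "cj a1 b = b2 * a2" "a2 \<in> range (\<lambda>k. y \<up> k)" "b2 \<in> range (\<lambda>k. z \<up> k)"
    unfolding cj_def by blast
  obtain k' l' where *: "z \<up> (- n) * y \<up> i = y \<up> k' * z \<up> l'" using closed by blast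
  then have "b1 * a * ginv b1 = y \<up> k' * z \<up> (l' + n)"
    by (simp add: b1_def a_def gpow_add gpow_minus mult.assoc)
  then obtain b3 a3 where a: "cj b1 a = a3 * b3" "a3 \<in> range (\<lambda>k. y \<up> k)" "b3 \<in> range (\<lambda>k. z \<up> k)"
    unfolding cj_def by blast
  have y1: "cj a1 a = a" "cj a1 a3 = a3"
    using a(2) unfolding a1_def a_def cj_fix_iff by (auto intro: gpow_gpow_commute)
  have z1: "cj b1 b = b" "cj b1 b2 = b2"
    using b(3) unfolding b1_def b_def cj_fix_iff by (auto intro: gpow_gpow_commute)
  have ya: "a * a2 = a2 * a" "a3 * a2 = a2 * a3"
    using a(2) b(2) unfolding a_def by (auto intro: gpow_gpow_commute)
  have zb: "b3 * b = b * b3" "b3 * b2 = b2 * b3"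
    using a(3) b(3) unfolding b_def by (auto intro: gpow_gpow_commute)
  have right: "commut p (q * r) = commut p q" if "p * r = r * p" for p q r :: 'a
  proof -
    have "commut p (q * r) = p * q * (r * ginv p) * ginv r * ginv q" by (simp add: commut_def mult.assoc)
    also have "r * ginv p = ginv p * r" using that
      by (metis cj_fix_iff cj_fix_ginv)
    finally show ?thesis by (simp add: commut_def mult.assoc)
  qed
  have left: "commut (p * r) q = commut p q" if "r * q = q * r" for p q r :: 'a
  proof -
    have "commut (p * r) q = p * (r * q) * ginv r * ginv p * ginv q" by (simp add: commut_def mult.assoc)
    also have "r * q = q * r" by fact
    finally show ?thesis by (simp add: commut_def mult.assoc)
  qed
  have cj: "cj g (commut p q) = commut (cj g p) (cj g q)" for g p q :: 'a
    by (simp add: commut_def)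
  \<comment> \<open>Conjugation by \<open>a1\<close> fixes \<open>a\<close> and turns
    \<open>b\<close> into \<open>b2 * a2\<close>, where \<open>a2\<close> drops out because it
    commutes with \<open>a\<close>; \<open>b1\<close> then does the same with the roles
    exchanged.\<close>
  have "cj b1 (cj a1 (commut a b)) = cj b1 (commut a b2)"
    by (simp add: cj y1 b right ya)
  also have "\<dots> = commut a3 b2" by (simp add: cj z1 a left zb)
  finally have 1: "cj (b1 * a1) (commut a b) = commut a3 b2" by (simp add: cj_cj)
  have "cj a1 (cj b1 (commut a b)) = cj a1 (commut a3 b)"
    by (simp add: cj z1 a left zb)
  also have "\<dots> = commut a3 b2" by (simp add: cj y1 b right ya)
  finally have 2: "cj (a1 * b1) (commut a b) = commut a3 b2" by (simp add: cj_cj)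
  have "cj (ginv (b1 * a1) * (a1 * b1)) (commut a b) = commut a b"
    by (metis 1 2 cj_cj cj_ginv_cj(1))
  moreover have "ginv (b1 * a1) * (a1 * b1) = commut (y \<up> m) (z \<up> n)"
    by (simp add: commut_def a1_def b1_def gpow_minus mult.assoc)
  ultimately show ?thesis by (metis a_def b_def cj_fix_iff)
qed

section \<open>The commutator subgroup of a rotation pair\<close>

definition u where "u = y * z"

lemma u_sq: "u * u = 1"
  using inv_yz by (simp add: u_def mult.assoc)

lemma ginv_u: "ginv u = u"
  by (rule ginv_unique) (rule u_sq)

lemma z_eq: "z = ginv y * u"
  by (simp add: u_def)

lemma zy_sq: "z * y * z * y = 1"
  by (metis ginv_left inv_yz group_cancel_left mult.assoc mult_1_left mult_1_right)

text \<open>\<open>V\<close> is the commutator subgroup of \<open>\<langle>y,z\<rangle>\<close>. It is abelian and inverted by the involution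
  \<open>u = yz\<close>, so that \<open>z\<close> acts on \<open>V\<close> as \<open>y\<^sup>-\<^sup>1\<close> followed by inversion.\<close>

definition shift_comm :: "int \<Rightarrow> 'a" where "shift_comm k = cj (y \<up> k) (z * z * y * y)"

definition V where "V = gen (range shift_comm)"

lemma V_one: "1 \<in> V" and V_times: "a \<in> V \<Longrightarrow> b \<in> V \<Longrightarrow> a * b \<in> V"
  and V_ginv: "a \<in> V \<Longrightarrow> ginv a \<in> V"
  unfolding V_def by (auto intro: gen_one gen_times gen_ginv)

lemma shift_in_V: "shift_comm k \<in> V"
  unfolding V_def by (auto intro: gen_incl)

text \<open>Since \<open>z * y = ginv y * ginv z\<close>, the first word is the commutator of
  \<open>z\<close> and \<open>ginv y\<close>; the other two are its conjugates by \<open>y\<close>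
  and \<open>y * y\<close>.\<close>

lemma V_c: "z * z * y * y \<in> V" "y * z * z * y \<in> V" "y * y * z * z \<in> V"
  using shift_in_V[of 0] shift_in_V[of 1] shift_in_V[of 2]
  by (simp_all add: shift_comm_def cj_def gpow_2 mult.assoc)

lemma cj_y_V: "a \<in> V \<Longrightarrow> cj (y \<up> n) a \<in> V"
  unfolding V_def
proof (rule gen_cj_closed)
  fix s assume "s \<in> range shift_comm"
  then obtain k where "s = shift_comm k" by blast
  then have "cj (y \<up> n) s = shift_comm (n + k)" by (simp add: shift_comm_def cj_cj gpow_add)
  then show "cj (y \<up> n) s \<in> gen (range shift_comm)" by (auto intro: gen_incl)
qed

lemma cj_y_V1: "a \<in> V \<Longrightarrow> cj y a \<in> V" "a \<in> V \<Longrightarrow> cj (ginv y) a \<in> V"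
  using cj_y_V[of a 1] cj_y_V[of a "- 1"] by simp_all

abbreviation "commuts \<equiv> {commut (y \<up> i) (z \<up> j) | i j. True}"

lemma gen_commuts_commute: "a \<in> gen commuts \<Longrightarrow> b \<in> gen commuts \<Longrightarrow> a * b = b * a"
  by (rule gen_commute[of commuts]) (use commut_commute in auto)

lemma commuts_z: "commut (y \<up> i) z \<in> gen commuts"
  by (rule gen_incl) (metis (mono_tags, lifting) gpow_1 mem_Collect_eq)

text \<open>As \<open>u\<close> is an involution, this element is the commutator of
  \<open>y \<up> i\<close> and \<open>u\<close>; expanding \<open>u = y * z\<close> leaves two
  commutators covered by Ito's argument.\<close>

lemma cj_u_in: "cj (y \<up> i) u * u \<in> gen commuts"
proof -
  have e: "ginv (y \<up> (i + 1)) = ginv (y \<up> i) * ginv y" by (metis gpow_Suc ginv_mult)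
  have "cj (y \<up> i) u * u = y \<up> i * y * z * ginv (y \<up> i) * ginv u"
    by (simp add: cj_def u_def mult.assoc ginv_u[unfolded u_def, simplified])
  also have "\<dots> = y \<up> (i + 1) * z * ginv (y \<up> (i + 1)) * ginv z * (z * y * ginv z * ginv y)"
    unfolding e by (simp add: gpow_add u_def mult.assoc)
  also have "\<dots> = commut (y \<up> (i + 1)) z * ginv (commut (y \<up> 1) z)"
    by (simp add: commut_def mult.assoc)
  finally show ?thesis
    using commuts_z by (simp only:) (intro gen_times gen_ginv)
qed

text \<open>A generator of \<open>V\<close> is a product of two neighbouring conjugates of
  \<open>u\<close>. Inserting \<open>u * u\<close> between them gives a quotient of elements
  \<open>cj (y \<up> i) u * u\<close>, which commute with one another and, being products of two
  involutions one of which is \<open>u\<close>, are inverted by \<open>u\<close>. Both main facts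
  about \<open>V\<close> follow from this form.\<close>

lemma shift_eq: "shift_comm k = (cj (y \<up> (k - 1)) u * u) * ginv (cj (y \<up> (k - 2)) u * u)"
proof -
  have e: "y \<up> (k - 2) = y \<up> (k - 1) * ginv y" "y \<up> k = y \<up> (k - 1) * y"
    using gpow_add[of y "k - 1" "- 1"] gpow_add[of y "k - 1" 1] by simp_all
  have "ginv (cj (y \<up> (k - 2)) u * u) = u * cj (y \<up> (k - 2)) u"
    using ginv_u by (metis cj_ginv ginv_mult)
  then have "(cj (y \<up> (k - 1)) u * u) * ginv (cj (y \<up> (k - 2)) u * u)
     = cj (y \<up> (k - 1)) u * (u * u) * cj (y \<up> (k - 2)) u" by (simp add: mult.assoc)
  also have "\<dots> = cj (y \<up> (k - 1)) u * cj (y \<up> (k - 2)) u" by (simp add: u_sq)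
  also have "\<dots> = cj (y \<up> (k - 1)) (u * cj (ginv y) u)"
    by (simp add: e cj_cj)
  also have "u * cj (ginv y) u = cj y (z * z * y * y)"
    by (simp add: cj_def u_def mult.assoc)
  finally show ?thesis by (simp only: shift_comm_def e(2) cj_cj)
qed

lemma shift_in_commuts: "shift_comm k \<in> gen commuts"
  unfolding shift_eq by (rule gen_times[OF cj_u_in gen_ginv[OF cj_u_in]])

lemma V_commuts: "V \<subseteq> gen commuts"
proof
  fix a assume "a \<in> V"
  then show "a \<in> gen commuts" unfolding V_def
  proof (induction rule: gen.induct)
    case gen_one
    show ?case by (rule gen.gen_one)
  next
    case (gen_mult s a)
    then show ?case using gen_times[OF shift_in_commuts] by blast
  next
    case (gen_inv s a)
    then show ?case using gen_times[OF gen_ginv[OF shift_in_commuts]] by blast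
  qed
qed

lemma V_commute: "a \<in> V \<Longrightarrow> b \<in> V \<Longrightarrow> a * b = b * a"
  using V_commuts gen_commuts_commute by blast

lemma V_cj: "a \<in> V \<Longrightarrow> b \<in> V \<Longrightarrow> cj a b = b"
  by (simp add: V_commute cj_fix_iff)

lemma cj_u_inv: "cj u (cj (y \<up> i) u * u) = ginv (cj (y \<up> i) u * u)"
  using u_sq ginv_u by (simp add: cj_def mult.assoc)

lemma u_inverts: "a \<in> V \<Longrightarrow> cj u a = ginv a"
  unfolding V_def
proof (induction rule: gen.induct)
  case gen_one
  show ?case by simp
next
  have *: "cj u (shift_comm k) = ginv (shift_comm k)" for k
    unfolding shift_eq
    by (simp only: cj_mult[of u "cj _ _ * _"] cj_u_inv cj_ginv ginv_mult[of "cj _ _ * _"])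
      (intro gen_commuts_commute gen_ginv cj_u_in)
  {
    case (gen_mult s a)
    then have "s \<in> V" "a \<in> V" by (auto simp: V_def intro: gen_incl)
    then have "ginv a * ginv s = ginv s * ginv a" by (intro V_commute V_ginv)
    then show ?case using gen_mult * by auto
  next
    case (gen_inv s a)
    then have "s \<in> V" "a \<in> V" by (auto simp: V_def intro: gen_incl)
    then have "s * ginv a = ginv a * s" by (intro V_commute V_ginv)
    then show ?case using gen_inv * by auto
  }
qed

lemma cj_z_V: "a \<in> V \<Longrightarrow> cj z a = ginv (cj (ginv y) a)"
  by (subst z_eq) (simp add: u_inverts flip: cj_cj)

lemma cj_z_in_V: "a \<in> V \<Longrightarrow> cj z a \<in> V"
  by (simp add: cj_z_V V_ginv cj_y_V1)

text \<open>The two inversions in the action of \<open>z\<close> cancel.\<close>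

lemma cj_zz_V: "a \<in> V \<Longrightarrow> cj (z * z) a = cj (ginv (y * y)) a"
  by (simp add: cj_z_V cj_z_in_V cj_y_V1 V_ginv flip: cj_cj)

lemma cj_zz_in_V: "a \<in> V \<Longrightarrow> cj (z * z) a \<in> V" "a \<in> V \<Longrightarrow> cj (ginv (z * z)) a \<in> V"
proof -
  show "a \<in> V \<Longrightarrow> cj (z * z) a \<in> V"
    by (simp add: cj_z_in_V flip: cj_cj)
  assume a: "a \<in> V"
  have "cj (z * z) (cj (y * y) a) = a"
    using a by (simp add: cj_zz_V cj_y_V1 flip: cj_cj[of y y]) (simp flip: cj_cj)
  then have "cj (ginv (z * z)) a = cj (y * y) a" by (metis cj_ginv_cj(1))
  then show "cj (ginv (z * z)) a \<in> V" using a by (simp add: cj_y_V1 flip: cj_cj)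
qed

text \<open>Modulo \<open>V\<close> the squares of \<open>z\<close> and of \<open>ginv y\<close>
  coincide. The induction wraps one more \<open>z * z\<close> and \<open>y * y\<close> around the
  word, at the cost of a conjugation and a factor from \<open>V_c\<close>.\<close>

lemma zz_yy_pow: "(z * z) \<up> m * (y * y) \<up> m \<in> V"
proof (induction m rule: int_induct[where k = 0])
  case base
  show ?case by (simp add: V_one)
next
  case (step1 i)
  have "(z * z) \<up> (1 + i) * (y * y) \<up> (i + 1) = cj (z * z) ((z * z) \<up> i * (y * y) \<up> i) * (z * z * y * y)"
    by (simp only: gpow_add) (simp add: cj_def mult.assoc)
  then show ?case using V_times[OF cj_zz_in_V(1)[OF step1(2)] V_c(1)] by (simp add: add.commute)
next
  case (step2 i)
  have "(z * z) \<up> (- 1 + i) * (y * y) \<up> (i + - 1)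
    = cj (ginv (z * z)) ((z * z) \<up> i * (y * y) \<up> i) * ginv (y * y * z * z)"
    by (simp only: gpow_add) (simp add: cj_def mult.assoc)
  then show ?case using V_times[OF cj_zz_in_V(2)[OF step2(2)] V_ginv[OF V_c(3)]] by (simp add: add.commute)
qed

lemma commut_zz_y: "commut ((z * z) \<up> m) (y \<up> n) \<in> V"
proof -
  let ?v = "(z * z) \<up> m * (y * y) \<up> m"
  have *: "(y * y) \<up> m * y \<up> n = y \<up> n * (y * y) \<up> m"
    by (simp add: gpow_gpow_commute flip: gpow_2 gpow_mult)
  have "cj (y \<up> n) (ginv ?v) = y \<up> n * ginv ((y * y) \<up> m) * ginv ((z * z) \<up> m) * ginv (y \<up> n)"
    by (simp add: cj_def mult.assoc)
  also have "y \<up> n * ginv ((y * y) \<up> m) = ginv ((y * y) \<up> m) * y \<up> n"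
    using * by (metis cj_fix_ginv cj_fix_iff)
  finally have "?v * cj (y \<up> n) (ginv ?v) = commut ((z * z) \<up> m) (y \<up> n)"
    by (simp add: commut_def mult.assoc)
  then show ?thesis using V_times[OF zz_yy_pow[of m] cj_y_V[OF V_ginv[OF zz_yy_pow[of m]], of n]] by simp
qed

text \<open>The generators of \<open>V\<close> contain \<open>z\<close> only through its square.
  Where \<open><y><z * z>\<close> is a group, elements of \<open>V\<close> therefore have normal
  forms with an even exponent of \<open>z\<close>.\<close>

lemma V_gen: "a \<in> V \<Longrightarrow> a \<in> gen {y, z * z}"
  unfolding V_def
proof (induction rule: gen.induct)
  case gen_one
  show ?case by (rule gen.gen_one)
next
  have *: "shift_comm k \<in> gen {y, z * z}" for k
  proof -
    have y: "y \<in> gen {y, z * z}" and z: "z * z \<in> gen {y, z * z}" by (auto intro: gen_incl)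
    show ?thesis unfolding shift_comm_def cj_def
      by (rule gen_times[OF gen_times[OF gen_gpow[OF y] gen_times[OF gen_times[OF z y] y]]
            gen_ginv[OF gen_gpow[OF y]]])
  qed
  {
    case (gen_mult s a)
    then show ?case using gen_times[OF *] by blast
  next
    case (gen_inv s a)
    then show ?case using gen_times[OF gen_ginv[OF *]] by blast
  }
qed

lemma V_gen': "a \<in> V \<Longrightarrow> a \<in> gen {y, z}"
proof -
  have s: "s \<in> gen {y, z}" if "s \<in> {y, z * z}" for s
    using that gen_incl[of y "{y, z}"] gen_times[OF gen_incl gen_incl, of z "{y, z}" z] by auto
  have "a \<in> gen {y, z * z} \<Longrightarrow> a \<in> gen {y, z}"
    by (induction rule: gen.induct) (simp_all add: gen_one gen_times gen_ginv s del: ginv_mult)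
  then show "a \<in> V \<Longrightarrow> ?thesis" using V_gen by blast
qed

end

section \<open>Commuting squares\<close>

lemma cj_cj_swap: "cj r (cj y d) = cj (cj r y) (cj r (d::'a::mult_group))"
  by (simp add: cj_def mult.assoc)

lemma gpow_mod2:
  fixes x :: "'a::mult_group"
  assumes "x * x = 1"
  shows "even n \<Longrightarrow> x \<up> n = 1" "odd n \<Longrightarrow> x \<up> n = x"
proof -
  have *: "x \<up> (2 * m) = 1" for m by (simp add: gpow_mult gpow_2 assms)
  show "even n \<Longrightarrow> x \<up> n = 1" using * by (auto elim!: evenE)
  show "odd n \<Longrightarrow> x \<up> n = x" using * by (auto elim!: oddE simp: gpow_add)
qed

text \<open>A cyclic group has at most one involution. For the gcd \<open>h\<close> of the exponents
  Bezout gives \<open>x \<up> (h + h) = 1\<close>; both cofactors must be odd, so both powers equal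
  \<open>x \<up> h\<close>.\<close>

lemma gpow_involution_unique:
  fixes x :: "'a::mult_group"
  assumes "x \<up> i * x \<up> i = 1" "x \<up> j * x \<up> j = 1" "x \<up> i \<noteq> 1" "x \<up> j \<noteq> 1"
  shows "x \<up> i = x \<up> j"
proof -
  define h where "h = gcd i j"
  obtain a b where ab: "i = h * a" "j = h * b" unfolding h_def by (meson dvdE gcd_dvd1 gcd_dvd2)
  obtain s t where "s * i + t * j = h" unfolding h_def using bezout_int by blast
  then have "h + h = (i + i) * s + (j + j) * t" by (simp add: algebra_simps flip: mult_2)
  moreover have "x \<up> ((i + i) * s + (j + j) * t) = 1"
    by (simp only: gpow_add gpow_mult assms gpow_one mult_1_left)
  ultimately have "x \<up> (h + h) = 1" by metis
  then have h: "x \<up> h * x \<up> h = 1" by (simp only: gpow_add)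
  have "odd a" "odd b" using gpow_mod2(1)[OF h] assms(3,4) by (auto simp: ab gpow_mult)
  then show ?thesis using gpow_mod2(2)[OF h] by (simp add: ab gpow_mult)
qed

lemma cj_scaled_pow:
  fixes a b d :: "'a::mult_group"
  assumes "cj a b = d * b" "cj a d = d"
  shows "cj (a \<up> n) b = d \<up> n * b"
proof (induction n rule: int_induct[where k = 0])
  case base
  show ?case by (simp add: cj_def)
next
  case (step1 i)
  have "cj (a \<up> (1 + i)) b = cj a (d \<up> i * b)" by (simp add: gpow_add step1 flip: cj_cj)
  also have "\<dots> = d \<up> (i + 1) * b" by (simp add: assms gpow_add mult.assoc)
  finally show ?case by (simp add: add.commute)
next
  case (step2 i)
  have "cj a (cj (a \<up> (- 1 + i)) b) = cj (a \<up> i) b" unfolding gpow_add by (simp add: cj_cj)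
  also have "\<dots> = cj a (d \<up> (i - 1) * b)" using gpow_add[of d "i - 1" 1]
    by (simp add: assms step2 mult.assoc)
  finally have "cj (a \<up> (- 1 + i)) b = d \<up> (i - 1) * b" by (simp only: cj_inj)
  then show ?case by simp
qed

context rot_pair
begin

lemma dual: "rot_pair z y"
proof
  show "z * y * z * y = 1" by (rule zy_sq)
  show "\<exists>k l. y \<up> i * z \<up> j = z \<up> k * y \<up> l" for i j by (rule closed')
  show "z \<up> i = 1" if "z \<up> i = y \<up> j" for i j using triv[of j i] that by simp
qed

lemma zy_eq: "z * y = ginv y * ginv z"
  by (metis ginv_mult ginv_unique mult.assoc zy_sq)

lemma cj_zy_zz: "cj z (cj y (z * z)) = cj (ginv y) (z * z)"
  unfolding cj_cj zy_eq by (simp add: cj_def mult.assoc)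

text \<open>If \<open>y * y\<close> centralizes \<open>z * z\<close>, then \<open>y\<close> and
  \<open>ginv y\<close> conjugate it to the same element, and \<open>cj_zy_zz\<close> says that
  \<open>z\<close> fixes this element. Hence \<open>z\<close> centralizes the \<open>y\<close>-part
  of its normal form.\<close>

lemma squares_commute_conj:
  assumes "z * z * (y * y) = y * y * (z * z)"
  obtains a b where "cj y (z * z) = y \<up> a * z \<up> b" "z * y \<up> a = y \<up> a * z"
proof -
  have "y * (z * z) * ginv y \<in> gen {y, z}"
    by (intro gen_times gen_ginv gen_incl) auto
  then obtain a b where ab: "cj y (z * z) = y \<up> a * z \<up> b" using gen_normal_form unfolding cj_def by blast
  have "cj (y * y) (z * z) = z * z" unfolding cj_fix_iff using assms by simp
  then have "cj (ginv y) (z * z) = cj y (z * z)" by (metis cj_cj cj_ginv_cj(1))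
  then have "cj z (y \<up> a * z \<up> b) = y \<up> a * z \<up> b" using cj_zy_zz ab by (simp only:)
  then have "cj z (y \<up> a) = y \<up> a" by (metis cj_mult cj_gpow cj_self group_cancel_right)
  then show ?thesis using that ab unfolding cj_fix_iff by blast
qed

text \<open>If \<open>y\<^sup>2\<close> and \<open>z\<^sup>2\<close> commute, then inverting both generators respects all relations.\<close>

lemma squares_commute_regular:
  assumes c: "z * z * (y * y) = y * y * (z * z)"
  shows "\<exists>k l. z * y \<up> j = y \<up> k * z \<up> l \<and> ginv z * y \<up> (- j) = y \<up> (- k) * z \<up> (- l)"
proof -
  interpret d: rot_pair z y by (rule dual)
  obtain b a where ba: "cj z (y * y) = z \<up> b * y \<up> a" "y * z \<up> b = z \<up> b * y"
    using d.squares_commute_conj c by metis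
  have com: "z \<up> (b * n) * y \<up> m = y \<up> m * z \<up> (b * n)" for n m
  proof -
    have "cj (z \<up> b) y = y" unfolding cj_fix_iff using ba(2) by simp
    from cj_fix_gpow2[OF this, of n m] show ?thesis unfolding cj_fix_iff gpow_mult .
  qed
  have p: "cj z ((y * y) \<up> n) = y \<up> (a * n) * z \<up> (b * n)" for n
  proof -
    have ab: "z \<up> b * y \<up> a = y \<up> a * z \<up> b" using com[of 1 a] by simp
    have "(z \<up> b * y \<up> a) \<up> n = z \<up> (b * n) * y \<up> (a * n)"
      unfolding gpow_mult by (rule gpow_mult_distrib[OF ab])
    then show ?thesis by (simp only: cj_gpow ba com)
  qed
  \<comment> \<open>So \<open>z\<close> and \<open>ginv z\<close> carry even powers of
    \<open>y\<close> to the same elements; this is what produces opposite exponents in the two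
    normal forms.\<close>
  have "cj (z * z) (y * y) = y * y" unfolding cj_fix_iff using c by simp
  then have "cj (ginv z) (y * y) = cj z (y * y)" by (metis cj_cj cj_ginv_cj(1))
  then have q: "cj (ginv z) ((y * y) \<up> n) = y \<up> (a * n) * z \<up> (b * n)" for n
    using p[of n] by simp
  have P: "z * (y * y) \<up> n = y \<up> (a * n) * z \<up> (b * n) * z" for n
    using p[of n] cj_mult_left[of z "(y * y) \<up> n"] by simp
  have Q: "ginv z * (y * y) \<up> n = y \<up> (a * n) * z \<up> (b * n) * ginv z" for n
    using q[of n] cj_mult_left[of "ginv z" "(y * y) \<up> n"] by simp
  have sq: "(y * y) \<up> n = y \<up> (2 * n)" for n by (simp add: gpow_mult gpow_2)
  show ?thesis
  proof (cases "even j")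
    case True
    then obtain n where j: "j = 2 * n" by (auto elim: evenE)
    have "z * y \<up> j = y \<up> (a * n) * z \<up> (b * n + 1)"
      using P[of n] by (simp add: j sq gpow_add mult.assoc)
    moreover have "ginv z * y \<up> (- j) = y \<up> (- (a * n)) * z \<up> (- (b * n + 1))"
      using Q[of "- n"] gpow_add[of z "- (b * n)" "- 1"] by (simp add: j sq mult.assoc)
    ultimately show ?thesis by blast
  next
    case False
    \<comment> \<open>The extra factor is absorbed by \<open>z * y = ginv y * ginv z\<close>, which
      turns the odd case for \<open>z\<close> into the even case for \<open>ginv z\<close>, and
      conversely.\<close>
    then obtain n where j: "j = 2 * n + 1" by (auto elim: oddE)
    have "z * y \<up> j = z * y * y \<up> (2 * n)" by (simp add: j gpow_add gpow_gpow_commute[of y 1, simplified] mult.assoc)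
    also have "\<dots> = ginv y * (ginv z * (y * y) \<up> n)" by (simp only: zy_eq sq mult.assoc)
    also have "\<dots> = y \<up> (- 1 + a * n) * z \<up> (b * n + - 1)" unfolding Q gpow_add by (simp add: mult.assoc)
    finally have 1: "z * y \<up> j = y \<up> (- 1 + a * n) * z \<up> (b * n + - 1)" .
    have mj: "- j = - 1 + 2 * (- n)" by (simp add: j)
    have "ginv z * y \<up> (- j) = ginv z * ginv y * y \<up> (2 * (- n))"
      unfolding mj gpow_add by (simp add: mult.assoc)
    also have "ginv z * ginv y = y * z" by (metis ginv_mult ginv_u u_def)
    also have "y * z * y \<up> (2 * (- n)) = y * (z * (y * y) \<up> (- n))" by (simp only: sq mult.assoc)
    also have "\<dots> = y \<up> (1 + a * (- n)) * z \<up> (b * (- n) + 1)" unfolding P gpow_add by (simp add: mult.assoc)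
    finally have "ginv z * y \<up> (- j) = y \<up> (- (- 1 + a * n)) * z \<up> (- (b * n + - 1))" by simp
    with 1 show ?thesis by blast
  qed
qed

text \<open>The commutator \<open>d\<close> of \<open>z\<^sup>2\<close> and \<open>y\<^sup>2\<close> is fixed by \<open>r\<close>, so by uniqueness of normal forms it is a
  product of two involutions \<open>\<eta> \<in> \<langle>y\<rangle>\<close> and \<open>\<theta> \<in> \<langle>g\<rangle>\<close>. It is central: the only other possibility is
  that \<open>y\<close> permutes three conjugates of \<open>d\<close> cyclically, which is incompatible with normal forms.
  Finally \<open>y z\<^sup>2 y\<close> is inverted by \<open>r\<close>, so its two factors commute, whereas each of them commutes
  with the square of the other generator only up to \<open>d\<close>.\<close>

lemma squares_commute:
  assumes ry: "cj r y = ginv y" and rg: "cj r g = ginv g" and gp: "g = z \<up> p"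
    and rzz: "cj r (z * z) = ginv (z * z)"
    and nf: "\<And>a. a \<in> V \<Longrightarrow> \<exists>i j. a = y \<up> i * g \<up> j"
  shows "z * z * (y * y) = y * y * (z * z)"
proof -
  define c c' d where "c = z * z * y * y" and "c' = y * y * z * z" and "d = c * ginv c'"
  have cV: "c \<in> V" "c' \<in> V" "d \<in> V" unfolding c_def c'_def d_def by (intro V_c V_times V_ginv)+
  have rzz': "cj r z * (cj r z * a) = ginv z * (ginv z * a)" for a
    using rzz by (metis cj_mult ginv_mult mult.assoc)
  have rc: "cj r c = ginv c'" "cj r c' = ginv c"
    using rzz ry rzz' by (simp_all add: c_def c'_def mult.assoc)
  have rd: "cj r d = d"
    using V_commute[of "ginv c'" c] cV V_ginv by (simp add: d_def rc)
  \<comment> \<open>\<open>r\<close> inverts both factors, so an element fixed by \<open>r\<close>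
    has two normal forms; uniqueness makes each factor its own inverse.\<close>
  have nf_inv: "y \<up> i * y \<up> i = 1 \<and> g \<up> j * g \<up> j = 1" if "cj r (y \<up> i * g \<up> j) = y \<up> i * g \<up> j" for i j
  proof -
    have "y \<up> (- i) * g \<up> (- j) = y \<up> i * g \<up> j"
      using that by (simp add: ry rg gpow_minus gpow_ginv)
    then have "y \<up> (- i) * z \<up> (p * - j) = y \<up> i * z \<up> (p * j)"
      unfolding gp gpow_mult .
    from normal_form_eq[OF this] have "ginv (y \<up> i) = y \<up> i" "ginv (g \<up> j) = g \<up> j"
      by (simp_all add: gpow_minus gp gpow_mult)
    then show ?thesis by (metis ginv_left)
  qed
  obtain k l where d: "d = y \<up> k * g \<up> l" using nf cV by blast
  define \<eta> \<theta> where "\<eta> = y \<up> k" and "\<theta> = g \<up> l"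
  have d_eq: "d = \<eta> * \<theta>" by (simp add: d \<eta>_def \<theta>_def)
  have sq: "\<eta> * \<eta> = 1" "\<theta> * \<theta> = 1"
    using nf_inv[of k l] rd d by (simp_all add: \<eta>_def \<theta>_def)
  then have gi: "ginv \<eta> = \<eta>" "ginv \<theta> = \<theta>" by (auto intro: ginv_unique)
  have fixed: "\<exists>a b. v = a * b \<and> (a = 1 \<or> \<eta> = 1 \<or> a = \<eta>) \<and> (b = 1 \<or> \<theta> = 1 \<or> b = \<theta>)"
    if v: "v \<in> V" "cj r v = v" for v
  proof -
    obtain i j where ij: "v = y \<up> i * g \<up> j" using nf v by blast
    with v nf_inv have s: "y \<up> i * y \<up> i = 1" "g \<up> j * g \<up> j = 1" by blast+
    have "y \<up> i = 1 \<or> \<eta> = 1 \<or> y \<up> i = \<eta>"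
      using gpow_involution_unique[OF s(1), of k] sq by (auto simp: \<eta>_def)
    moreover have "g \<up> j = 1 \<or> \<theta> = 1 \<or> g \<up> j = \<theta>"
      using gpow_involution_unique[OF s(2), of l] sq by (auto simp: \<theta>_def)
    ultimately show ?thesis using ij by blast
  qed
  have \<eta>\<theta>_triv: "\<eta> = \<theta> \<Longrightarrow> \<eta> = 1"
    using triv[of k "p * l"] by (simp add: \<eta>_def \<theta>_def gp gpow_mult)
  have com: "\<theta> * \<eta> = \<eta> * \<theta>"
  proof -
    have gd: "ginv d = \<theta> * \<eta>" by (simp add: d_eq gi)
    have "ginv d \<in> V" "cj r (ginv d) = ginv d" using cV rd V_ginv by simp_all
    from fixed[OF this] show ?thesis unfolding gd using \<eta>\<theta>_triv
      by (metis gi(2) ginv_unique group_cancel_left group_cancel_right mult_1_left mult_1_right)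
  qed
  have dd: "d * d = 1"
    by (simp add: d_eq com mult.assoc) (simp add: sq com flip: mult.assoc)
  have central: "cj y d = d"
  proof (cases "\<eta> \<in> V")
    case True
    \<comment> \<open>Here \<open>\<theta>\<close> lies in \<open>V\<close> too. It is fixed by
      \<open>z\<close> as a power of \<open>g\<close>, hence also by \<open>y\<close>, because
      \<open>z\<close> acts on \<open>V\<close> as \<open>ginv y\<close> followed by inversion and
      \<open>ginv \<theta> = \<theta>\<close>.\<close>
    have "\<theta> = \<eta> * d" by (simp add: d_eq sq flip: mult.assoc)
    then have "\<theta> \<in> V" using True cV V_times by simp
    moreover have "cj z \<theta> = \<theta>" by (simp add: \<theta>_def gp cj_fix_gpow flip: gpow_mult)
    ultimately have "cj (ginv y) \<theta> = \<theta>" using cj_z_V[of \<theta>] gi by (metis ginv_ginv)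
    then have "cj y \<theta> = \<theta>" by (metis cj_ginv_cj(2))
    then show ?thesis by (simp add: d_eq \<eta>_def)
  next
    case False
    have ne: "\<eta> \<noteq> 1" using False V_one by blast
    have t\<theta>: "\<theta> \<notin> V"
    proof
      assume "\<theta> \<in> V"
      then have "d * \<theta> \<in> V" using cV V_times by blast
      moreover have "d * \<theta> = \<eta>" by (simp add: d_eq sq mult.assoc)
      ultimately show False using False by simp
    qed
    then have ne': "\<theta> \<noteq> 1" using V_one by blast
    have fx: "v = 1 \<or> v = d" if "v \<in> V" "cj r v = v" for v
      using fixed[OF that] ne ne' t\<theta> False that(1) by (auto simp: d_eq)
    \<comment> \<open>Now 1 and \<open>d\<close> are the only \<open>r\<close>-fixed elements of
      \<open>V\<close>, and \<open>r\<close> exchanges \<open>D1\<close> and \<open>D2\<close>, so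
      their product is one of the two. If it is \<open>d\<close> and \<open>y\<close> moves
      \<open>d\<close>, then \<open>{1, d, D1, D2}\<close> is a four-group whose involutions are
      cycled by \<open>y\<close>.\<close>
    define D1 D2 where "D1 = cj y d" and "D2 = cj (ginv y) d"
    have DV: "D1 \<in> V" "D2 \<in> V" using cV cj_y_V1 by (simp_all add: D1_def D2_def)
    have DD: "D1 * D1 = 1" "D2 * D2 = 1" using dd by (simp_all add: D1_def D2_def flip: cj_mult)
    then have Dg: "ginv D1 = D1" "ginv D2 = D2" by (auto intro: ginv_unique)
    have Dc: "D1 * D2 = D2 * D1" "d * D1 = D1 * d" "d * D2 = D2 * d" using V_commute DV cV by blast+
    have rD: "cj r D1 = D2" "cj r D2 = D1"
      by (simp_all add: D1_def D2_def cj_cj_swap[of r] ry rd)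
    have "cj r (D1 * D2) = D1 * D2" by (simp add: rD Dc)
    with fx DV V_times have "D1 * D2 = 1 \<or> D1 * D2 = d" by blast
    then show ?thesis
    proof
      assume "D1 * D2 = 1"
      then have "D2 = D1" by (metis DD(1) group_cancel_left)
      then have "D1 = 1 \<or> D1 = d" using fx DV rD by metis
      then show ?thesis using D1_def by auto
    next
      assume m: "D1 * D2 = d"
      show ?thesis
      proof (rule ccontr)
        assume "cj y d \<noteq> d"
        then have Dd: "D1 \<noteq> d" by (simp add: D1_def)
        have mD: "D1 * d = D2" "D2 * d = D1" "d * D2 = D1" "d * D1 = D2"
          using m DD Dc by (metis mult.assoc mult_1_left mult_1_right)+
        have yD: "cj y d = D1" "cj y D2 = d" by (simp_all add: D1_def D2_def)
        have yD1: "cj y D1 = D2"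
        proof -
          have "cj y (D1 * D2) = cj y D1 * d" by (simp add: yD)
          then have "cj y D1 * d = D1" using m yD by simp
          then have "cj y D1 * d * d = D1 * d" by simp
          then show ?thesis by (simp add: dd mD mult.assoc)
        qed
        have D2d: "D2 \<noteq> d" using yD yD1 Dd by metis
        have d3: "cj (y \<up> 3) d = d"
          using gpow_add[of y 1 2] by (simp add: gpow_2 yD yD1 flip: cj_cj)
        have act: "cj (y \<up> (3 * q + 0)) d = d" "cj (y \<up> (3 * q + 1)) d = D1" "cj (y \<up> (3 * q + 2)) d = D2" for q
        proof -
          show 0: "cj (y \<up> (3 * q + 0)) d = d" using cj_fix_gpow[OF d3, of q] by (simp add: gpow_mult)
          show "cj (y \<up> (3 * q + 1)) d = D1"
            using 0 yD by (simp add: add.commute[of _ 1] gpow_add del: cj_gpow flip: cj_cj)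
          show "cj (y \<up> (3 * q + 2)) d = D2"
            using 0 yD yD1 by (simp add: add.commute[of _ 2] gpow_add gpow_2 flip: cj_cj)
        qed
        have mod3: "\<exists>q. n = 3 * q + 0 \<or> n = 3 * q + 1 \<or> n = 3 * q + 2" for n :: int
          by presburger
        have "cj \<eta> d = d" unfolding cj_fix_iff by (simp add: d_eq com mult.assoc)
        moreover have "\<eta> * ginv y = ginv y * \<eta>"
          unfolding \<eta>_def by (metis gpow_gpow_commute gpow_minus_1)
        ultimately have \<eta>D: "cj \<eta> D2 = D2" unfolding D2_def by (metis cj_cj)
        obtain a b where ab: "D1 = y \<up> a * g \<up> b" using nf DV by blast
        have "D2 = y \<up> (- a) * g \<up> (- b)"
          unfolding rD(1)[symmetric] ab by (simp add: ry rg gpow_ginv gpow_minus)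
        then have g1: "g \<up> b = y \<up> (- a) * D1" and g2: "g \<up> (- b) = y \<up> a * D2"
          by (simp_all add: ab gpow_minus)
        have "ginv (y \<up> (- a) * D1) = y \<up> a * D2" using g1 g2 by (metis gpow_minus)
        then have "D1 * y \<up> a = y \<up> a * D2" by (simp add: gpow_minus Dg)
        then have aD: "cj (y \<up> a) D2 = D1" by (metis cj_mult_left group_cancel_right)
        moreover have "D2 = cj (y \<up> 2) d" by (simp add: gpow_2 yD yD1 flip: cj_cj)
        ultimately have a2: "cj (y \<up> (a + 2)) d = D1" by (simp add: gpow_add cj_cj)
        \<comment> \<open>The action of \<open>y\<close> on \<open>d\<close> has period 3 and
          \<open>D2\<close> is the second conjugate, so carrying \<open>D2\<close> to
          \<open>D1\<close> determines \<open>a\<close> modulo 3.\<close>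
        obtain q where q: "a = 3 * q + 2"
        proof -
          obtain q where "a = 3 * q + 0 \<or> a = 3 * q + 1 \<or> a = 3 * q + 2" using mod3 by blast
          moreover have "a \<noteq> 3 * q + 0" using a2 act(3)[of q] yD yD1 Dd D2d by (metis add.right_neutral)
          moreover have "a \<noteq> 3 * q + 1" using a2 act(1)[of "q + 1"] Dd by (auto simp: algebra_simps)
          ultimately show ?thesis using that by blast
        qed
        have "cj (y \<up> (- a)) D1 = D2" using aD by (simp add: gpow_minus flip: aD)
        then have gb: "g \<up> b = D2 * y \<up> (- a)" unfolding g1 by (metis cj_mult_left)
        have gb': "g \<up> (- b) = D1 * y \<up> a" unfolding g2 using aD by (metis cj_mult_left)
        have "d * \<eta> = \<eta> * \<eta> * \<theta>" by (simp add: d_eq com mult.assoc)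
        then have "\<theta> * g \<up> b = d * \<eta> * (D2 * y \<up> (- a))" by (simp add: sq gb)
        also have "\<dots> = d * (\<eta> * D2) * y \<up> (- a)" by (simp add: mult.assoc)
        also have "\<eta> * D2 = D2 * \<eta>" using \<eta>D by (simp only: cj_fix_iff)
        also have "d * (D2 * \<eta>) * y \<up> (- a) = D1 * \<eta> * y \<up> (- a)" by (simp add: mD flip: mult.assoc)
        finally have "ginv (g \<up> (- b)) * (\<theta> * g \<up> b) = ginv (D1 * y \<up> a) * (D1 * \<eta> * y \<up> (- a))"
          by (simp only: gb')
        then have "g \<up> (b + l + b) = y \<up> (- a + k + - a)"
          unfolding gpow_add \<eta>_def \<theta>_def by (simp add: gpow_minus mult.assoc)
        then have "y \<up> (- a + k + - a) = 1"
          using triv[of "- a + k + - a" "p * (b + l + b)"] by (simp add: gp gpow_mult)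
        then have "y \<up> (a + (- a + k + - a) + a) = y \<up> (a + a)"
          by (simp only: gpow_add[of y _ a] gpow_add[of y a "- a + k + - a"]) simp
        \<comment> \<open>As \<open>\<eta> * \<eta> = 1\<close>, this makes
          \<open>y \<up> (4 * a)\<close> trivial. But \<open>4 * a\<close> is 2 modulo 3 like
          \<open>a\<close>, so this power moves \<open>d\<close> to \<open>D2\<close>.\<close>
        then have "y \<up> k = y \<up> (a + a)" by simp
        then have "y \<up> (a + a + (a + a)) = 1" using sq(1) unfolding \<eta>_def by (simp only: gpow_add)
        moreover have "a + a + (a + a) = 3 * (4 * q + 2) + 2" by (simp add: q)
        ultimately have "cj 1 d = D2" using act(3)[of "4 * q + 2"] by metis
        then show False using D2d by simp
      qed
    qed
  qed
  have zd: "cj z d = d"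
  proof -
    have "cj (ginv y) d = d" using central by (metis cj_ginv_cj(1))
    then show ?thesis using cj_z_V[OF cV(3)] dd by (simp add: ginv_unique)
  qed
  have gd: "ginv d = d" using dd by (rule ginv_unique)
  define e where "e = y * z * z * y"
  have eV: "e \<in> V" unfolding e_def by (rule V_c)
  obtain i j where e: "e = y \<up> i * g \<up> j" using nf eV by blast
  define J where "J = p * j"
  have gJ: "g \<up> j = z \<up> J" unfolding J_def gp gpow_mult ..
  then have eJ: "e = y \<up> i * z \<up> J" by (simp add: e)
  \<comment> \<open>\<open>e\<close> is a palindrome in \<open>y\<close> and \<open>z * z\<close>,
    both inverted by \<open>r\<close>. Since \<open>r\<close> also inverts the two factors of the
    normal form separately, these factors commute.\<close>
  have "cj r e = ginv e" unfolding e_def using rzz' ry by (simp add: mult.assoc)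
  moreover have "cj r e = ginv (y \<up> i) * ginv (z \<up> J)"
    by (simp add: e ry rg gpow_ginv flip: gJ)
  ultimately have "ginv (z \<up> J * y \<up> i) = ginv (y \<up> i * z \<up> J)" using eJ by simp
  then have comJ: "z \<up> J * y \<up> i = y \<up> i * z \<up> J" by (simp only: ginv_eq_iff)
  have yye: "cj (y * y) e = d * e"
  proof -
    have "cj (y * y) c = c'" by (simp add: c_def c'_def cj_def mult.assoc)
    also have "c' = d * c" using V_commute[of c "ginv c'"] cV V_ginv gd
      by (metis d_def ginv_ginv ginv_left_assoc ginv_mult mult.assoc)
    finally have "cj y (cj (y * y) c) = d * cj y c" using central by simp
    moreover have "e = cj y c" by (simp add: c_def e_def cj_def mult.assoc)
    ultimately show ?thesis by (simp add: cj_cj mult.assoc)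
  qed
  have yyd: "cj (y * y) d = d" "cj (z * z) d = d" using central zd by (simp_all flip: cj_cj)
  have zze: "cj (z * z) e = d * e"
  proof -
    have "cj (y * y) (d * e) = e" using yyd yye dd by (simp flip: mult.assoc)
    then show ?thesis using cj_zz_V[OF eV] by (metis cj_ginv_cj(1))
  qed
  have yi: "cj (y * y) (y \<up> i) = y \<up> i"
    by (simp add: cj_fix_gpow flip: cj_cj)
  have zi: "cj (z * z) (z \<up> J) = z \<up> J"
    by (simp flip: cj_cj)
  have dy: "y \<up> i * d = d * y \<up> i" using cj_fix_gpow[OF central, of i] by (simp only: cj_fix_iff)
  have A: "cj (y * y) (z \<up> J) = d * z \<up> J"
  proof -
    have "y \<up> i * cj (y * y) (z \<up> J) = d * (y \<up> i * z \<up> J)" using yye yi unfolding eJ by (metis cj_mult)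
    also have "\<dots> = y \<up> i * (d * z \<up> J)" using dy by (metis mult.assoc)
    finally show ?thesis by simp
  qed
  have B: "cj (z * z) (y \<up> i) = d * y \<up> i"
  proof -
    have "cj (z * z) (y \<up> i) * z \<up> J = d * y \<up> i * z \<up> J"
      using zze zi unfolding eJ by (metis cj_mult mult.assoc)
    then show ?thesis by simp
  qed
  have C: "cj (y * y) (z * z) = d * (z * z)"
  proof -
    have "d * (y * y * (z * z)) = z * z * (y * y)" by (simp add: d_def c_def c'_def mult.assoc)
    then have "d * (d * (y * y * (z * z))) = d * (z * z * (y * y))" by simp
    then have "y * y * (z * z) = d * (z * z) * (y * y)" by (simp add: dd mult.assoc flip: mult.assoc[of d d])
    then show ?thesis by (metis cj_mult_left group_cancel_right)
  qed
  have dz: "z * z * d = d * (z * z)" using yyd(2) by (simp only: cj_fix_iff)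
  have C': "cj (y * y) ((z * z) \<up> n) = d \<up> n * (z * z) \<up> n" for n
    by (simp only: cj_gpow C gpow_mult_distrib[OF dz[symmetric]])
  have "d = 1"
  \<comment> \<open>\<open>A\<close> and \<open>C\<close> both evaluate conjugation by
    \<open>y * y\<close> on powers of \<open>z\<close>. For even \<open>J\<close> the commuting
    factors and \<open>B\<close> give \<open>d \<up> n = 1\<close>, so that \<open>C\<close> and
    \<open>A\<close> agree only for \<open>d = 1\<close>; for odd \<open>J\<close> they are compared
    on the square of \<open>z \<up> J\<close>.\<close>
  proof (cases "even J")
    case True
    then obtain n where n: "J = 2 * n" by (auto elim: evenE)
    then have zJ: "z \<up> J = (z * z) \<up> n" by (simp add: gpow_mult gpow_2)
    have "cj ((z * z) \<up> n) (y \<up> i) = d \<up> n * y \<up> i"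
      by (rule cj_scaled_pow) (use B yyd in auto)
    moreover have "cj (z \<up> J) (y \<up> i) = y \<up> i" unfolding cj_fix_iff by (rule comJ)
    ultimately have "d \<up> n = 1" by (metis zJ group_cancel_right mult_1_left)
    then have "d * z \<up> J = 1 * z \<up> J" using A C'[of n] unfolding zJ by (metis mult_1_left)
    then show ?thesis by (simp only: group_cancel_right)
  next
    case False
    have dJ: "d \<up> J = d" using gpow_mod2(2)[OF dd False] .
    have zz: "(z * z) \<up> J = z \<up> J * z \<up> J"
      by (simp add: gpow_mult_distrib)
    have "z \<up> J * d = d * z \<up> J" using cj_fix_gpow[OF zd, of J] by (simp only: cj_fix_iff)
    then have "d * z \<up> J * (d * z \<up> J) = d * d * (z \<up> J * z \<up> J)" by (metis mult.assoc)
    then have "cj (y * y) (z \<up> J * z \<up> J) = z \<up> J * z \<up> J" using A dd by (metis cj_mult mult_1_left)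
    then have "d * (z * z) \<up> J = 1 * (z * z) \<up> J" using C'[of J] dJ unfolding zz by simp
    then show ?thesis by (simp only: group_cancel_right)
  qed
  then have "c = c'" by (metis d_def ginv_left_assoc ginv_right group_cancel_right)
  then show ?thesis by (simp add: c_def c'_def mult.assoc)
qed

end

section \<open>Quotients\<close>

text \<open>Used twice: its elements represent automorphisms, and a quotient group is realized by
  bijections of the set type, through its action on cosets. Both thereby live in instances of
  \<open>mult_group\<close>.\<close>

typedef 'a bij = "{f :: 'a \<Rightarrow> 'a. bij f}"
  morphisms app Abs_bij
  using bij_id by blast

setup_lifting type_definition_bij

instantiation bij :: (type) mult_group
begin

lift_definition one_bij :: "'a bij" is id by (rule bij_id)
lift_definition times_bij :: "'a bij \<Rightarrow> 'a bij \<Rightarrow> 'a bij" is "(\<circ>)" by (rule bij_comp)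
lift_definition ginv_bij :: "'a bij \<Rightarrow> 'a bij" is inv by (rule bij_imp_bij_inv)

instance
  by standard (transfer; auto simp: fun_eq_iff bij_is_inj)+

end

lemma app_one [simp]: "app 1 = id" and app_times: "app (f * g) = app f \<circ> app g"
  by (transfer, simp)+

lemma app_bij: "bij (app f)"
  using app by blast

lemma app_inject: "app f = app g \<longleftrightarrow> f = g"
  by (rule app_inject)

text \<open>A map relative to a subgroup \<open>D\<close>, since groups are whole types here while a
  subgroup is normal only in its normalizer.\<close>

locale group_hom_on =
  fixes D :: "'a::mult_group set" and \<pi> :: "'a \<Rightarrow> 'b::mult_group"
  assumes D_one: "1 \<in> D" and D_times: "a \<in> D \<Longrightarrow> b \<in> D \<Longrightarrow> a * b \<in> D"
    and D_ginv: "a \<in> D \<Longrightarrow> ginv a \<in> D"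
    and hom_times: "a \<in> D \<Longrightarrow> b \<in> D \<Longrightarrow> \<pi> (a * b) = \<pi> a * \<pi> b"
begin

lemma hom_one: "\<pi> 1 = 1"
  using hom_times[OF D_one D_one] by (metis group_cancel_left mult_1_right)

lemma hom_ginv: "a \<in> D \<Longrightarrow> \<pi> (ginv a) = ginv (\<pi> a)"
  by (metis D_ginv ginv_right ginv_unique hom_one hom_times)

lemma D_gpow: "a \<in> D \<Longrightarrow> a \<up> n \<in> D"
  by (rule gpow_closed) (auto intro: D_one D_times D_ginv)

lemma hom_gpow: "a \<in> D \<Longrightarrow> \<pi> (a \<up> n) = \<pi> a \<up> n"
proof (induction n rule: int_induct[where k = 0])
  case base
  show ?case by (simp add: hom_one)
next
  case (step1 i)
  then show ?case by (simp add: gpow_add hom_times D_gpow)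
next
  case (step2 i)
  then show ?case by (simp add: gpow_diff hom_times hom_ginv D_gpow D_ginv)
qed

lemma hom_cj: "a \<in> D \<Longrightarrow> g \<in> D \<Longrightarrow> \<pi> (cj g a) = cj (\<pi> g) (\<pi> a)"
  by (simp add: cj_def hom_times hom_ginv D_times D_ginv)

lemma D_cj: "a \<in> D \<Longrightarrow> g \<in> D \<Longrightarrow> cj g a \<in> D"
  by (simp add: cj_def D_times D_ginv)

text \<open>The involution and the exchange law survive in every image; trivial intersection need
  not, so it has to be supplied.\<close>

lemma rot_pair_image:
  assumes yz: "rot_pair y z" and D: "y \<in> D" "z \<in> D"
    and triv: "\<And>i j. \<pi> (y \<up> i) = \<pi> (z \<up> j) \<Longrightarrow> \<pi> (y \<up> i) = 1"
  shows "rot_pair (\<pi> y) (\<pi> z)"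
proof
  note hom = hom_times hom_gpow D_times D_gpow D
  have "\<pi> (y * z * y * z) = 1" unfolding rot_pair.inv_yz[OF yz] by (rule hom_one)
  then show "\<pi> y * \<pi> z * \<pi> y * \<pi> z = 1" by (simp add: hom)
  show "\<pi> y \<up> i = 1" if "\<pi> y \<up> i = \<pi> z \<up> j" for i j
    using triv[of i j] that by (simp add: hom)
  fix i j
  obtain k l where "z \<up> i * y \<up> j = y \<up> k * z \<up> l" using rot_pair.closed[OF yz] by blast
  then have "\<pi> (z \<up> i * y \<up> j) = \<pi> (y \<up> k * z \<up> l)" by simp
  then have "\<pi> z \<up> i * \<pi> y \<up> j = \<pi> y \<up> k * \<pi> z \<up> l" by (simp add: hom)
  then show "\<exists>k l. \<pi> z \<up> i * \<pi> y \<up> j = \<pi> y \<up> k * \<pi> z \<up> l" by blast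
qed

end

text \<open>Both conjugations are required because \<open>N\<close> may be infinite, and then
  \<open>cj g\<close> could map \<open>N\<close> into a proper part of itself.\<close>

definition normalizer :: "'a::mult_group set \<Rightarrow> 'a set"
  where "normalizer N = {g. \<forall>n\<in>N. cj g n \<in> N \<and> cj (ginv g) n \<in> N}"

lemma quotient_hom:
  fixes N :: "'a::mult_group set"
  assumes one: "1 \<in> N" and times: "\<And>a b. a \<in> N \<Longrightarrow> b \<in> N \<Longrightarrow> a * b \<in> N"
    and inv: "\<And>a. a \<in> N \<Longrightarrow> ginv a \<in> N"
  shows "\<exists>\<pi> :: 'a \<Rightarrow> 'a set bij. group_hom_on (normalizer N) \<pi> \<and>
    (\<forall>g \<in> normalizer N. \<pi> g = 1 \<longleftrightarrow> g \<in> N)"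
proof -
  let ?D = "normalizer N"
  \<comment> \<open>Left translation on the cosets \<open>h N\<close> with \<open>h\<close> in the
    normalizer, extended by the identity to all other sets so that it is a bijection of the whole
    type. Evaluation at the coset \<open>N\<close> identifies the kernel.\<close>
  define act where "act g S = (if S \<in> (\<lambda>h. (*) h ` N) ` ?D then (*) g ` S else S)" for g and S :: "'a set"
  have D1: "1 \<in> ?D" by (simp add: normalizer_def)
  have Dt: "a * b \<in> ?D" if "a \<in> ?D" "b \<in> ?D" for a b
    using that by (simp add: normalizer_def flip: cj_cj)
  have Di: "ginv a \<in> ?D" if "a \<in> ?D" for a
    using that by (simp add: normalizer_def)
  have img: "(*) a ` ((*) b ` S) = (*) (a * b) ` S" for a b :: 'a and S
    by (auto simp: image_iff mult.assoc)
  have one_img: "(*) (1::'a) ` S = S" for S by auto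
  have act_in: "act g S \<in> (\<lambda>h. (*) h ` N) ` ?D \<longleftrightarrow> S \<in> (\<lambda>h. (*) h ` N) ` ?D" if "g \<in> ?D" for g S
    using that Dt by (auto simp: act_def img)
  have comp: "act g (act h S) = act (g * h) S" if "g \<in> ?D" "h \<in> ?D" for g h S
    using act_in[OF that(2), of S] by (auto simp: act_def img)
  have act1: "act 1 S = S" for S by (simp add: act_def one_img)
  have bij: "bij (act g)" if "g \<in> ?D" for g
    by (rule o_bij[of "act (ginv g)"]) (simp_all add: fun_eq_iff comp that Di act1)
  define \<pi> where "\<pi> g = Abs_bij (act g)" for g
  have app: "app (\<pi> g) = act g" if "g \<in> ?D" for g
    unfolding \<pi>_def using bij[OF that] by (simp add: Abs_bij_inverse)
  have "group_hom_on ?D \<pi>"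
  proof
    show "\<pi> (a * b) = \<pi> a * \<pi> b" if "a \<in> ?D" "b \<in> ?D" for a b
      using that by (simp add: app_inject[symmetric] app_times app Dt fun_eq_iff comp)
  qed (use D1 Dt Di in auto)
  moreover have "\<pi> g = 1 \<longleftrightarrow> g \<in> N" if g: "g \<in> ?D" for g
  proof
    assume "\<pi> g = 1"
    then have "act g N = N" using app[OF g] by (metis app_one id_apply)
    moreover have "N \<in> (\<lambda>h. (*) h ` N) ` ?D" using D1 one_img by (metis image_eqI)
    ultimately have "(*) g ` N = N" by (simp add: act_def)
    then show "g \<in> N" using one by (metis imageI mult_1_right)
  next
    assume gN: "g \<in> N"
    have "act g S = S" for S
    proof (cases "S \<in> (\<lambda>h. (*) h ` N) ` ?D")
      case True
      then obtain h where h: "h \<in> ?D" "S = (*) h ` N" by blast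
      let ?n = "cj (ginv h) g"
      have n: "?n \<in> N" using h gN by (auto simp: normalizer_def)
      have "(*) ?n ` N = N"
      proof
        show "(*) ?n ` N \<subseteq> N" using n times by auto
        have "x = ?n * (ginv ?n * x)" for x by simp
        then show "N \<subseteq> (*) ?n ` N" using times[OF inv[OF n]] by blast
      qed
      moreover have "g * h = h * ?n" by (simp add: cj_def mult.assoc)
      ultimately have "(*) g ` S = S" unfolding h(2) img by (metis img)
      then show ?thesis by (simp add: act_def)
    qed (auto simp: act_def)
    then show "\<pi> g = 1" using app[OF g] by (simp add: app_inject[symmetric] fun_eq_iff)
  qed
  ultimately show ?thesis by blast
qed

section \<open>Commuting squares in the core-free case\<close>

context rot_pair
begin

text \<open>The element \<open>Z = (z\<^sup>2)\<^sup>j\<^sup>+\<^sup>1\<close> measures how far \<open>t\<close> is from inverting \<open>z\<^sup>2\<close>. Once \<open>f = 1\<close> is shown,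
  \<open>Z\<close> and its conjugate \<open>Z1\<close> generate a normal subgroup, and \<open>squares_commute\<close> applies modulo
  this subgroup with \<open>r = t\<close>.\<close>

lemma squares_commute_core_free:
  assumes ty: "cj t y = ginv y" and tt: "t * t = 1"
    and tz: "cj t (z * z) = (z * z) \<up> j"
    and core_free: "\<And>k. cj z (y \<up> k) = y \<up> k \<or> cj z (y \<up> k) = ginv (y \<up> k) \<Longrightarrow> y \<up> k = 1"
    and tz_in: "\<And>k l. cj t z = y \<up> k * z \<up> l \<Longrightarrow> cj t z = ginv z"
  shows "z * z * (y * y) = y * y * (z * z)"
proof (cases "\<exists>k l. cj t z = y \<up> k * z \<up> l")
  case True
  with tz_in have r: "cj t z = ginv z" by blast
  show ?thesis
    by (rule squares_commute[OF ty r, of 1]) (use r gen_normal_form V_gen' in auto)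
next
  case B: False
  define g where "g = z * z"
  have g_pow: "g \<up> n = z \<up> (2 * n)" for n by (simp add: g_def gpow_mult gpow_2)
  have tg: "cj t g = g \<up> j" using tz by (simp add: g_def)
  have tct: "cj t (cj t a) = a" for a by (simp add: cj_cj tt)
  have gjj: "g \<up> (j * j) = g" using tct[of g] by (simp add: tg gpow_mult)
  have gjj': "g \<up> (j * (j * n)) = g \<up> n" for n using gjj by (metis gpow_mult mult.assoc)
  have trivg: "y \<up> i = g \<up> m \<Longrightarrow> y \<up> i = 1" for i m using triv by (simp add: g_pow)
  have nfg: "y \<up> i = y \<up> k \<and> g \<up> m = g \<up> l" if "y \<up> i * g \<up> m = y \<up> k * g \<up> l" for i k l m
    using normal_form_eq that unfolding g_pow by blast
  \<comment> \<open>The left side lies in \<open><y, g>\<close>, which \<open>t\<close> maps into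
    itself. With an odd exponent of \<open>z\<close> on the right, \<open>t\<close> would carry
    \<open>z\<close> into \<open><y, z>\<close>, against \<open>B\<close>.\<close>
  have closed_g: "\<exists>k l. g \<up> i * y \<up> m = y \<up> k * g \<up> l" for i m
  proof -
    obtain k l where kl: "g \<up> i * y \<up> m = y \<up> k * z \<up> l" unfolding g_pow using closed by blast
    have "even l"
    proof (rule ccontr)
      assume "odd l"
      then obtain n where l: "l = 1 + 2 * n" by (metis oddE add.commute)
      have "cj t (y \<up> k * z \<up> l) = (g \<up> j) \<up> i * y \<up> (- m)"
        by (simp add: ty tg gpow_ginv gpow_minus flip: kl)
      moreover have "cj t (y \<up> k * z \<up> l) = y \<up> (- k) * (cj t z * cj t (g \<up> n))"
      proof -
        have "y \<up> k * z \<up> l = y \<up> k * (z * g \<up> n)" by (simp add: l gpow_add g_pow)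
        then show ?thesis by (simp add: ty gpow_ginv gpow_minus)
      qed
      ultimately have "cj t z = y \<up> k * ((g \<up> j) \<up> i * y \<up> (- m)) * (g \<up> j) \<up> (- n)"
        by (simp add: tg gpow_minus mult.assoc)
      moreover have "\<dots> \<in> gen {y, z}"
        unfolding g_def by (intro gen_times gen_gpow) (auto intro: gen_incl)
      ultimately show False using B gen_normal_form by metis
    qed
    then show ?thesis using kl g_pow by (metis evenE)
  qed
  have nf: "\<exists>k l. a = y \<up> k * g \<up> l" if "a \<in> gen {y, g}" for a
    by (rule gen_pair_normal_form[OF closed_g that])
  have nfV: "\<exists>k l. a = y \<up> k * g \<up> l" if "a \<in> V" for a
    using V_gen[OF that] nf by (simp add: g_def)
  define w where "w = y * y"
  have wp: "w \<up> n = y \<up> (2 * n)" for n by (simp add: w_def gpow_mult gpow_2)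
  have wy: "cj y (w \<up> n) = w \<up> n" for n by (simp add: wp)
  have gz: "cj z (g \<up> n) = g \<up> n" "cj (g \<up> n) z = z" for n
    unfolding g_pow by (simp_all add: cj_fix_gpow)
  have tw: "cj t w = ginv w" by (simp add: w_def ty)
  define c c' where "c = g * w" and "c' = w * g"
  have cV: "c \<in> V" "c' \<in> V" using V_c by (simp_all add: c_def c'_def g_def w_def mult.assoc)
  have gw_pow: "g \<up> n * w \<up> n \<in> V" for n unfolding g_def w_def by (rule zz_yy_pow)
  have commV: "commut (g \<up> m) (y \<up> n) \<in> V" for m n unfolding g_def by (rule commut_zz_y)
  have g_act: "cj (g \<up> n) (cj (w \<up> n) a) = a" if "a \<in> V" for a n
    using V_cj[OF gw_pow[of n] that] by (simp add: cj_cj)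
  have yV: "cj y a \<in> V" if "a \<in> V" for a using cj_y_V1 that by blast
  have wV: "cj (w \<up> n) a \<in> V" if "a \<in> V" for a n unfolding wp using cj_y_V[OF that] .
  \<comment> \<open>Modulo \<open>V\<close> every \<open>g \<up> n\<close> equals
    \<open>w \<up> (- n)\<close>, so \<open>t\<close> sends \<open>c' = w * g\<close> from
    \<open>V\<close> into the coset of \<open>ginv E\<close>: the exponent \<open>j + 1\<close>
    measures how far \<open>t\<close> is from preserving \<open>V\<close>.\<close>
  define E where "E = w \<up> (j + 1)"
  have Ey: "E = y \<up> (2 * (j + 1))" by (simp add: E_def wp)
  have EV: "cj E a \<in> V" if "a \<in> V" for a unfolding E_def using wV[OF that] .
  have Ew: "cj E w = w" unfolding E_def by (simp add: cj_fix_gpow)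
  have tE: "cj t E = ginv E" unfolding E_def by (simp add: tw gpow_ginv)
  define b where "b = commut g y"
  have bV: "b \<in> V" using commV[of 1 1] by (simp add: b_def)
  \<comment> \<open>The image \<open>v\<close> of \<open>c'\<close> under \<open>t\<close> commutes
    with \<open>b'\<close> because \<open>c'\<close> and \<open>b\<close> commute in
    \<open>V\<close>. As \<open>E * v\<close> lies in \<open>V\<close>, it commutes with
    \<open>b'\<close> too, hence so does \<open>E\<close>; applying \<open>t\<close> again leads
    back to \<open>b\<close>.\<close>
  have Eb: "cj E b = b"
  proof -
    define b' where "b' = cj t b"
    have "b' = commut (g \<up> j) (y \<up> (- 1))" by (simp add: b'_def b_def commut_def ty tg)
    then have b'V: "b' \<in> V" using commV by blast
    define v where "v = cj t c'"
    have v: "v = ginv w * g \<up> j" by (simp add: v_def c'_def tw tg)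
    have vb: "cj v b' = b'" unfolding v_def b'_def using V_cj[OF cV(2) bV] by (metis cj_cj_swap)
    have "cj (w \<up> j) (g \<up> j * w \<up> j) = w \<up> (j + 1) * v"
      by (simp add: v gpow_add cj_def mult.assoc)
    then have "E * v \<in> V" using wV[OF gw_pow] unfolding E_def by metis
    then have "cj (E * v) b' = b'" using V_cj b'V by blast
    then have "cj E b' = b'" using vb by (metis cj_cj)
    then have "cj (cj t E) (cj t b') = cj t b'" by (metis cj_cj_swap)
    then have "cj (ginv E) b = b" by (simp add: tE b'_def tct)
    then show ?thesis by (metis cj_ginv_cj(2))
  qed
  define f where "f = commut g E"
  have fV: "f \<in> V" using commV[of 1 "2 * (j + 1)"] by (simp add: f_def Ey)
  have f_c: "f = c * ginv (cj E c)"
  proof -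
    have "cj E c = E * g * ginv E * w" unfolding c_def cj_mult Ew by (simp add: cj_def)
    then show ?thesis by (simp add: f_def commut_def c_def mult.assoc)
  qed
  \<comment> \<open>\<open>E\<close> centralizes \<open>b = c * ginv (cj y c)\<close>; rearranged in
    the abelian group \<open>V\<close>, this says that \<open>c * ginv (cj E c)\<close> is unchanged
    by \<open>y\<close>.\<close>
  have yf: "cj y f = f"
  proof -
    have yE: "cj y (cj E a) = cj E (cj y a)" for a
      using wy[of "j + 1"] unfolding E_def by (metis cj_cj_swap)
    have b_c: "b = c * ginv (cj y c)"
      by (simp add: b_def commut_def c_def w_def cj_def mult.assoc)
    have "c * ginv (cj y c) = cj E c * ginv (cj E (cj y c))"
      using Eb unfolding b_c by simp
    then have "ginv (cj E c) * c = ginv (cj E (cj y c)) * cj y c"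
      using V_commute[OF V_ginv[OF EV[OF yV[OF cV(1)]]] yV[OF cV(1)]]
      by (metis ginv_left_assoc ginv_ginv ginv_right_assoc mult.assoc ginv_left mult_1_right)
    then have f_yc: "f = cj y c * ginv (cj E (cj y c))"
      using V_commute[OF V_ginv[OF EV[OF cV(1)]] cV(1)]
        V_commute[OF V_ginv[OF EV[OF yV[OF cV(1)]]] yV[OF cV(1)]] f_c by simp
    have "cj y f = cj y c * ginv (cj E (cj y c))" unfolding f_c by (simp add: yE)
    then show ?thesis using f_yc by (simp only:)
  qed
  have zf: "cj z f = ginv f"
    using cj_z_V[OF fV] yf by (metis cj_ginv_cj(1))
  have gf: "cj g f = f" unfolding g_def by (simp add: zf flip: cj_cj)
  have Ef: "cj E f = f" unfolding Ey using yf by (rule cj_fix_gpow)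
  obtain k l where f: "f = y \<up> k * g \<up> l" using nfV fV by blast
  have ygl: "cj y (g \<up> l) = g \<up> l" using yf unfolding f by (metis cj_mult cj_gpow cj_self group_cancel_left)
  \<comment> \<open>\<open>cj t f\<close> is computed twice, from the normal form of
    \<open>f\<close> and as \<open>commut (g \<up> j) (ginv E) = ginv (f \<up> j)\<close>. The
    \<open>g\<close>-parts give \<open>g \<up> (j * (2 * l)) = 1\<close>, and a further power
    \<open>j\<close> removes the factor \<open>j\<close> because
    \<open>g \<up> (j * j) = g\<close>.\<close>
  have gl2: "g \<up> (2 * l) = 1"
  proof -
    have gE: "cj g E = f * E" by (simp add: f_def commut_def cj_def mult.assoc)
    have gjE: "cj (g \<up> j) E = f \<up> j * E" by (rule cj_scaled_pow[OF gE gf])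
    have "commut (g \<up> j) (ginv E) = ginv E * ginv (f \<up> j) * E"
    proof -
      have "commut (g \<up> j) (ginv E) = ginv (cj (g \<up> j) E) * E" by (simp add: commut_def cj_def mult.assoc)
      then show ?thesis by (simp only: gjE ginv_mult)
    qed
    also have "\<dots> = cj (ginv E) (ginv (f \<up> j))" by (simp add: cj_def)
    also have "\<dots> = ginv (f \<up> j)" using Ef by (simp add: cj_fix_ginv)
    finally have "commut (g \<up> j) (ginv E) = ginv (f \<up> j)" .
    moreover have "cj t f = commut (g \<up> j) (ginv E)" by (simp add: f_def commut_def tg tE)
    moreover have "cj t f = y \<up> (- k) * g \<up> (j * l)" by (simp add: f ty tg gpow_ginv gpow_minus gpow_mult)
    moreover have "ginv (f \<up> j) = y \<up> (- (k * j)) * g \<up> (- (l * j))"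
    proof -
      have com: "y \<up> k * g \<up> l = g \<up> l * y \<up> k" using cj_fix_gpow[OF ygl, of k] by (simp only: cj_fix_iff)
      have com2: "y \<up> (k * j) * g \<up> (l * j) = g \<up> (l * j) * y \<up> (k * j)"
        using cj_fix_gpow2[OF ygl, of "k * j" j] by (simp only: cj_fix_iff gpow_mult)
      show ?thesis unfolding f gpow_mult_distrib[OF com] gpow_minus
        using com2 by (simp add: gpow_mult)
    qed
    ultimately have "y \<up> (- k) * g \<up> (j * l) = y \<up> (- (k * j)) * g \<up> (- (l * j))" by simp
    then have "g \<up> (j * l) = g \<up> (- (l * j))" using nfg by blast
    then have "g \<up> (j * l) * g \<up> (j * l) = 1" by (metis gpow_minus ginv_right mult.commute)
    then have "g \<up> (j * (2 * l)) = 1" by (simp add: algebra_simps flip: gpow_add)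
    then show ?thesis using gjj'[of "2 * l"] by (metis gpow_mult gpow_one mult.commute)
  qed
  have "cj z (y \<up> k) = ginv (y \<up> k)"
  proof -
    have com: "y \<up> k * g \<up> l = g \<up> l * y \<up> k" using cj_fix_gpow[OF ygl, of k] by (simp only: cj_fix_iff)
    have "g \<up> l * g \<up> l = 1" using gl2 by (simp flip: gpow_add)
    then have gl: "ginv (g \<up> l) = g \<up> l" by (rule ginv_unique)
    have "cj z (y \<up> k) * g \<up> l = ginv (y \<up> k * g \<up> l)" using zf gz(1)[of l] unfolding f by (metis cj_mult)
    also have "\<dots> = ginv (y \<up> k) * g \<up> l" unfolding com by (simp add: gl)
    finally show ?thesis by simp
  qed
  then have "y \<up> k = 1" using core_free by blast
  then have fg: "f = g \<up> l" using f by simp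
  have ff: "f * f = 1" using gl2 by (simp add: fg flip: gpow_add)
  then have gif: "ginv f = f" by (rule ginv_unique)
  have zf': "cj z f = f" by (simp add: zf gif)
  define Z where "Z = g \<up> (j + 1)"
  have Zc: "cj Z c = f * c"
  proof -
    have "cj E c = f * c"
    proof -
      have "f * cj E c = c" by (simp add: f_c mult.assoc)
      then have "f * (f * cj E c) = f * c" by simp
      then show ?thesis by (simp add: ff flip: mult.assoc)
    qed
    then have "c = cj Z (f * c)" using g_act[OF cV(1), of "j + 1"] by (simp add: Z_def E_def)
    moreover have "cj Z f = f" unfolding Z_def using gf by (rule cj_fix_gpow)
    ultimately have "c = f * cj Z c" by simp
    then have "f * c = f * (f * cj Z c)" by simp
    then show ?thesis by (simp add: ff flip: mult.assoc)
  qed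
  have fgc: "f * g = g * f" using gf by (simp add: cj_fix_iff)
  have wZ: "cj w Z = f * Z"
  proof -
    have "cj Z g = g" unfolding Z_def by (simp add: cj_fix_gpow)
    then have "g * cj Z w = g * (f * w)" using Zc unfolding c_def by (simp add: fgc flip: mult.assoc)
    then have "cj Z w = f * w" by simp
    then have "Z * w = f * w * Z" by (metis cj_mult_left)
    then have "f * (Z * w) = w * Z" by (simp add: ff flip: mult.assoc)
    then show ?thesis by (metis cj_mult_left group_cancel_right mult.assoc)
  qed
  define Z1 where "Z1 = cj y Z"
  have yZ: "cj (ginv y) Z = f * Z1"
  proof -
    have "cj y (cj y Z) = f * Z" using wZ by (simp add: w_def cj_cj)
    then have "cj y Z = f * cj (ginv y) Z" using yf by (metis cj_ginv_cj(1) cj_mult)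
    then have "f * Z1 = f * (f * cj (ginv y) Z)" by (simp add: Z1_def)
    then show ?thesis by (simp add: ff flip: mult.assoc)
  qed
  have zcjy: "cj z (cj y (g \<up> n)) = cj (ginv y) (g \<up> n)" for n
  proof -
    have "cj z (cj y g) = cj (ginv y) g" unfolding g_def by (rule cj_zy_zz)
    then show ?thesis by simp
  qed
  have zZ1: "cj z Z1 = f * Z1" using zcjy[of "j + 1"] yZ by (simp only: Z1_def Z_def)
  have cjy_gen: "cj y (g \<up> n) \<in> gen {y, g}" for n
    unfolding cj_def by (intro gen_times gen_gpow gen_ginv gen_incl) auto
  obtain a m where Z1: "Z1 = y \<up> a * g \<up> m" using nf[OF cjy_gen] unfolding Z1_def Z_def by blast
  have yf2: "f * y \<up> n = y \<up> n * f" for n using cj_fix_gpow[OF yf, of n] by (simp only: cj_fix_iff)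
  have za: "cj z (y \<up> a) = f * y \<up> a"
  proof -
    have "cj z (y \<up> a) * g \<up> m = f * y \<up> a * g \<up> m"
      using zZ1 gz(1)[of m] unfolding Z1 by (metis cj_mult mult.assoc)
    then show ?thesis by simp
  qed
  have "y \<up> a * y \<up> a = 1"
  proof -
    have "cj z (y \<up> (a + a)) = f * (y \<up> a * f) * y \<up> a" by (simp only: gpow_add cj_mult za mult.assoc)
    also have "\<dots> = y \<up> (a + a)" unfolding yf2[symmetric] gpow_add by (simp add: ff flip: mult.assoc)
    finally have "y \<up> (a + a) = 1" using core_free by blast
    then show ?thesis by (simp only: gpow_add)
  qed
  then have gia: "ginv (y \<up> a) = y \<up> a" by (rule ginv_unique)
  have ga: "cj g (y \<up> a) = y \<up> a"
    unfolding g_def cj_cj[symmetric] za cj_mult zf' by (simp add: ff flip: mult.assoc)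
  have Zj: "Z \<up> (j - 1) = 1"
    by (simp add: Z_def algebra_simps gjj flip: gpow_mult) (simp add: gpow_diff gjj)
  \<comment> \<open>\<open>t\<close> fixes \<open>Z\<close> but multiplies \<open>Z1\<close> by
    \<open>f\<close>, so the \<open>g\<close>-part of \<open>Z1\<close> has
    \<open>(j - 1)\<close>-th power \<open>f\<close>. As \<open>Z \<up> (j - 1) = 1\<close>, the
    same power of the conjugate \<open>Z1\<close> is trivial, which puts \<open>f\<close> into both
    cyclic groups.\<close>
  have "f = 1"
  proof -
    have "cj t Z = Z" by (simp add: Z_def tg gpow_add gjj flip: gpow_mult) (metis gpow_1 gpow_gpow_commute)
    then have "cj t Z1 = f * Z1" by (simp add: Z1_def cj_cj_swap[of t] ty yZ[unfolded Z1_def])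
    then have "y \<up> a * g \<up> (j * m) = f * y \<up> a * g \<up> m"
      unfolding Z1 by (simp add: ty tg gpow_ginv gia gpow_mult mult.assoc)
    then have "g \<up> (j * m) = f * g \<up> m" by (simp add: yf2 mult.assoc)
    then have fm: "g \<up> (m * (j - 1)) = f" by (simp add: algebra_simps gpow_diff)
    have "y \<up> a * g \<up> m = g \<up> m * y \<up> a" using cj_fix_gpow[OF ga, of m] by (simp only: cj_fix_iff)
    then have "Z1 \<up> (j - 1) = y \<up> (a * (j - 1)) * g \<up> (m * (j - 1))"
      unfolding Z1 gpow_mult by (rule gpow_mult_distrib)
    moreover have "Z1 \<up> (j - 1) = 1" unfolding Z1_def cj_gpow[symmetric] Zj by simp
    ultimately have "y \<up> (a * (j - 1)) * f = 1" using fm by simp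
    then have "y \<up> (a * (j - 1)) = g \<up> l" using ff fg by (metis group_cancel_right)
    then show ?thesis using trivg fg by metis
  qed
  have yZ': "cj (ginv y) Z = Z1" "cj y Z1 = Z" using yZ \<open>f = 1\<close> by (simp_all flip: Z1_def) (metis cj_ginv_cj(2))
  have "y \<up> a = 1" using za \<open>f = 1\<close> core_free by simp
  then have Z1g: "Z1 = g \<up> m" using Z1 by simp
  \<comment> \<open>\<open>y\<close> exchanges \<open>Z\<close> and \<open>Z1\<close>, while
    \<open>z\<close> and \<open>t\<close> fix both. As these are powers of \<open>g\<close>,
    \<open>N\<close> meets \<open><y>\<close> trivially, and \<open>g \<up> (j + 1) = 1\<close>
    modulo \<open>N\<close> makes \<open>t\<close> invert \<open>g\<close> there.\<close>
  define N where "N = {Z \<up> i * Z1 \<up> n | i n. True}"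
  have NI: "Z \<up> i * Z1 \<up> n \<in> N" for i n unfolding N_def by blast
  have N_g: "Z \<up> i * Z1 \<up> n = g \<up> ((j + 1) * i + m * n)" for i n
    by (simp add: Z_def Z1g gpow_add gpow_mult)
  have N1: "1 \<in> N" using NI[of 0 0] by simp
  have Ncom: "Z1 \<up> n * Z \<up> i = Z \<up> i * Z1 \<up> n" for i n
    unfolding Z_def Z1g by (simp add: gpow_gpow_commute flip: gpow_mult)
  have Nt: "x * x' \<in> N" if "x \<in> N" "x' \<in> N" for x x'
  proof -
    from that obtain i n i' n' where "x = Z \<up> i * Z1 \<up> n" "x' = Z \<up> i' * Z1 \<up> n'" unfolding N_def by blast
    then have "x * x' = Z \<up> i * (Z1 \<up> n * Z \<up> i') * Z1 \<up> n'" by (simp add: mult.assoc)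
    also have "\<dots> = Z \<up> (i + i') * Z1 \<up> (n + n')" unfolding Ncom by (simp add: gpow_add mult.assoc)
    finally show ?thesis using NI by simp
  qed
  have Ni: "ginv x \<in> N" if "x \<in> N" for x
  proof -
    from that obtain i n where "x = Z1 \<up> n * Z \<up> i" unfolding N_def Ncom by blast
    then have "ginv x = Z \<up> (- i) * Z1 \<up> (- n)" by (simp add: gpow_minus)
    then show ?thesis using NI by simp
  qed
  have tZ: "cj t Z = Z" "cj t Z1 = Z1"
  proof -
    show "cj t Z = Z" by (simp add: Z_def tg gpow_add gjj flip: gpow_mult) (metis gpow_1 gpow_gpow_commute)
    then show "cj t Z1 = Z1" by (simp add: Z1_def cj_cj_swap[of t] ty yZ'(1)[unfolded Z1_def])
  qed
  have zZ: "cj z Z = Z" "cj z Z1 = Z1" by (simp_all only: Z_def Z1g gz)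
  have y_nor: "y \<in> normalizer N"
  proof -
    have "cj y (Z \<up> i * Z1 \<up> n) = Z \<up> n * Z1 \<up> i" "cj (ginv y) (Z \<up> i * Z1 \<up> n) = Z \<up> n * Z1 \<up> i" for i n
      using yZ' by (simp_all add: Ncom flip: Z1_def) (simp_all add: Z1_def Ncom[unfolded Z1_def])
    then show ?thesis using NI unfolding normalizer_def N_def by auto
  qed
  have nor_fix: "h \<in> normalizer N" if "cj h Z = Z" "cj h Z1 = Z1" for h
  proof -
    have "cj h x = x \<and> cj (ginv h) x = x" if "x \<in> N" for x
      using that \<open>cj h Z = Z\<close> \<open>cj h Z1 = Z1\<close> cj_fix_ginv[OF \<open>cj h Z = Z\<close>]
        cj_fix_ginv[OF \<open>cj h Z1 = Z1\<close>] unfolding N_def by auto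
    then show ?thesis unfolding normalizer_def by simp
  qed
  have z_nor: "z \<in> normalizer N" and t_nor: "t \<in> normalizer N" using zZ tZ nor_fix by blast+
  have "\<exists>\<pi> :: 'a \<Rightarrow> 'a set bij. group_hom_on (normalizer N) \<pi> \<and>
    (\<forall>h \<in> normalizer N. \<pi> h = 1 \<longleftrightarrow> h \<in> N)"
    by (rule quotient_hom) (use N1 Nt Ni in auto)
  then obtain \<pi> :: "'a \<Rightarrow> 'a set bij" where hom: "group_hom_on (normalizer N) \<pi>"
    and ker: "\<And>h. h \<in> normalizer N \<Longrightarrow> \<pi> h = 1 \<longleftrightarrow> h \<in> N" by blast
  interpret \<pi>: group_hom_on "normalizer N" \<pi> by (rule hom)
  note \<pi>_simps = \<pi>.hom_times \<pi>.hom_ginv \<pi>.hom_gpow \<pi>.hom_cj \<pi>.D_times \<pi>.D_ginv \<pi>.D_gpow \<pi>.D_cj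
    y_nor z_nor t_nor \<pi>.hom_one
  have g_nor: "g \<in> normalizer N" and w_nor: "w \<in> normalizer N" unfolding g_def w_def by (simp_all add: \<pi>_simps)
  have \<pi>g: "\<pi> g = \<pi> z * \<pi> z" and \<pi>w: "\<pi> w = \<pi> y * \<pi> y" by (simp_all add: g_def w_def \<pi>_simps)
  interpret q: rot_pair "\<pi> y" "\<pi> z"
  proof (rule \<pi>.rot_pair_image[OF rot_pair_axioms y_nor z_nor])
    fix i n assume "\<pi> (y \<up> i) = \<pi> (z \<up> n)"
    then have "\<pi> (y \<up> i * ginv (z \<up> n)) = 1" by (simp add: \<pi>_simps)
    moreover have "y \<up> i * ginv (z \<up> n) \<in> normalizer N" by (simp add: \<pi>_simps)
    ultimately have "y \<up> i * ginv (z \<up> n) \<in> N" using ker by blast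
    then obtain s where "y \<up> i * ginv (z \<up> n) = g \<up> s" unfolding N_def N_g by blast
    moreover have "y \<up> i = y \<up> i * ginv (z \<up> n) * z \<up> n" by (simp add: mult.assoc)
    ultimately have "y \<up> i = z \<up> (2 * s + n)" by (simp only: g_pow gpow_add)
    then have "y \<up> i = 1" by (rule triv)
    then show "\<pi> (y \<up> i) = 1" by (simp add: \<pi>.hom_one)
  qed
  have \<pi>tg: "cj (\<pi> t) (\<pi> g) = ginv (\<pi> g)"
  proof -
    have Z_nor: "Z \<in> normalizer N" unfolding Z_def using g_nor by (rule \<pi>.D_gpow)
    moreover have "Z \<in> N" using NI[of 1 0] by simp
    ultimately have "\<pi> Z = 1" using ker by blast
    moreover have "g \<up> j = ginv g * Z"
      using gpow_add[of g "- 1" "j + 1"] by (simp add: Z_def)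
    ultimately have "\<pi> (g \<up> j) = ginv (\<pi> g)" using g_nor Z_nor by (simp add: \<pi>.hom_times \<pi>.hom_ginv \<pi>.D_ginv)
    then show ?thesis using g_nor t_nor by (metis \<pi>.hom_cj tg)
  qed
  have "\<pi> z * \<pi> z * (\<pi> y * \<pi> y) = \<pi> y * \<pi> y * (\<pi> z * \<pi> z)"
  proof (rule q.squares_commute[of "\<pi> t" "\<pi> g" 2])
    show "cj (\<pi> t) (\<pi> y) = ginv (\<pi> y)"
      using ty by (metis \<pi>.hom_cj \<pi>.hom_ginv y_nor t_nor)
    show "\<exists>i n. x = \<pi> y \<up> i * \<pi> g \<up> n" if "x \<in> q.V" for x
    proof (rule gen_pair_normal_form)
      show "x \<in> gen {\<pi> y, \<pi> g}" using q.V_gen[OF that] by (simp add: \<pi>g)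
      show "\<exists>k l. \<pi> g \<up> i * \<pi> y \<up> n = \<pi> y \<up> k * \<pi> g \<up> l" for i n
      proof -
        obtain k l where "g \<up> i * y \<up> n = y \<up> k * g \<up> l" using closed_g by blast
        then have "\<pi> (g \<up> i * y \<up> n) = \<pi> (y \<up> k * g \<up> l)" by simp
        then have "\<pi> g \<up> i * \<pi> y \<up> n = \<pi> y \<up> k * \<pi> g \<up> l" by (simp add: \<pi>_simps g_nor)
        then show ?thesis by blast
      qed
    qed
  qed (use \<pi>tg \<pi>g in \<open>simp_all add: gpow_2\<close>)
  then have \<pi>c: "\<pi> g * \<pi> w = \<pi> w * \<pi> g" by (simp add: \<pi>g \<pi>w)
  define d where "d = c * ginv c'"
  have dV: "d \<in> V" unfolding d_def using cV V_times V_ginv by blast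
  have "\<pi> c = \<pi> c'" using \<pi>c g_nor w_nor by (simp add: c_def c'_def \<pi>_simps)
  moreover have "c \<in> normalizer N" "c' \<in> normalizer N"
    using g_nor w_nor by (simp_all add: c_def c'_def \<pi>_simps)
  ultimately have "\<pi> d = 1" by (simp add: d_def \<pi>_simps)
  moreover have "d \<in> normalizer N" using g_nor w_nor by (simp add: d_def c_def c'_def \<pi>_simps)
  ultimately have "d \<in> N" using ker by blast
  then obtain i n where d: "d = Z \<up> i * Z1 \<up> n" unfolding N_def by blast
  define s where "s = (j + 1) * i + m * n"
  have dg: "d = g \<up> s" unfolding d N_g s_def ..
  have zd: "cj z d = d" unfolding dg by (rule gz)
  have yd': "cj y d = ginv d"
    using cj_z_V[OF dV] zd by (metis cj_ginv cj_ginv_cj(2) ginv_ginv)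
  have wd: "cj w d = d" by (simp add: w_def yd' flip: cj_cj)
  have dj: "d \<up> (j - 1) = 1"
  proof -
    have "Z1 \<up> (j - 1) = 1" unfolding Z1_def cj_gpow[symmetric] Zj by simp
    then have "(Z \<up> i) \<up> (j - 1) = 1" "(Z1 \<up> n) \<up> (j - 1) = 1"
      unfolding gpow_swap[of Z i] gpow_swap[of Z1 n] using Zj by simp_all
    then show ?thesis unfolding d gpow_mult_distrib[OF Ncom[symmetric]] by simp
  qed
  \<comment> \<open>\<open>f = 1\<close> says that \<open>E = w \<up> (j + 1)\<close> centralizes
    \<open>c\<close>, whereas \<open>w\<close> multiplies \<open>c\<close> by \<open>ginv d\<close>;
    so the power \<open>j + 1\<close> of \<open>d\<close> is trivial. So is the power
    \<open>j - 1\<close>, and the exponents differ by 2.\<close>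
  have dd: "d * d = 1"
  proof -
    have "cj w c = ginv d * c"
      by (simp add: d_def c_def c'_def cj_def mult.assoc)
    then have "cj E c = ginv d \<up> (j + 1) * c"
      unfolding E_def by (rule cj_scaled_pow) (simp add: wd)
    moreover have "cj E c = c"
    proof -
      have "c * ginv (cj E c) * cj E c = cj E c" using f_c \<open>f = 1\<close> by simp
      then show ?thesis by (simp add: mult.assoc)
    qed
    ultimately have "ginv d \<up> (j + 1) = 1" by (metis group_cancel_right mult_1_left)
    then have "d \<up> (j + 1) = 1" by (simp add: gpow_ginv)
    moreover have "j + 1 = j - 1 + 2" by simp
    ultimately have "d \<up> (j - 1 + 2) = 1" by metis
    then show ?thesis unfolding gpow_add dj by (simp add: gpow_2)
  qed
  then have gid: "ginv d = d" by (rule ginv_unique)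
  have yd: "cj y d = d" by (simp add: yd' gid)
  have dy: "d * y \<up> n = y \<up> n * d" for n using cj_fix_gpow[OF yd, of n] by (simp only: cj_fix_iff)
  have wg: "cj w g = d * g"
  proof -
    have "d * (w * g) = g * w" by (simp add: d_def c_def c'_def mult.assoc)
    then have "d * (d * (w * g)) = d * (g * w)" by simp
    then have "w * g = d * g * w" by (simp add: dd mult.assoc flip: mult.assoc[of d d])
    then show ?thesis by (metis cj_mult_left group_cancel_right)
  qed
  define G where "G = cj y g"
  have yg: "cj (ginv y) g = d * G"
  proof -
    have "cj y (cj y g) = d * g" using wg by (simp add: w_def cj_cj)
    then have "cj y g = d * cj (ginv y) g" using yd by (metis cj_ginv_cj(1) cj_mult)
    then have "d * G = d * (d * cj (ginv y) g)" by (simp add: G_def)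
    then show ?thesis by (simp add: dd flip: mult.assoc)
  qed
  have zG: "cj z G = d * G" using zcjy[of 1] yg by (simp add: G_def)
  obtain a' m' where G: "G = y \<up> a' * g \<up> m'" using nf[OF cjy_gen[of 1]] unfolding G_def by auto
  have za': "cj z (y \<up> a') = d * y \<up> a'"
  proof -
    have "cj z (y \<up> a') * g \<up> m' = d * y \<up> a' * g \<up> m'"
      using zG gz(1)[of m'] unfolding G by (metis cj_mult mult.assoc)
    then show ?thesis by simp
  qed
  have aa': "y \<up> a' * y \<up> a' = 1"
  proof -
    have "cj z (y \<up> (a' + a')) = d * (y \<up> a' * d) * y \<up> a'" by (simp only: gpow_add cj_mult za' mult.assoc)
    also have "\<dots> = y \<up> (a' + a')" unfolding dy[symmetric] gpow_add by (simp add: dd flip: mult.assoc)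
    finally have "y \<up> (a' + a') = 1" using core_free by blast
    then show ?thesis by (simp only: gpow_add)
  qed
  then have gia': "ginv (y \<up> a') = y \<up> a'" by (rule ginv_unique)
  have ga': "cj g (y \<up> a') = y \<up> a'"
    unfolding g_def cj_cj[symmetric] za' cj_mult zd by (simp add: dd flip: mult.assoc)
  have "cj t G = (d * G) \<up> j" by (simp add: G_def cj_cj_swap[of t] ty tg yg[unfolded G_def])
  moreover have dG: "d * G = G * d"
  proof -
    have "d * g \<up> m' = g \<up> m' * d" unfolding dg by (rule gpow_gpow_commute)
    then show ?thesis unfolding G using dy[of a'] by (metis mult.assoc)
  qed
  ultimately have 1: "cj t G = d \<up> j * G \<up> j" unfolding gpow_mult_distrib[OF dG] by blast
  have "y \<up> a' * g \<up> m' = g \<up> m' * y \<up> a'" using cj_fix_gpow[OF ga', of m'] by (simp only: cj_fix_iff)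
  then have "G \<up> j = (y \<up> a') \<up> j * (g \<up> m') \<up> j" unfolding G by (rule gpow_mult_distrib)
  then have "y \<up> a' * (g \<up> j) \<up> m' = d \<up> j * (y \<up> a') \<up> j * (g \<up> m') \<up> j"
    using 1 unfolding G by (simp add: ty tg gpow_ginv gia' mult.assoc)
  then have 2: "y \<up> a' = d \<up> j * (y \<up> a') \<up> j" by (simp add: gpow_swap)
  \<comment> \<open>For even \<open>j\<close>, \<open>d\<close> is a power of \<open>g\<close>,
    whence \<open>d = d \<up> (j * j) = 1\<close>; for odd \<open>j\<close> the last equation reads
    \<open>y \<up> a' = d * y \<up> a'\<close>.\<close>
  have "d = 1"
  proof (cases "even j")
    case True
    then have "even (j * j)" by simp
    then have "d \<up> (j * j) = 1" using gpow_mod2(1)[OF dd] by blast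
    moreover have "d \<up> (j * j) = d" unfolding dg using gjj by (metis gpow_swap gpow_mult)
    ultimately show ?thesis by simp
  next
    case False
    then show ?thesis using 2 gpow_mod2(2)[OF dd False] gpow_mod2(2)[OF aa' False]
      by (metis group_cancel_right mult_1_left)
  qed
  then have "c = c'" by (metis d_def ginv_left_assoc ginv_right group_cancel_right)
  then show ?thesis by (simp add: c_def c'_def g_def w_def)
qed

end

section \<open>Three consecutive rotations\<close>

context rot_pair
begin

definition core_y :: "'a set"
  where "core_y = {p \<in> range (\<lambda>k. y \<up> k). \<forall>h \<in> gen {y, z}. cj h p \<in> range (\<lambda>k. y \<up> k)}"

lemma range_y: "1 \<in> range (\<lambda>k. y \<up> k)"
  "a \<in> range (\<lambda>k. y \<up> k) \<Longrightarrow> b \<in> range (\<lambda>k. y \<up> k) \<Longrightarrow> a * b \<in> range (\<lambda>k. y \<up> k)"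
  "a \<in> range (\<lambda>k. y \<up> k) \<Longrightarrow> ginv a \<in> range (\<lambda>k. y \<up> k)"
  "a \<in> range (\<lambda>k. y \<up> k) \<Longrightarrow> b \<in> range (\<lambda>k. y \<up> k) \<Longrightarrow> a * b = b * a"
proof -
  show "1 \<in> range (\<lambda>k. y \<up> k)" by (metis gpow_0 rangeI)
  show "a \<in> range (\<lambda>k. y \<up> k) \<Longrightarrow> b \<in> range (\<lambda>k. y \<up> k) \<Longrightarrow> a * b \<in> range (\<lambda>k. y \<up> k)"
    by (auto simp flip: gpow_add)
  show "a \<in> range (\<lambda>k. y \<up> k) \<Longrightarrow> ginv a \<in> range (\<lambda>k. y \<up> k)"
    by (auto simp flip: gpow_minus)
  show "a \<in> range (\<lambda>k. y \<up> k) \<Longrightarrow> b \<in> range (\<lambda>k. y \<up> k) \<Longrightarrow> a * b = b * a"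
    by (auto intro: gpow_gpow_commute)
qed

lemma core_range: "p \<in> core_y \<Longrightarrow> p \<in> range (\<lambda>k. y \<up> k)"
  by (simp add: core_y_def)

lemma core_one: "1 \<in> core_y"
  by (simp add: core_y_def range_y)

lemma core_times: "p \<in> core_y \<Longrightarrow> q \<in> core_y \<Longrightarrow> p * q \<in> core_y"
  by (simp add: core_y_def range_y(2))

lemma core_ginv: "p \<in> core_y \<Longrightarrow> ginv p \<in> core_y"
  by (simp add: core_y_def range_y(3))

lemma core_gpow: "p \<in> core_y \<Longrightarrow> p \<up> n \<in> core_y"
  by (rule gpow_closed) (auto intro: core_one core_times core_ginv simp del: ginv_mult)

lemma core_cj: "p \<in> core_y \<Longrightarrow> h \<in> gen {y, z} \<Longrightarrow> cj h p \<in> core_y"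
  unfolding core_y_def by (simp add: cj_cj gen_times)

text \<open>\<open>y\<close> centralizes its own powers, so stability under \<open>z\<close> and
  \<open>ginv z\<close> is all that normality demands.\<close>

lemma core_largest:
  assumes S: "S \<subseteq> range (\<lambda>k. y \<up> k)" and z: "\<And>p. p \<in> S \<Longrightarrow> cj z p \<in> S \<and> cj (ginv z) p \<in> S"
  shows "S \<subseteq> core_y"
proof
  fix p assume p: "p \<in> S"
  have "cj h p \<in> S" if "h \<in> gen {y, z}" for h using that
  proof (induction rule: gen.induct)
    case gen_one
    show ?case using p by (simp add: cj_def)
  next
    have y: "cj y q = q" "cj (ginv y) q = q" if "q \<in> S" for q
      using S that by (auto simp: cj_fix_ginv)
    {
      case (gen_mult s a)
      then show ?case using y z by (auto simp flip: cj_cj)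
    next
      case (gen_inv s a)
      then show ?case using y z by (auto simp flip: cj_cj)
    }
  qed
  then show "p \<in> core_y" using p S unfolding core_y_def by blast
qed

text \<open>The products of powers of \<open>y \<up> k\<close> with core elements are stable under
  \<open>z\<close>, hence lie in the core. This yields the assumption \<open>core_free\<close> of
  \<open>squares_commute_core_free\<close> after division by the core; \<open>e\<close> covers its
  two alternatives.\<close>

lemma core_free_mod_core:
  assumes p: "p \<in> core_y" and e: "e = 1 \<or> e = - 1" and c: "cj z (y \<up> k) = p * y \<up> (e * k)"
  shows "y \<up> k \<in> core_y"
proof -
  define S where "S = {y \<up> (k * i) * q | i q. q \<in> core_y}"
  have SI: "q \<in> core_y \<Longrightarrow> y \<up> (k * i) * q \<in> S" for i q unfolding S_def by blast
  have zg: "z \<in> gen {y, z}" "ginv z \<in> gen {y, z}" by (auto intro: gen_incl gen_ginv)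
  have com: "y \<up> n * q = q * y \<up> n" if "q \<in> core_y" for q n
    by (rule range_y(4)) (use that core_range in auto)
  have c_i: "cj z (y \<up> (k * i)) = y \<up> (k * (e * i)) * p \<up> i" for i
  proof -
    have "cj z (y \<up> (k * i)) = (p * y \<up> (e * k)) \<up> i"
      unfolding gpow_mult[of y k i] cj_gpow[of z "y \<up> k" i] c ..
    also have "\<dots> = p \<up> i * (y \<up> (e * k)) \<up> i" by (rule gpow_mult_distrib[OF com[OF p, symmetric]])
    also have "(y \<up> (e * k)) \<up> i = y \<up> (k * (e * i))" by (simp add: ac_simps flip: gpow_mult)
    finally show ?thesis using com[OF core_gpow[OF p]] by simp
  qed
  have inv_i: "cj (ginv z) (y \<up> (k * i)) = y \<up> (k * (e * i)) * ginv (cj (ginv z) (p \<up> (e * i)))" for i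
  proof -
    have "cj z (y \<up> (k * (e * i))) = y \<up> (k * i) * p \<up> (e * i)"
      using c_i[of "e * i"] e by (auto simp: mult.assoc)
    then have "y \<up> (k * (e * i)) = cj (ginv z) (y \<up> (k * i)) * cj (ginv z) (p \<up> (e * i))"
      by (metis cj_ginv_cj(1) cj_mult)
    then show ?thesis by (simp add: mult.assoc)
  qed
  have "S \<subseteq> core_y"
  proof (rule core_largest)
    show "S \<subseteq> range (\<lambda>k. y \<up> k)" unfolding S_def using core_range range_y(2) by blast
    fix s assume "s \<in> S"
    then obtain i q where s: "s = y \<up> (k * i) * q" and q: "q \<in> core_y" unfolding S_def by blast
    have "cj z s = y \<up> (k * (e * i)) * (p \<up> i * cj z q)"
      unfolding s cj_mult c_i by (simp add: mult.assoc)
    moreover have "cj (ginv z) s = y \<up> (k * (e * i)) * (ginv (cj (ginv z) (p \<up> (e * i))) * cj (ginv z) q)"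
      unfolding s cj_mult inv_i by (simp only: mult.assoc)
    moreover have "p \<up> i * cj z q \<in> core_y"
      by (intro core_times core_gpow core_cj p q zg)
    moreover have "ginv (cj (ginv z) (p \<up> (e * i))) * cj (ginv z) q \<in> core_y"
      by (intro core_times core_ginv core_gpow core_cj p q zg)
    ultimately show "cj z s \<in> S \<and> cj (ginv z) s \<in> S"
      by (simp only: SI simp_thms)
  qed
  moreover have "y \<up> k \<in> S" using SI[OF core_one, of 1] by simp
  ultimately show ?thesis by blast
qed

end

locale rot_triple =
  fixes y z w :: "'a::mult_group"
  assumes yz: "rot_pair y z" and zw: "rot_pair z w"
    and inv_yzw: "y * z * w * y * z * w = 1"
    and triv3: "y \<up> i * z \<up> j * w \<up> k = 1 \<Longrightarrow> y \<up> i = 1 \<and> z \<up> j = 1 \<and> w \<up> k = 1"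
    and finite_z: "\<exists>n::nat. 0 < n \<and> z ^ n = 1"
begin

sublocale yz: rot_pair y z by (rule yz)

sublocale zw: rot_pair z w by (rule zw)

sublocale wz: rot_pair w z by (rule zw.dual)

text \<open>If \<open>b\<close> is odd, then \<open>z\<close> has an odd period, so every power of
  \<open>z\<close> is a power of \<open>z * z\<close>. Indeed, for an even period
  \<open>2 * m\<close>, conjugating \<open>(z * z) \<up> m = 1\<close> by \<open>w\<close> yields
  \<open>z \<up> (b * m) = 1\<close>; since \<open>z \<up> m\<close> squares to 1 and
  \<open>b\<close> is odd, already \<open>m\<close> is a period.\<close>

lemma square_exponent:
  assumes "cj w (z * z) = w \<up> a * z \<up> b" "z * w \<up> a = w \<up> a * z"
  shows "\<exists>j. z \<up> b = (z * z) \<up> j"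
proof (cases "even b")
  case True
  then show ?thesis by (metis evenE gpow_2 gpow_mult)
next
  case False
  have "\<exists>q. odd q \<and> z \<up> q = 1" if "0 < n" "z \<up> int n = 1" for n :: nat
    using that
  proof (induction n rule: less_induct)
    case (less n)
    show ?case
    proof (cases "even n")
      case True
      then obtain m where m: "n = 2 * m" by (auto elim: evenE)
      have zm: "z \<up> int m * z \<up> int m = 1"
      proof -
        have "int m + int m = int n" using m by simp
        then show ?thesis unfolding gpow_add[symmetric] using less(3) by metis
      qed
      then have zz: "(z * z) \<up> int m = 1" by (simp only: gpow_mult_distrib)
      have "(w \<up> a * z \<up> b) \<up> int m = cj w ((z * z) \<up> int m)" by (simp only: cj_gpow assms(1))
      also have "\<dots> = 1" by (simp only: zz cj_one)
      finally have "(w \<up> a * z \<up> b) \<up> int m = 1" .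
      moreover have wz: "w \<up> a * z \<up> b = z \<up> b * w \<up> a"
      proof -
        have "cj z (w \<up> a) = w \<up> a" unfolding cj_fix_iff by (rule assms(2))
        from cj_fix_gpow[OF this, of b] show ?thesis unfolding cj_fix_iff by simp
      qed
      ultimately have "w \<up> (a * int m) * z \<up> (b * int m) = 1"
        unfolding gpow_mult gpow_mult_distrib[OF wz] by blast
      then have "z \<up> (b * int m) = 1" by (rule wz.normal_form_one)
      then have "(z \<up> int m) \<up> b = 1" unfolding gpow_mult[symmetric] by (simp add: mult.commute)
      then have "z \<up> int m = 1" using gpow_mod2(2)[OF zm False] by simp
      moreover have "m < n" "0 < m" using m less(2) by auto
      ultimately show ?thesis using less(1) by blast
    next
      case False
      then show ?thesis using less(3) by (metis even_of_nat_iff)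
    qed
  qed
  moreover obtain n :: nat where "0 < n" "z \<up> int n = 1" using finite_z unfolding gpow_of_nat by blast
  ultimately obtain q where q: "odd q" "z \<up> q = 1" by blast
  then obtain m where "q = 2 * m + 1" by (auto elim: oddE)
  then have "z = z \<up> (2 * (m + 1))" using q(2) gpow_add[of z 1 q] by (simp add: algebra_simps)
  then have "z = (z * z) \<up> (m + 1)" by (simp only: gpow_mult gpow_2)
  then show ?thesis by (metis gpow_mult)
qed

text \<open>Modulo the core of \<open>\<langle>y\<rangle>\<close> in \<open>\<langle>y,z\<rangle>\<close> and the normal subgroup \<open>\<langle>w\<^sup>a\<rangle>\<close>, where
  \<open>w z\<^sup>2 w\<^sup>-\<^sup>1 = w\<^sup>a z\<^sup>b\<close>, the core-free case applies with \<open>t = zw\<close>.\<close>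

lemma commut_squares_in_y:
  assumes rz: "cj r z = ginv z" and rw: "cj r w = ginv w"
  shows "\<exists>k. commut (z * z) (y * y) = y \<up> k"
proof -
  have "z * z * (w * w) = w * w * (z * z)"
    by (rule wz.squares_commute[OF rw rz, of 1]) (use rz wz.gen_normal_form wz.V_gen' in auto)
  then obtain a b where ab: "cj w (z * z) = w \<up> a * z \<up> b" and wa: "z * w \<up> a = w \<up> a * z"
    by (rule wz.squares_commute_conj)
  obtain j where j: "z \<up> b = (z * z) \<up> j" using square_exponent[OF ab wa] by blast
  define om where "om = w \<up> a"
  have om_pow: "om \<up> n = w \<up> (a * n)" for n by (simp add: om_def gpow_mult)
  have zom: "cj z om = om" using wa by (simp add: om_def cj_fix_iff del: cj_gpow)
  define t where "t = z * w"
  have tt: "t * t = 1" using zw.inv_yz by (simp add: t_def mult.assoc)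
  have gt: "ginv t = t" using tt by (rule ginv_unique)
  have ytyt: "y * t * y * t = 1" using inv_yzw by (simp add: t_def mult.assoc)
  have ty: "cj t y = ginv y"
  proof -
    have "y * (t * y * t) = 1" using ytyt by (simp add: mult.assoc)
    then show ?thesis unfolding cj_def gt by (metis ginv_unique)
  qed
  have tz: "cj t (z * z) = om * (z * z) \<up> j"
  proof -
    have "cj t (z * z) = cj z (om * z \<up> b)" unfolding t_def cj_cj[symmetric] ab om_def ..
    also have "\<dots> = om * z \<up> b" using zom by simp
    finally show ?thesis by (simp add: j)
  qed
  have tom: "cj t om = om" unfolding t_def cj_cj[symmetric] using zom by (simp add: om_def)
  have yom: "cj y om = ginv om"
  proof -
    have "cj (y * z) w = ginv w"
    proof -
      have "y * z * w * (y * z) * w = 1" using inv_yzw by (simp add: mult.assoc)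
      then have "y * z * w * (y * z) = ginv w" by (metis ginv_ginv ginv_unique ginv_mult ginv_right_assoc mult.assoc ginv_right mult_1_right)
      then show ?thesis unfolding cj_def using yz.ginv_u by (simp add: yz.u_def)
    qed
    then have "cj (y * z) om = ginv om" by (simp add: om_def gpow_ginv)
    then show ?thesis using zom by (metis cj_cj)
  qed
  have yk: "\<exists>e. cj (y \<up> k) (om \<up> n) = om \<up> e" for k n
  proof -
    have "cj (y \<up> k) om = om \<or> cj (y \<up> k) om = ginv om"
    proof (induction k rule: int_induct[where k = 0])
      case base
      show ?case by (simp add: cj_def)
    next
      case (step1 i)
      then show ?case using yom by (auto simp: add.commute[of i] gpow_add simp flip: cj_cj)
    next
      case (step2 i)
      have "cj (ginv y) om = ginv om" using yom by (metis cj_ginv cj_ginv_cj(1) ginv_ginv)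
      then show ?case using step2 gpow_add[of y "- 1" i]
        by (auto simp flip: cj_cj)
    qed
    then have "cj (y \<up> k) (om \<up> n) = om \<up> n \<or> cj (y \<up> k) (om \<up> n) = om \<up> (- n)"
      by (auto simp: gpow_ginv gpow_minus)
    then show ?thesis by blast
  qed
  \<comment> \<open>Dividing by \<open><om>\<close> makes \<open>t\<close> map \<open>z * z\<close>
    to its power \<open>j\<close>; dividing by the core provides \<open>core_free\<close>.\<close>
  define N where "N = {p * om \<up> n | p n. p \<in> yz.core_y}"
  have NI: "p \<in> yz.core_y \<Longrightarrow> p * om \<up> n \<in> N" for p n unfolding N_def by blast
  have swap: "\<exists>m. om \<up> n * p = p * om \<up> m" if pc: "p \<in> yz.core_y" for p n
  proof -
    obtain k where p: "p = y \<up> k" using yz.core_range pc by blast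
    obtain m where "cj (y \<up> (- k)) (om \<up> n) = om \<up> m" using yk by blast
    then have "p * (ginv p * om \<up> n * p) = p * om \<up> m" by (simp add: p cj_def gpow_minus mult.assoc)
    then show ?thesis by (auto simp: mult.assoc)
  qed
  have N1: "1 \<in> N" using NI[OF yz.core_one, of 0] by simp
  have Nt: "x * x' \<in> N" if "x \<in> N" "x' \<in> N" for x x'
  proof -
    from that obtain p n p' n' where x: "x = p * om \<up> n" "x' = p' * om \<up> n'"
      and p: "p \<in> yz.core_y" "p' \<in> yz.core_y" unfolding N_def by blast
    obtain m where m: "om \<up> n * p' = p' * om \<up> m" using swap[OF p(2)] by blast
    have "x * x' = p * (om \<up> n * p') * om \<up> n'" by (simp add: x mult.assoc)
    also have "\<dots> = p * p' * om \<up> (m + n')" by (simp add: m gpow_add mult.assoc)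
    finally show ?thesis using NI yz.core_times[OF p] by simp
  qed
  have Ni: "ginv x \<in> N" if "x \<in> N" for x
  proof -
    from that obtain p n where x: "x = p * om \<up> n" and p: "p \<in> yz.core_y" unfolding N_def by blast
    obtain m where "om \<up> (- n) * ginv p = ginv p * om \<up> m" using swap[OF yz.core_ginv[OF p]] by blast
    then have "ginv x = ginv p * om \<up> m" by (simp add: x gpow_minus)
    then show ?thesis using NI yz.core_ginv[OF p] by simp
  qed
  have nor: "h \<in> normalizer N"
    if "\<And>p. p \<in> yz.core_y \<Longrightarrow> cj h p \<in> yz.core_y" "\<And>p. p \<in> yz.core_y \<Longrightarrow> cj (ginv h) p \<in> yz.core_y"
      "cj h om = om \<or> cj h om = ginv om" for h
  proof -
    have "cj (ginv h) om = om \<or> cj (ginv h) om = ginv om"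
      using that(3) by (metis cj_ginv cj_ginv_cj(1) ginv_ginv)
    with that(3) have "\<exists>m. cj h (om \<up> n) = om \<up> m" "\<exists>m. cj (ginv h) (om \<up> n) = om \<up> m" for n
      by (metis cj_gpow gpow_ginv gpow_minus)+
    then have "cj h (p * om \<up> n) \<in> N \<and> cj (ginv h) (p * om \<up> n) \<in> N" if "p \<in> yz.core_y" for p n
      unfolding cj_mult using NI \<open>p \<in> _\<close> \<open>\<And>p. p \<in> yz.core_y \<Longrightarrow> cj h p \<in> yz.core_y\<close>
        \<open>\<And>p. p \<in> yz.core_y \<Longrightarrow> cj (ginv h) p \<in> yz.core_y\<close> by metis
    then show ?thesis unfolding normalizer_def N_def by blast
  qed
  have gens: "y \<in> gen {y, z}" "z \<in> gen {y, z}" by (auto intro: gen_incl)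
  have y_nor: "y \<in> normalizer N" and z_nor: "z \<in> normalizer N"
    by (rule nor; use gens yz.core_cj gen_ginv yom zom in blast)+
  have t_nor: "t \<in> normalizer N"
  proof (rule nor)
    have "cj t p \<in> yz.core_y" if pc: "p \<in> yz.core_y" for p
    proof -
      obtain k where p: "p = y \<up> k" using yz.core_range pc by blast
      have "cj t p = ginv p" by (simp add: p ty gpow_ginv)
      then show ?thesis using yz.core_ginv pc by simp
    qed
    then show "\<And>p. p \<in> yz.core_y \<Longrightarrow> cj t p \<in> yz.core_y" "\<And>p. p \<in> yz.core_y \<Longrightarrow> cj (ginv t) p \<in> yz.core_y"
      by (simp_all add: gt)
  qed (simp add: tom)
  have om_nor: "om \<in> normalizer N"
    unfolding normalizer_def using Nt Ni NI[OF yz.core_one, of 1] by (auto simp: cj_def)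
  have "\<exists>\<pi> :: 'a \<Rightarrow> 'a set bij. group_hom_on (normalizer N) \<pi> \<and>
    (\<forall>h \<in> normalizer N. \<pi> h = 1 \<longleftrightarrow> h \<in> N)"
    by (rule quotient_hom) (use N1 Nt Ni in auto)
  then obtain \<pi> :: "'a \<Rightarrow> 'a set bij" where hom: "group_hom_on (normalizer N) \<pi>"
    and ker: "\<And>h. h \<in> normalizer N \<Longrightarrow> \<pi> h = 1 \<longleftrightarrow> h \<in> N" by blast
  interpret \<pi>: group_hom_on "normalizer N" \<pi> by (rule hom)
  note D = \<pi>.D_times \<pi>.D_ginv \<pi>.D_gpow \<pi>.D_cj y_nor z_nor t_nor om_nor \<pi>.D_one
  note \<pi>_simps = \<pi>.hom_times \<pi>.hom_ginv \<pi>.hom_gpow \<pi>.hom_cj \<pi>.hom_one D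
  have \<pi>_eq: "\<exists>p n. p \<in> yz.core_y \<and> g = p * om \<up> n * h"
    if "g \<in> normalizer N" "h \<in> normalizer N" "\<pi> g = \<pi> h" for g h
  proof -
    have "\<pi> (g * ginv h) = 1" using that by (simp add: \<pi>.hom_times \<pi>.hom_ginv \<pi>.D_ginv)
    then have "g * ginv h \<in> N" using ker \<pi>.D_times \<pi>.D_ginv that by blast
    then obtain p n where "p \<in> yz.core_y" "g * ginv h = p * om \<up> n" unfolding N_def by blast
    moreover have "g = g * ginv h * h" by (simp add: mult.assoc)
    ultimately show ?thesis by metis
  qed
  have \<pi>om: "\<pi> om = 1" using ker[OF om_nor] NI[OF yz.core_one, of 1] by simp
  \<comment> \<open>\<open><om>\<close> meets \<open><y, z>\<close> trivially, so an equation within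
    \<open><y, z>\<close> that holds modulo \<open>N\<close> holds modulo the core.\<close>
  have om_gen: "om \<up> n = 1" if g: "om \<up> n \<in> gen {y, z}" for n
  proof -
    obtain i l where il: "om \<up> n = y \<up> i * z \<up> l" using yz.gen_normal_form g by blast
    have e: "w \<up> (a * (- n)) = ginv (om \<up> n)" unfolding om_pow[symmetric] by (rule gpow_minus)
    have "y \<up> i * z \<up> l * w \<up> (a * (- n)) = 1" unfolding e il[symmetric] by (rule ginv_right)
    then have "w \<up> (a * (- n)) = 1" using triv3 by blast
    then have "ginv (om \<up> n) = 1" by (simp only: e)
    then show ?thesis by simp
  qed
  have core_gen: "p \<in> gen {y, z}" if "p \<in> yz.core_y" for p
    using yz.core_range[OF that] gen_gpow[OF gens(1)] by auto
  interpret q: rot_pair "\<pi> y" "\<pi> z"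
  proof (rule \<pi>.rot_pair_image[OF yz y_nor z_nor])
    fix i n assume eq: "\<pi> (y \<up> i) = \<pi> (z \<up> n)"
    then obtain p m where p: "p \<in> yz.core_y" "z \<up> n = p * om \<up> m * y \<up> i"
      using \<pi>_eq[of "z \<up> n" "y \<up> i"] \<pi>.D_gpow y_nor z_nor by metis
    have "om \<up> m = ginv p * z \<up> n * ginv (y \<up> i)" by (simp add: p(2) mult.assoc)
    also have "\<dots> \<in> gen {y, z}" by (intro gen_times gen_ginv gen_gpow gens core_gen p(1))
    finally have "om \<up> m = 1" by (rule om_gen)
    moreover obtain k where "p = y \<up> k" using yz.core_range[OF p(1)] by blast
    ultimately have "y \<up> (k + i) = z \<up> n" using p(2) by (simp add: gpow_add)
    then have "z \<up> n = 1" using yz.triv by metis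
    then show "\<pi> (y \<up> i) = 1" using eq \<pi>.hom_one by simp
  qed
  have "\<pi> z * \<pi> z * (\<pi> y * \<pi> y) = \<pi> y * \<pi> y * (\<pi> z * \<pi> z)"
  proof (rule q.squares_commute_core_free)
    show "cj (\<pi> t) (\<pi> y) = ginv (\<pi> y)"
      using ty by (metis \<pi>.hom_cj \<pi>.hom_ginv y_nor t_nor)
    show "\<pi> t * \<pi> t = 1" using tt by (metis \<pi>.hom_times \<pi>.hom_one t_nor)
    have "\<pi> (cj t (z * z)) = \<pi> (om * (z * z) \<up> j)" by (simp only: tz)
    then show "cj (\<pi> t) (\<pi> z * \<pi> z) = (\<pi> z * \<pi> z) \<up> j" by (simp add: \<pi>_simps \<pi>om del: cj_mult)
  next
    fix k
    assume "cj (\<pi> z) (\<pi> y \<up> k) = \<pi> y \<up> k \<or> cj (\<pi> z) (\<pi> y \<up> k) = ginv (\<pi> y \<up> k)"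
    then obtain e where e: "e = 1 \<or> e = - 1" "cj (\<pi> z) (\<pi> y \<up> k) = \<pi> y \<up> (e * k)"
      by (metis gpow_minus mult_1 mult_minus1)
    then have "\<pi> (cj z (y \<up> k)) = \<pi> (y \<up> (e * k))" by (simp only: \<pi>_simps)
    then obtain p m where p: "p \<in> yz.core_y" "cj z (y \<up> k) = p * om \<up> m * y \<up> (e * k)"
      using \<pi>_eq[of "cj z (y \<up> k)" "y \<up> (e * k)"] \<pi>.D_cj \<pi>.D_gpow y_nor z_nor by blast
    have "om \<up> m = ginv p * cj z (y \<up> k) * ginv (y \<up> (e * k))" by (simp add: p(2) mult.assoc del: cj_gpow)
    also have "\<dots> \<in> gen {y, z}" unfolding cj_def
      by (intro gen_times gen_ginv gen_gpow gens core_gen p(1))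
    finally have "om \<up> m = 1" by (rule om_gen)
    then have "cj z (y \<up> k) = p * y \<up> (e * k)" using p(2) by simp
    then have "y \<up> k \<in> yz.core_y" using yz.core_free_mod_core p(1) e(1) by blast
    then have "y \<up> k \<in> N" using NI[of "y \<up> k" 0] by simp
    then have "\<pi> (y \<up> k) = 1" using ker \<pi>.D_gpow[OF y_nor] by blast
    then show "\<pi> y \<up> k = 1" by (simp add: \<pi>_simps)
  next
    fix k l
    assume "cj (\<pi> t) (\<pi> z) = \<pi> y \<up> k * \<pi> z \<up> l"
    then have "\<pi> (cj t z) = \<pi> (y \<up> k * z \<up> l)" by (simp only: \<pi>_simps)
    then obtain p m where p: "p \<in> yz.core_y" "cj t z = p * om \<up> m * (y \<up> k * z \<up> l)"
      using \<pi>_eq[of "cj t z" "y \<up> k * z \<up> l"] \<pi>.D_cj[OF z_nor t_nor]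
        \<pi>.D_times[OF \<pi>.D_gpow[OF y_nor] \<pi>.D_gpow[OF z_nor]] by blast
    have "\<exists>e. om \<up> m * y \<up> k = y \<up> k * om \<up> e"
    proof -
      obtain e where "cj (y \<up> (- k)) (om \<up> m) = om \<up> e" using yk by blast
      then have "y \<up> k * (ginv (y \<up> k) * om \<up> m * y \<up> k) = y \<up> k * om \<up> e" by (simp add: cj_def gpow_minus mult.assoc)
      then show ?thesis by (auto simp: mult.assoc)
    qed
    then obtain e where e: "om \<up> m * y \<up> k = y \<up> k * om \<up> e" by blast
    have oz: "om \<up> e * z \<up> l = z \<up> l * om \<up> e"
      using cj_fix_gpow2[OF zom, of l e] unfolding cj_fix_iff by simp
    obtain s where s: "p = y \<up> s" using yz.core_range[OF p(1)] by blast
    have "cj t z = p * (om \<up> m * y \<up> k) * z \<up> l" by (simp add: p(2) mult.assoc)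
    also have "\<dots> = y \<up> (s + k) * z \<up> l * om \<up> e" unfolding e s by (simp add: gpow_add oz mult.assoc)
    finally have tz1: "cj t z = y \<up> (s + k) * z \<up> l * om \<up> e" .
    \<comment> \<open>\<open>cj t z\<close> lies in \<open><z, w>\<close> because
      \<open>t = z * w\<close>, so uniqueness of normal forms removes its \<open>y\<close>-part.
      What remains determines \<open>cj w z\<close>, which equals
      \<open>ginv z * ginv (w * w)\<close>; comparing \<open>z\<close>-parts gives
      \<open>z \<up> l = ginv z\<close>.\<close>
    have gens': "z \<in> gen {z, w}" "w \<in> gen {z, w}" by (auto intro: gen_incl)
    have "z \<up> l * om \<up> e * ginv (cj t z) \<in> gen {z, w}" unfolding om_pow t_def cj_def
      by (intro gen_times gen_ginv gen_gpow gens')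
    then obtain i n where "z \<up> l * om \<up> e * ginv (cj t z) = z \<up> i * w \<up> n" using zw.gen_normal_form by blast
    moreover have "y \<up> (s + k) * (z \<up> l * om \<up> e * ginv (cj t z)) = 1"
      by (subst tz1) (simp add: mult.assoc)
    ultimately have "y \<up> (s + k) * z \<up> i * w \<up> n = 1" by (simp add: mult.assoc)
    then have "y \<up> (s + k) = 1" using triv3 by blast
    then have tz2: "cj t z = z \<up> l * w \<up> (a * e)" using tz1 by (simp add: om_pow)
    have "cj z (cj w z) = cj z (z \<up> l * om \<up> e)"
      using tz2 zom unfolding t_def by (simp add: om_pow cj_cj flip: om_pow)
    then have "cj w z = z \<up> l * w \<up> (a * e)" by (simp only: cj_inj om_pow)
    moreover have "cj w z = z \<up> (- 1) * w \<up> (- 2)"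
      using wz.zy_eq zw.zy_eq by (simp add: cj_def gpow_minus gpow_2 mult.assoc)
    ultimately have "z \<up> l = z \<up> (- 1)" using zw.normal_form_eq(1) by metis
    then have "cj t z = ginv z * om \<up> e" using tz2 by (simp add: om_pow)
    then have "\<pi> (cj t z) = \<pi> (ginv z * om \<up> e)" by simp
    then show "cj (\<pi> t) (\<pi> z) = ginv (\<pi> z)" by (simp add: \<pi>_simps \<pi>om)
  qed
  then have "\<pi> (z * z * (y * y)) = \<pi> (y * y * (z * z))" by (simp add: \<pi>_simps)
  then obtain p m where p: "p \<in> yz.core_y" "z * z * (y * y) = p * om \<up> m * (y * y * (z * z))"
    using \<pi>_eq[of "z * z * (y * y)" "y * y * (z * z)"] \<pi>.D_times y_nor z_nor by blast
  then have c: "commut (z * z) (y * y) = p * om \<up> m" by (simp add: commut_def mult.assoc)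
  then have "om \<up> m = ginv p * commut (z * z) (y * y)" by simp
  also have "\<dots> \<in> gen {y, z}" unfolding commut_def
    by (intro gen_times gen_ginv gens core_gen p(1))
  finally have "om \<up> m = 1" by (rule om_gen)
  then show ?thesis using c p(1) yz.core_range by auto
qed

end

section \<open>Four consecutive rotations\<close>

instantiation prod :: (mult_group, mult_group) mult_group
begin

definition one_prod :: "'a \<times> 'b" where "one_prod = (1, 1)"
definition times_prod :: "'a \<times> 'b \<Rightarrow> 'a \<times> 'b \<Rightarrow> 'a \<times> 'b"
  where "times_prod p q = (fst p * fst q, snd p * snd q)"
definition ginv_prod :: "'a \<times> 'b \<Rightarrow> 'a \<times> 'b" where "ginv_prod p = (ginv (fst p), ginv (snd p))"

instance
  by standard (simp_all add: one_prod_def times_prod_def ginv_prod_def mult.assoc)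

end

lemma Pair_times [simp]: "(a, b) * (c, d) = (a * c, b * d)"
  and Pair_ginv [simp]: "ginv (a, b) = (ginv a, ginv b)"
  by (simp_all add: times_prod_def ginv_prod_def)

lemma Pair_cj: "cj (a, b) (c, d) = (cj a c, cj b d)"
  by (simp add: cj_def)

lemma Pair_gpow: "(a, b) \<up> n = (a \<up> n, b \<up> n)"
proof (induction n rule: int_induct[where k = 0])
  case base
  show ?case by (simp add: one_prod_def)
next
  case (step1 i)
  then show ?case by (simp add: gpow_add)
next
  case (step2 i)
  then show ?case by (simp add: gpow_diff)
qed

section \<open>Products of cyclic subgroups as sets\<close>

definition cyc :: "'a::mult_group \<Rightarrow> 'a set" where "cyc a = range (\<lambda>k. a \<up> k)"

lemma cyc_gpow: "a \<up> k \<in> cyc a" and cyc_self: "a \<in> cyc a" and cyc_ginv: "ginv a \<in> cyc a"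
  and cyc_one: "1 \<in> cyc a"
  unfolding cyc_def by (auto simp: image_iff intro: exI[of _ 1] exI[of _ "- 1"] exI[of _ 0])

lemma cyc_cyc: "cyc a * cyc a = cyc a"
proof
  show "cyc a * cyc a \<subseteq> cyc a" by (auto simp: cyc_def set_times_def simp flip: gpow_add)
  show "cyc a \<subseteq> cyc a * cyc a" using cyc_one set_times_intro[of 1 "cyc a" _ "cyc a"] by fastforce
qed

lemma subset_times_one: "1 \<in> B \<Longrightarrow> A \<subseteq> A * (B :: 'a::monoid_mult set)"
  using set_times_intro[of _ A 1 B] by fastforce

lemma cyc_perm_iff: "cyc b * cyc a \<subseteq> cyc a * cyc b \<longleftrightarrow> (\<forall>i j. \<exists>k l. b \<up> i * a \<up> j = a \<up> k * b \<up> l)"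
  unfolding cyc_def set_times_def by (simp add: subset_iff) blast

lemma cyc_times3E:
  assumes "v \<in> cyc a * cyc b * cyc c"
  obtains i j k where "v = a \<up> i * b \<up> j * c \<up> k"
  using assms unfolding cyc_def set_times_def by blast

lemma cyc_times4E:
  assumes "v \<in> cyc a * cyc b * cyc c * cyc d"
  obtains i j k l where "v = a \<up> i * b \<up> j * c \<up> k * d \<up> l"
  using assms unfolding cyc_def set_times_def by blast

lemma cyc_left_closed:
  assumes "a *o B \<subseteq> B" "ginv a *o B \<subseteq> B"
  shows "cyc a * B \<subseteq> B"
proof -
  have "a \<up> n * b \<in> B" if "b \<in> B" for n b
  proof (induction n rule: int_induct[where k = 0])
    case base
    show ?case using that by simp
  next
    case (step1 i)
    have "a \<up> (1 + i) * b = a * (a \<up> i * b)" by (simp add: gpow_add mult.assoc)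
    then show ?case using assms(1) step1 by (auto simp: elt_set_times_def add.commute)
  next
    case (step2 i)
    have "a \<up> (- 1 + i) * b = ginv a * (a \<up> i * b)" unfolding gpow_add by (simp add: mult.assoc)
    then show ?case using assms(2) step2 by (auto simp: elt_set_times_def)
  qed
  then show ?thesis by (auto simp: cyc_def set_times_def)
qed

lemma cyc_right_closed:
  assumes "\<And>b. b \<in> B \<Longrightarrow> b * a \<in> B" "\<And>b. b \<in> B \<Longrightarrow> b * ginv a \<in> B"
  shows "B * cyc a \<subseteq> B"
proof -
  have "b * a \<up> n \<in> B" if "b \<in> B" for n b
  proof (induction n rule: int_induct[where k = 0])
    case base
    show ?case using that by simp
  next
    case (step1 i)
    then show ?case using assms(1)[of "b * a \<up> i"] by (simp add: gpow_add mult.assoc)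
  next
    case (step2 i)
    then show ?case using assms(2)[of "b * a \<up> i"] by (simp add: gpow_diff mult.assoc)
  qed
  then show ?thesis by (auto simp: cyc_def set_times_def)
qed

text \<open>Reversing the order of the faces replaces \<open>\<rho>\<^sub>i\<close> by
  \<open>\<rho>\<^sub>4\<^sub>-\<^sub>i\<close>, which reverses the sequence of rotations and
  inverts each of them.\<close>

lemma rot_pair_dual_inverse:
  assumes "rot_pair y z"
  shows "rot_pair (ginv z) (ginv y)"
proof -
  interpret rot_pair y z by (rule assms)
  show ?thesis
  proof
    have "ginv (y * z * y * z) = 1" unfolding inv_yz by simp
    then show "ginv z * ginv y * ginv z * ginv y = 1" by (simp add: mult.assoc)
    fix i j :: int
    obtain k l where "y \<up> (- i) * z \<up> (- j) = z \<up> k * y \<up> l" using closed' by blast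
    then have "ginv y \<up> i * ginv z \<up> j = ginv z \<up> (- k) * ginv y \<up> (- l)"
      by (simp add: gpow_ginv gpow_minus)
    then show "\<exists>k l. ginv y \<up> i * ginv z \<up> j = ginv z \<up> k * ginv y \<up> l" by blast
    assume "ginv z \<up> i = ginv y \<up> j"
    then have "y \<up> j = z \<up> i" by (simp add: gpow_ginv)
    then show "ginv z \<up> i = 1" using triv[of j i] by (simp add: gpow_ginv)
  qed
qed

text \<open>In the situation of interest \<open>x,y,z,w\<close> are the rotations \<open>\<rho>\<^sub>i\<^sub>-\<^sub>1\<rho>\<^sub>i\<close>, so that
  conjugation by \<open>\<rho>\<^sub>2\<close>, if it existed, would send \<open>x,y,z,w\<close> to
  \<open>xy\<^sup>2, y\<^sup>-\<^sup>1, z\<^sup>-\<^sup>1, z\<^sup>2w\<close>.\<close>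

locale rot_quad =
  fixes x y z w r r' :: "'a::mult_group"
  assumes xy: "rot_pair x y" and yz: "rot_pair y z" and zw: "rot_pair z w"
    and inv_xyz: "x * y * z * x * y * z = 1" and inv_yzw: "y * z * w * y * z * w = 1"
    and cj_t: "cj (z * w) x = x * y * y" "cj (z * w) y = ginv y"
    and cj_s: "cj (x * y) w = z * z * w" "cj (x * y) z = ginv z"
    and comm_xw: "x * w = w * x"
    and comm_xw': "(x * y * y) * (z * z * w) = (z * z * w) * (x * y * y)"
    and r: "cj r x = ginv x" "cj r y = ginv y" and r': "cj r' z = ginv z" "cj r' w = ginv w"
    and triv4: "x \<up> i * y \<up> j * z \<up> k * w \<up> l = 1 \<Longrightarrow> x \<up> i = 1 \<and> y \<up> j = 1 \<and> z \<up> k = 1 \<and> w \<up> l = 1"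
    and finite_y: "\<exists>n::nat. 0 < n \<and> y ^ n = 1" and finite_z: "\<exists>n::nat. 0 < n \<and> z ^ n = 1"
begin

sublocale xy: rot_pair x y by (rule xy)
sublocale yz: rot_pair y z by (rule yz)
sublocale zw: rot_pair z w by (rule zw)

sublocale yzw: rot_triple y z w
proof (rule rot_triple.intro)
  show "y \<up> i = 1 \<and> z \<up> j = 1 \<and> w \<up> k = 1" if "y \<up> i * z \<up> j * w \<up> k = 1" for i j k
    using triv4[of 0 i j k] that by simp
qed (fact yz zw inv_yzw finite_z)+

lemma dual_triple: "rot_triple (ginv z) (ginv y) (ginv x)"
proof (rule rot_triple.intro)
  show "rot_pair (ginv z) (ginv y)" "rot_pair (ginv y) (ginv x)"
    by (rule rot_pair_dual_inverse[OF yz] rot_pair_dual_inverse[OF xy])+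
  have "ginv (x * y * z * x * y * z) = 1" unfolding inv_xyz by simp
  then show "ginv z * ginv y * ginv x * ginv z * ginv y * ginv x = 1" by (simp add: mult.assoc)
  obtain n :: nat where "0 < n" "y ^ n = 1" using finite_y by blast
  moreover have "ginv y ^ n = ginv (y ^ n)" by (simp add: gpow_ginv flip: gpow_of_nat)
  ultimately show "\<exists>n::nat. 0 < n \<and> ginv y ^ n = 1" by auto
  show "ginv z \<up> i = 1 \<and> ginv y \<up> j = 1 \<and> ginv x \<up> k = 1"
    if "ginv z \<up> i * ginv y \<up> j * ginv x \<up> k = 1" for i j k
  proof -
    have "ginv (ginv z \<up> i * ginv y \<up> j * ginv x \<up> k) = 1" using that by simp
    then have "x \<up> k * y \<up> j * z \<up> i * w \<up> 0 = 1" by (simp add: gpow_ginv mult.assoc)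
    from triv4[OF this] show ?thesis by (simp add: gpow_ginv)
  qed
qed

text \<open>\<open>yzw\<close> puts a commutator of the squares into \<open><y>\<close>, the dual
  triple puts one into \<open><z>\<close>. These powers commute with \<open>a\<close> and
  \<open>b\<close> respectively, so substituting one relation into the other leaves
  \<open>y \<up> k * z \<up> (- l) = 1\<close>.\<close>

lemma squares_commute_yz: "z * z * (y * y) = y * y * (z * z)"
proof -
  define a b where "a = y * y" and "b = z * z"
  obtain k where k: "commut b a = y \<up> k"
    using yzw.commut_squares_in_y[OF r'] unfolding a_def b_def by blast
  obtain l where "commut (ginv y * ginv y) (ginv z * ginv z) = ginv z \<up> l"
    using rot_triple.commut_squares_in_y[OF dual_triple, of r] r by auto
  then have l: "ginv a * ginv b * a * b = z \<up> (- l)"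
    by (simp add: commut_def a_def b_def gpow_ginv gpow_minus mult.assoc)
  have ba: "b * a = y \<up> k * a * b" unfolding k[symmetric] by (simp add: commut_def mult.assoc)
  have ab: "a * b = b * a * z \<up> (- l)" unfolding l[symmetric] by (simp add: mult.assoc)
  have ya: "y \<up> k * a = a * y \<up> k" and zb: "b * z \<up> (- l) = z \<up> (- l) * b"
    using cj_fix_gpow[of y a k] cj_fix_gpow[of z b "- l"]
    unfolding a_def b_def cj_fix_iff by (simp_all add: mult.assoc)
  have "a * b = y \<up> k * a * b * z \<up> (- l)" using ab unfolding ba .
  also have "\<dots> = a * (y \<up> k * (b * z \<up> (- l)))" by (simp only: ya mult.assoc)
  also have "\<dots> = a * (y \<up> k * z \<up> (- l) * b)" by (simp only: zb mult.assoc)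
  finally have "y \<up> k * z \<up> (- l) * b = 1 * b" by (simp only: group_cancel_left mult_1_left)
  then have "y \<up> k * z \<up> (- l) = 1" by (simp only: group_cancel_right)
  then have "y \<up> k = 1" by (rule yz.normal_form_one)
  then show ?thesis using ba by (simp add: a_def b_def mult.assoc)
qed

text \<open>Each pair holds a rotation and what conjugation by \<open>\<rho>\<^sub>2\<close> would
  make of it; \<open>S\<close> and \<open>T\<close> are diagonal because
  \<open>\<rho>\<^sub>0\<rho>\<^sub>2\<close> and \<open>\<rho>\<^sub>2\<rho>\<^sub>4\<close>
  commute with \<open>\<rho>\<^sub>2\<close>.\<close>

abbreviation "X \<equiv> (x, x * y * y)"
abbreviation "Y \<equiv> (y, ginv y)"
abbreviation "Z \<equiv> (z, ginv z)"
abbreviation "W \<equiv> (w, z * z * w)"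
abbreviation "S \<equiv> (x * y, x * y)"
abbreviation "T \<equiv> (z * w, z * w)"

lemma XY_eq: "X * Y = S" and ZW_eq: "Z * W = T"
  by (simp_all add: mult.assoc)

text \<open>On \<open>x\<close> and \<open>y\<close> the conjugation is performed by the actual
  element \<open>z * w\<close>, since \<open>\<rho>\<^sub>4\<close> commutes with
  \<open>\<rho>\<^sub>0\<close>, \<open>\<rho>\<^sub>1\<close> and \<open>\<rho>\<^sub>2\<close>;
  relations thus transfer to the second coordinate. For \<open>z\<close> and \<open>w\<close> the
  element \<open>x * y\<close> does the same.\<close>

lemma perm_YX: "cyc Y * cyc X \<subseteq> cyc X * cyc Y"
  unfolding cyc_perm_iff
proof (intro allI)
  fix i j
  obtain k l where 1: "y \<up> i * x \<up> j = x \<up> k * y \<up> l" using xy.closed by blast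
  then have "cj (z * w) (y \<up> i * x \<up> j) = cj (z * w) (x \<up> k * y \<up> l)" by simp
  then have "ginv y \<up> i * (x * y * y) \<up> j = (x * y * y) \<up> k * ginv y \<up> l"
    by (simp only: cj_mult[of _ "_ \<up> _"] cj_gpow cj_t)
  then show "\<exists>k l. Y \<up> i * X \<up> j = X \<up> k * Y \<up> l" using 1 unfolding Pair_gpow by auto
qed

lemma perm_WZ: "cyc W * cyc Z \<subseteq> cyc Z * cyc W"
  unfolding cyc_perm_iff
proof (intro allI)
  fix i j
  obtain k l where 1: "w \<up> i * z \<up> j = z \<up> k * w \<up> l" using zw.closed by blast
  then have "cj (x * y) (w \<up> i * z \<up> j) = cj (x * y) (z \<up> k * w \<up> l)" by simp
  then have "(z * z * w) \<up> i * ginv z \<up> j = ginv z \<up> k * (z * z * w) \<up> l"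
    by (simp only: cj_mult[of _ "_ \<up> _"] cj_gpow cj_s)
  then show "\<exists>k l. W \<up> i * Z \<up> j = Z \<up> k * W \<up> l" using 1 unfolding Pair_gpow by auto
qed

text \<open>No group element is known to invert both \<open>y\<close> and \<open>z\<close>. The
  opposite exponents obtained from the commuting squares take its place: this is where regularity of
  the medial section enters.\<close>

lemma perm_ZY: "cyc Z * cyc Y \<subseteq> cyc Y * cyc Z"
proof -
  have Z_step: "\<exists>k l. Z * Y \<up> j = Y \<up> k * Z \<up> l" "\<exists>k l. ginv Z * Y \<up> j = Y \<up> k * Z \<up> l" for j
  proof -
    obtain k l where "z * y \<up> j = y \<up> k * z \<up> l" "ginv z * y \<up> (- j) = y \<up> (- k) * z \<up> (- l)"
      using yz.squares_commute_regular[OF squares_commute_yz] by blast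
    then show "\<exists>k l. Z * Y \<up> j = Y \<up> k * Z \<up> l"
      by (intro exI[of _ k] exI[of _ l]) (simp add: Pair_gpow gpow_ginv gpow_minus)
    obtain k l where "z * y \<up> (- j) = y \<up> k * z \<up> l" "ginv z * y \<up> (- (- j)) = y \<up> (- k) * z \<up> (- l)"
      using yz.squares_commute_regular[OF squares_commute_yz] by blast
    then show "\<exists>k l. ginv Z * Y \<up> j = Y \<up> k * Z \<up> l"
      by (intro exI[of _ "- k"] exI[of _ "- l"]) (simp add: Pair_gpow gpow_ginv gpow_minus)
  qed
  have "a *o (cyc Y * cyc Z) \<subseteq> cyc Y * cyc Z" if aZ: "a = Z \<or> a = ginv Z" for a
  proof
    fix b assume "b \<in> a *o (cyc Y * cyc Z)"
    then obtain j m where b: "b = a * (Y \<up> j * Z \<up> m)" by (auto simp: elt_set_times_def set_times_def cyc_def)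
    obtain k l where "a * Y \<up> j = Y \<up> k * Z \<up> l" using aZ Z_step by blast
    then have "b = Y \<up> k * Z \<up> (l + m)" unfolding b gpow_add by (simp only: flip: mult.assoc)
    then show "b \<in> cyc Y * cyc Z" using cyc_gpow set_times_intro by metis
  qed
  then have "cyc Z * (cyc Y * cyc Z) \<subseteq> cyc Y * cyc Z" by (intro cyc_left_closed) auto
  moreover have "cyc Z * cyc Y \<subseteq> cyc Z * (cyc Y * cyc Z)"
    unfolding mult.assoc[symmetric] by (rule subset_times_one[OF cyc_one])
  ultimately show ?thesis by blast
qed

lemma perm_WX: "cyc W * cyc X \<subseteq> cyc X * cyc W"
proof -
  have "cj W X = X" unfolding cj_fix_iff using comm_xw comm_xw' by simp
  then have "W \<up> i * X \<up> j = X \<up> j * W \<up> i" for i j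
    using cj_fix_gpow2 unfolding cj_fix_iff by blast
  then show ?thesis unfolding cyc_perm_iff by blast
qed

lemma cyc_cyc_assoc: "cyc a * (cyc a * B) = cyc a * B"
  by (simp add: cyc_cyc flip: mult.assoc)

lemma T_Y: "T * Y \<up> j = Y \<up> (- j) * T" and T_T: "T * T = 1"
  and Z_S: "Z \<up> j * S = S * Z \<up> (- j)" and S_S: "S * S = 1"
proof -
  have "cj T Y = ginv Y" by (simp only: Pair_cj cj_t cj_ginv ginv_ginv Pair_ginv)
  then have "cj T (Y \<up> j) = Y \<up> (- j)" by (simp only: cj_gpow gpow_ginv gpow_minus)
  then show "T * Y \<up> j = Y \<up> (- j) * T" by (metis cj_mult_left)
  show "T * T = 1" using zw.inv_yz by (simp add: one_prod_def mult.assoc)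
  have "cj S Z = ginv Z" by (simp only: Pair_cj cj_s cj_ginv ginv_ginv Pair_ginv)
  then have "cj S (Z \<up> (- j)) = Z \<up> j" by (simp only: cj_gpow cj_ginv gpow_ginv gpow_minus ginv_ginv)
  then show "Z \<up> j * S = S * Z \<up> (- j)" by (metis cj_mult_left)
  show "S * S = 1" using xy.inv_yz by (simp add: one_prod_def mult.assoc)
qed

text \<open>\<open>T = Z * W\<close> inverts \<open>Y\<close>, so a power of \<open>Y\<close> passes
  \<open>W\<close> at the cost of factors from \<open>cyc Z\<close>, which the exchange laws of
  neighbours put back in order.\<close>

lemma perm_WY: "cyc W * (cyc Y * cyc Z * cyc W) \<subseteq> cyc Y * cyc Z * cyc W"
proof (rule cyc_left_closed)
  have sub: "cyc Z * cyc Y * cyc Z * (cyc W * cyc Z) * cyc W \<subseteq> cyc Y * cyc Z * cyc W"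
  proof -
    have "cyc Z * cyc Y * cyc Z * (cyc W * cyc Z) * cyc W
      \<subseteq> cyc Y * cyc Z * cyc Z * (cyc Z * cyc W) * cyc W"
      by (intro set_times_mono2 perm_ZY perm_WZ subset_refl)
    then show ?thesis by (simp add: cyc_cyc cyc_cyc_assoc mult.assoc)
  qed
  show "W *o (cyc Y * cyc Z * cyc W) \<subseteq> cyc Y * cyc Z * cyc W"
  proof
    fix b assume "b \<in> W *o (cyc Y * cyc Z * cyc W)"
    then obtain b' where b': "b' \<in> cyc Y * cyc Z * cyc W" "b = W * b'"
      unfolding elt_set_times_def by blast
    from b'(1) obtain j m n where "b' = Y \<up> j * Z \<up> m * W \<up> n" by (rule cyc_times3E)
    with b'(2) have b: "b = W * (Y \<up> j * Z \<up> m * W \<up> n)" by (simp only:)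
    have W: "W = ginv Z * T" unfolding ZW_eq[symmetric] by (simp only: ginv_left_assoc)
    have "W * Y \<up> j = ginv Z * (T * Y \<up> j)" unfolding W by (simp only: mult.assoc)
    also have "\<dots> = ginv Z * (Y \<up> (- j) * T)" by (simp only: T_Y)
    also have "\<dots> = ginv Z * Y \<up> (- j) * Z * W" unfolding ZW_eq[symmetric] by (simp only: mult.assoc)
    finally have WY: "W * Y \<up> j = ginv Z * Y \<up> (- j) * Z * W" .
    have "b = (W * Y \<up> j) * (Z \<up> m * W \<up> n)" unfolding b by (simp only: mult.assoc)
    also have "\<dots> = ginv Z * Y \<up> (- j) * Z * (W * Z \<up> m) * W \<up> n" unfolding WY by (simp only: mult.assoc)
    also have "\<dots> \<in> cyc Z * cyc Y * cyc Z * (cyc W * cyc Z) * cyc W"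
      by (intro set_times_intro cyc_ginv cyc_gpow cyc_self)
    finally show "b \<in> cyc Y * cyc Z * cyc W" using sub by blast
  qed
  show "ginv W *o (cyc Y * cyc Z * cyc W) \<subseteq> cyc Y * cyc Z * cyc W"
  proof
    fix b assume "b \<in> ginv W *o (cyc Y * cyc Z * cyc W)"
    then obtain b' where b': "b' \<in> cyc Y * cyc Z * cyc W" "b = ginv W * b'"
      unfolding elt_set_times_def by blast
    from b'(1) obtain j m n where "b' = Y \<up> j * Z \<up> m * W \<up> n" by (rule cyc_times3E)
    with b'(2) have b: "b = ginv W * (Y \<up> j * Z \<up> m * W \<up> n)" by (simp only:)
    have "ginv T = T" using T_T by (rule ginv_unique)
    moreover have "ginv T * Z = ginv W" unfolding ZW_eq[symmetric] by (simp only: ginv_mult mult.assoc ginv_left mult_1_right)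
    ultimately have W: "ginv W = T * Z" by metis
    obtain k l where kl: "Z \<up> 1 * Y \<up> j = Y \<up> k * Z \<up> l" using perm_ZY unfolding cyc_perm_iff by blast
    have "ginv W * Y \<up> j = T * (Z \<up> 1 * Y \<up> j)" unfolding W by (simp only: mult.assoc gpow_1)
    also have "\<dots> = (T * Y \<up> k) * Z \<up> l" unfolding kl by (simp only: mult.assoc)
    also have "\<dots> = (Y \<up> (- k) * T) * Z \<up> l" by (simp only: T_Y)
    also have "\<dots> = Y \<up> (- k) * Z * W * Z \<up> l" unfolding ZW_eq[symmetric] by (simp only: mult.assoc)
    finally have WY: "ginv W * Y \<up> j = Y \<up> (- k) * Z * W * Z \<up> l" .
    have "b = (ginv W * Y \<up> j) * (Z \<up> m * W \<up> n)" unfolding b by (simp only: mult.assoc)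
    also have "\<dots> = 1 * Y \<up> (- k) * Z * (W * Z \<up> (l + m)) * W \<up> n"
      unfolding WY gpow_add by (simp only: mult.assoc mult_1_left)
    also have "\<dots> \<in> cyc Z * cyc Y * cyc Z * (cyc W * cyc Z) * cyc W"
      by (intro set_times_intro cyc_ginv cyc_gpow cyc_self cyc_one)
    finally show "b \<in> cyc Y * cyc Z * cyc W" using sub by blast
  qed
qed

text \<open>The mirror image of \<open>perm_WY\<close>: \<open>S = X * Y\<close> inverts
  \<open>Z\<close>, and the product is closed up from the right.\<close>

lemma perm_ZX: "cyc Z * cyc X \<subseteq> cyc X * cyc Y * cyc Z"
proof -
  have sub: "cyc X * (cyc Y * cyc X) * cyc Y * (cyc Z * cyc Y) \<subseteq> cyc X * cyc Y * cyc Z"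
  proof -
    have "cyc X * (cyc Y * cyc X) * cyc Y * (cyc Z * cyc Y) \<subseteq> cyc X * (cyc X * cyc Y) * cyc Y * (cyc Y * cyc Z)"
      by (intro set_times_mono2 perm_ZY perm_YX subset_refl)
    then show ?thesis by (simp add: cyc_cyc cyc_cyc_assoc mult.assoc)
  qed
  have XS: "X = S * ginv Y" unfolding XY_eq[symmetric] by (simp only: mult.assoc ginv_right mult_1_right)
  have "cyc X * cyc Y * cyc Z * cyc X \<subseteq> cyc X * cyc Y * cyc Z"
  proof (rule cyc_right_closed)
    fix b assume "b \<in> cyc X * cyc Y * cyc Z"
    then obtain i m c where b: "b = X \<up> i * Y \<up> m * Z \<up> c"
      by (rule cyc_times3E)
    have "Z \<up> c * X = (Z \<up> c * S) * ginv Y" unfolding XS by (simp only: mult.assoc)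
    also have "\<dots> = (S * Z \<up> (- c)) * ginv Y" by (simp only: Z_S)
    also have "\<dots> = X * Y * Z \<up> (- c) * ginv Y" unfolding XY_eq[symmetric] by (simp only: mult.assoc)
    finally have ZX: "Z \<up> c * X = X * Y * Z \<up> (- c) * ginv Y" .
    have "b * X = X \<up> i * Y \<up> m * (Z \<up> c * X)" unfolding b by (simp only: mult.assoc)
    also have "\<dots> = X \<up> i * (Y \<up> m * X) * Y * (Z \<up> (- c) * ginv Y)" unfolding ZX by (simp only: mult.assoc)
    also have "\<dots> \<in> cyc X * (cyc Y * cyc X) * cyc Y * (cyc Z * cyc Y)"
      by (intro set_times_intro cyc_ginv cyc_gpow cyc_self)
    finally show "b * X \<in> cyc X * cyc Y * cyc Z" using sub by blast
    have "ginv S = S" using S_S by (rule ginv_unique)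
    moreover have "ginv X = Y * ginv S" unfolding XY_eq[symmetric] by (simp only: ginv_mult ginv_right_assoc)
    ultimately have XS': "ginv X = Y * S" by metis
    obtain k l where kl: "Z \<up> c * Y \<up> 1 = Y \<up> k * Z \<up> l" using perm_ZY unfolding cyc_perm_iff by blast
    have "Z \<up> c * ginv X = (Z \<up> c * Y \<up> 1) * S" unfolding XS' by (simp only: mult.assoc gpow_1)
    also have "\<dots> = Y \<up> k * (Z \<up> l * S)" unfolding kl by (simp only: mult.assoc)
    also have "\<dots> = Y \<up> k * (S * Z \<up> (- l))" by (simp only: Z_S)
    also have "\<dots> = Y \<up> k * X * Y * Z \<up> (- l)" unfolding XY_eq[symmetric] by (simp only: mult.assoc)
    finally have ZX': "Z \<up> c * ginv X = Y \<up> k * X * Y * Z \<up> (- l)" .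
    have "b * ginv X = X \<up> i * Y \<up> m * (Z \<up> c * ginv X)" unfolding b by (simp only: mult.assoc)
    also have "\<dots> = X \<up> i * (Y \<up> (m + k) * X) * Y * (Z \<up> (- l) * 1)"
      unfolding ZX' gpow_add by (simp only: mult.assoc mult_1_right)
    also have "\<dots> \<in> cyc X * (cyc Y * cyc X) * cyc Y * (cyc Z * cyc Y)"
      by (intro set_times_intro cyc_gpow cyc_self cyc_one)
    finally show "b * ginv X \<in> cyc X * cyc Y * cyc Z" using sub by blast
  qed
  moreover have "cyc Z \<subseteq> cyc X * cyc Y * cyc Z"
  proof
    fix b assume "b \<in> cyc Z"
    then have "1 * 1 * b \<in> cyc X * cyc Y * cyc Z" by (intro set_times_intro cyc_one)
    then show "b \<in> cyc X * cyc Y * cyc Z" by simp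
  qed
  ultimately show ?thesis using set_times_mono2 subset_refl by blast
qed

definition P where "P = cyc X * cyc Y * cyc Z * cyc W"

lemma P_closed: "cyc X * P \<subseteq> P" "cyc Y * P \<subseteq> P" "cyc Z * P \<subseteq> P" "cyc W * P \<subseteq> P"
proof -
  show "cyc X * P \<subseteq> P" by (simp add: P_def cyc_cyc_assoc mult.assoc)
  have "cyc Y * P = cyc Y * cyc X * (cyc Y * cyc Z * cyc W)" by (simp add: P_def mult.assoc)
  also have "\<dots> \<subseteq> cyc X * cyc Y * (cyc Y * cyc Z * cyc W)"
    by (intro set_times_mono2 perm_YX subset_refl)
  finally show "cyc Y * P \<subseteq> P" by (simp add: P_def cyc_cyc_assoc mult.assoc)
  have "cyc Z * P = cyc Z * cyc X * (cyc Y * cyc Z * cyc W)" by (simp add: P_def mult.assoc)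
  also have "\<dots> \<subseteq> cyc X * cyc Y * cyc Z * (cyc Y * cyc Z * cyc W)"
    by (intro set_times_mono2 perm_ZX subset_refl)
  also have "\<dots> = cyc X * cyc Y * (cyc Z * cyc Y) * (cyc Z * cyc W)" by (simp add: mult.assoc)
  also have "\<dots> \<subseteq> cyc X * cyc Y * (cyc Y * cyc Z) * (cyc Z * cyc W)"
    by (intro set_times_mono2 perm_ZY subset_refl)
  finally show "cyc Z * P \<subseteq> P" by (simp add: P_def cyc_cyc_assoc mult.assoc)
  have "cyc W * P = cyc W * cyc X * (cyc Y * cyc Z * cyc W)" by (simp add: P_def mult.assoc)
  also have "\<dots> \<subseteq> cyc X * cyc W * (cyc Y * cyc Z * cyc W)"
    by (intro set_times_mono2 perm_WX subset_refl)
  also have "\<dots> = cyc X * (cyc W * (cyc Y * cyc Z * cyc W))" by (simp add: mult.assoc)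
  also have "\<dots> \<subseteq> cyc X * (cyc Y * cyc Z * cyc W)"
    by (intro set_times_mono2 perm_WY subset_refl)
  finally show "cyc W * P \<subseteq> P" by (simp add: P_def mult.assoc)
qed

lemma gen_in_P: "a \<in> gen {Y, Z, S, T} \<Longrightarrow> a \<in> P"
proof -
  note cX = subsetD[OF P_closed(1) set_times_intro] and cY = subsetD[OF P_closed(2) set_times_intro]
    and cZ = subsetD[OF P_closed(3) set_times_intro] and cW = subsetD[OF P_closed(4) set_times_intro]
  show "a \<in> gen {Y, Z, S, T} \<Longrightarrow> a \<in> P"
  proof (induction rule: gen.induct)
    case gen_one
    have "1 * 1 * 1 * 1 \<in> P" unfolding P_def by (intro set_times_intro cyc_one)
    then show ?case by simp
  next
    case (gen_mult s a)
    then consider "s = Y" | "s = Z" | "s = X * Y" | "s = Z * W" unfolding XY_eq ZW_eq by blast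
    then show ?case
    proof cases
      case 1
      then show ?thesis using cY[OF cyc_self gen_mult(3)] by (simp only:)
    next
      case 2
      then show ?thesis using cZ[OF cyc_self gen_mult(3)] by (simp only:)
    next
      case 3
      then show ?thesis using cX[OF cyc_self cY[OF cyc_self gen_mult(3)]] by (simp only: mult.assoc)
    next
      case 4
      then show ?thesis using cZ[OF cyc_self cW[OF cyc_self gen_mult(3)]] by (simp only: mult.assoc)
    qed
  next
    case (gen_inv s a)
    then consider "s = Y" | "s = Z" | "s = X * Y" | "s = Z * W" unfolding XY_eq ZW_eq by blast
    then show ?case
    proof cases
      case 1
      then show ?thesis using cY[OF cyc_ginv gen_inv(3)] by (simp only:)
    next
      case 2
      then show ?thesis using cZ[OF cyc_ginv gen_inv(3)] by (simp only:)
    next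
      case 3
      then show ?thesis using cY[OF cyc_ginv cX[OF cyc_ginv gen_inv(3)]]
        by (simp only: mult.assoc ginv_mult)
    next
      case 4
      then show ?thesis using cW[OF cyc_ginv cZ[OF cyc_ginv gen_inv(3)]]
        by (simp only: mult.assoc ginv_mult)
    qed
  qed
qed

text \<open>By \<open>triv4\<close>, first coordinate 1 forces all four powers in the normal form to
  be trivial; the second coordinate is built from conjugates and inverses of these powers.\<close>

lemma reflection_well_defined:
  assumes "(1, d) \<in> gen {Y, Z, S, T}"
  shows "d = 1"
proof -
  obtain i j k l where "(1, d) = X \<up> i * Y \<up> j * Z \<up> k * W \<up> l"
    using gen_in_P[OF assms] unfolding P_def by (rule cyc_times4E)
  then have 1: "x \<up> i * y \<up> j * z \<up> k * w \<up> l = 1"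
    and d: "d = (x * y * y) \<up> i * ginv y \<up> j * ginv z \<up> k * (z * z * w) \<up> l"
    by (simp_all add: Pair_gpow)
  have "x \<up> i = 1 \<and> y \<up> j = 1 \<and> z \<up> k = 1 \<and> w \<up> l = 1" using triv4[OF 1] .
  moreover have "(x * y * y) \<up> i = cj (z * w) (x \<up> i)" "(z * z * w) \<up> l = cj (x * y) (w \<up> l)"
    by (simp_all only: cj_gpow cj_t cj_s)
  ultimately show ?thesis using d by (simp add: gpow_ginv)
qed

end

section \<open>Ranks and flags\<close>

lemma chain_extends_to_flag:
  assumes "is_chain A le C"
  shows "\<exists>D. is_flag A le D \<and> C \<subseteq> D"
proof -
  define S where "S = {D. is_chain A le D \<and> C \<subseteq> D}"
  have "\<exists>M\<in>S. \<forall>X\<in>S. M \<subseteq> X \<longrightarrow> X = M"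
  proof (rule subset_Zorn_nonempty)
    show "S \<noteq> {}" using assms unfolding S_def by blast
    fix K assume K: "K \<noteq> {}" "subset.chain S K"
    have KS: "D \<in> S" if "D \<in> K" for D
      using K(2) that unfolding subset_chain_def by blast
    have tot: "D \<subseteq> E \<or> E \<subseteq> D" if "D \<in> K" "E \<in> K" for D E
      using K(2) that unfolding subset_chain_def by blast
    have "le a b \<or> le b a" if ab: "a \<in> \<Union>K" "b \<in> \<Union>K" for a b
    proof -
      obtain D E where "D \<in> K" "a \<in> D" "E \<in> K" "b \<in> E" using ab by blast
      then show ?thesis using tot[of D E] KS[of D] KS[of E] unfolding S_def is_chain_def by blast
    qed
    moreover have "\<Union>K \<subseteq> A" using KS unfolding S_def is_chain_def by blast
    moreover have "C \<subseteq> \<Union>K" using K(1) KS unfolding S_def by blast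
    ultimately show "\<Union>K \<in> S" unfolding S_def is_chain_def by blast
  qed
  then obtain M where M: "M \<in> S" "\<And>X. X \<in> S \<Longrightarrow> M \<subseteq> X \<Longrightarrow> X = M" by blast
  have "is_flag A le M" unfolding is_flag_def
  proof (intro conjI allI impI)
    show "is_chain A le M" using M(1) unfolding S_def by blast
    show "D = M" if "is_chain A le D \<and> M \<subseteq> D" for D
      using M that unfolding S_def by blast
  qed
  moreover have "C \<subseteq> M" using M(1) unfolding S_def by blast
  ultimately show ?thesis by blast
qed

locale polytope =
  fixes F :: "'a set" and le :: "'a \<Rightarrow> 'a \<Rightarrow> bool" and n :: nat
  assumes poly: "abstract_polytope F le n"
begin

abbreviation "rk \<equiv> face_rank F le"
abbreviation "ranks \<equiv> {-1..int n}"

lemma le_refl: "x \<in> F \<Longrightarrow> le x x"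
  and le_antisym: "x \<in> F \<Longrightarrow> y \<in> F \<Longrightarrow> le x y \<Longrightarrow> le y x \<Longrightarrow> x = y"
  and le_trans: "x \<in> F \<Longrightarrow> y \<in> F \<Longrightarrow> z \<in> F \<Longrightarrow> le x y \<Longrightarrow> le y z \<Longrightarrow> le x z"
  using poly unfolding abstract_polytope_def partial_order_on_set_def by blast+

lemma flag_card: "C \<in> flags F le \<Longrightarrow> finite C" "C \<in> flags F le \<Longrightarrow> card C = n + 2"
  using poly unfolding abstract_polytope_def by blast+

lemma flag_sub: "C \<in> flags F le \<Longrightarrow> C \<subseteq> F"
  unfolding flags_def is_flag_def is_chain_def by blast

lemma flag_total: "C \<in> flags F le \<Longrightarrow> x \<in> C \<Longrightarrow> y \<in> C \<Longrightarrow> le x y \<or> le y x"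
  unfolding flags_def is_flag_def is_chain_def by blast

lemma extend_flag:
  assumes "C \<subseteq> F" "\<And>x y. x \<in> C \<Longrightarrow> y \<in> C \<Longrightarrow> le x y \<or> le y x"
  obtains D where "D \<in> flags F le" "C \<subseteq> D"
proof -
  have "is_chain F le C" using assms unfolding is_chain_def by simp
  then show ?thesis using chain_extends_to_flag[of F le C] that unfolding flags_def by auto
qed

lemma flag_maximal:
  assumes "C \<in> flags F le" "x \<in> F" "\<And>y. y \<in> C \<Longrightarrow> le x y \<or> le y x"
  shows "x \<in> C"
proof -
  have "is_chain F le (insert x C)"
    using assms le_refl flag_sub flag_total unfolding is_chain_def by blast
  then show ?thesis using assms(1) unfolding flags_def is_flag_def by blast
qed

lemma flag_halves:
  assumes C: "is_flag {y\<in>F. le y x} le C" and D: "is_flag {y\<in>F. le x y} le D" and x: "x \<in> F"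
  shows "C \<union> D \<in> flags F le" "C \<inter> D = {x}"
proof -
  have CF: "C \<subseteq> F" "\<And>y. y \<in> C \<Longrightarrow> le y x" "\<And>y z. y \<in> C \<Longrightarrow> z \<in> C \<Longrightarrow> le y z \<or> le z y"
    and DF: "D \<subseteq> F" "\<And>y. y \<in> D \<Longrightarrow> le x y" "\<And>y z. y \<in> D \<Longrightarrow> z \<in> D \<Longrightarrow> le y z \<or> le z y"
    using C D unfolding is_flag_def is_chain_def by blast+
  have addC: "z \<in> C" if "z \<in> F" "le z x" "\<And>y. y \<in> C \<Longrightarrow> le y z \<or> le z y" for z
  proof -
    have "is_chain {y\<in>F. le y x} le (insert z C)"
      using that CF le_refl unfolding is_chain_def by blast
    then show ?thesis using C unfolding is_flag_def by blast
  qed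
  have addD: "z \<in> D" if "z \<in> F" "le x z" "\<And>y. y \<in> D \<Longrightarrow> le y z \<or> le z y" for z
  proof -
    have "is_chain {y\<in>F. le x y} le (insert z D)"
      using that DF le_refl unfolding is_chain_def by blast
    then show ?thesis using D unfolding is_flag_def by blast
  qed
  have xC: "x \<in> C" using addC[OF x] le_refl[OF x] CF by blast
  have xD: "x \<in> D" using addD[OF x] le_refl[OF x] DF by blast
  show "C \<inter> D = {x}" using xC xD CF DF le_antisym x by blast
  have tot: "le y z \<or> le z y" if "y \<in> C \<union> D" "z \<in> C \<union> D" for y z
    using that CF DF le_trans[OF _ x] by blast
  show "C \<union> D \<in> flags F le"
    unfolding flags_def is_flag_def mem_Collect_eq
  proof (intro conjI allI impI)
    show "is_chain F le (C \<union> D)" unfolding is_chain_def using tot CF DF by blast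
    fix E assume E: "is_chain F le E \<and> C \<union> D \<subseteq> E"
    have "z \<in> C \<union> D" if "z \<in> E" for z
    proof -
      have z: "z \<in> F" "\<And>y. y \<in> E \<Longrightarrow> le y z \<or> le z y" using E that unfolding is_chain_def by blast+
      then consider "le z x" | "le x z" using E xC by blast
      then show ?thesis using addC addD z E by cases blast+
    qed
    then show "E = C \<union> D" using E by blast
  qed
qed

lemma lower_half_flag:
  assumes "C \<in> flags F le" "x \<in> C"
  shows "is_flag {y\<in>F. le y x} le {y\<in>C. le y x}"
  unfolding is_flag_def
proof (intro conjI allI impI)
  show "is_chain {y\<in>F. le y x} le {y\<in>C. le y x}"
    using assms flag_sub flag_total unfolding is_chain_def by blast
  fix D assume D: "is_chain {y\<in>F. le y x} le D \<and> {y\<in>C. le y x} \<subseteq> D"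
  have "z \<in> C" if z: "z \<in> D" for z
  proof (rule flag_maximal[OF assms(1)])
    show zF: "z \<in> F" using D z unfolding is_chain_def by blast
    fix y assume y: "y \<in> C"
    show "le z y \<or> le y z"
    proof (cases "le y x")
      case True
      then show ?thesis using D z y unfolding is_chain_def by blast
    next
      case False
      then have "le x y" using flag_total assms y by blast
      moreover have "le z x" using D z unfolding is_chain_def by blast
      ultimately show ?thesis using le_trans[OF zF _ _, of x y] assms y flag_sub by blast
    qed
  qed
  then show "D = {y\<in>C. le y x}" using D unfolding is_chain_def by blast
qed

text \<open>Any flag below \<open>x\<close>, glued to one fixed flag above \<open>x\<close>, is a
  flag of size \<open>n + 2\<close> in which \<open>x\<close> was counted twice. So all flags below
  \<open>x\<close> have the same size, and the choice made in \<open>face_rank\<close> is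
  immaterial.\<close>

lemma rk_flag:
  assumes C: "C \<in> flags F le" and x: "x \<in> C"
  shows "rk x = int (card {y\<in>C. le y x}) - 2"
proof -
  have xF: "x \<in> F" using flag_sub assms by blast
  obtain D where D: "is_flag {y\<in>F. le x y} le D"
    using chain_extends_to_flag[of "{y\<in>F. le x y}" le "{}"] by (auto simp: is_chain_def)
  have *: "card B + card D = n + 3" if B: "is_flag {y\<in>F. le y x} le B" for B
  proof -
    have fl: "B \<union> D \<in> flags F le" "B \<inter> D = {x}" using flag_halves[OF B D xF] by auto
    then have "finite B" "finite D" using flag_card(1)[OF fl(1)] by auto
    then show ?thesis using card_Un_Int[of B D] fl flag_card(2)[OF fl(1)] by simp
  qed
  have "is_flag {y\<in>F. le y x} le (SOME C. is_flag {y\<in>F. le y x} le C)"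
    using lower_half_flag[OF assms] by (rule someI)
  then show ?thesis using *[OF lower_half_flag[OF assms]] * unfolding face_rank_def by (metis add_right_cancel)
qed

lemma rk_less:
  assumes "x \<in> F" "y \<in> F" "le x y" "x \<noteq> y"
  shows "rk x < rk y"
proof -
  obtain C where C: "C \<in> flags F le" "{x, y} \<subseteq> C"
    using extend_flag[of "{x, y}"] assms le_refl by blast
  have "{z\<in>C. le z x} \<subset> {z\<in>C. le z y}"
    using C assms le_trans[of _ x y] le_antisym[of x y] flag_sub[OF C(1)] le_refl by blast
  then have "card {z\<in>C. le z x} < card {z\<in>C. le z y}"
    using flag_card(1)[OF C(1)] by (intro psubset_card_mono) auto
  then show ?thesis using rk_flag[OF C(1)] C(2) by simp
qed

lemma rk_le: "x \<in> F \<Longrightarrow> y \<in> F \<Longrightarrow> le x y \<Longrightarrow> rk x \<le> rk y"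
  using rk_less by fastforce

lemma rk_bij:
  assumes C: "C \<in> flags F le"
  shows "bij_betw rk C ranks"
proof -
  have inj: "inj_on rk C"
    by (rule inj_onI) (metis C flag_sub flag_total order_less_irrefl rk_less subsetD)
  have "rk ` C \<subseteq> ranks"
  proof
    fix r assume "r \<in> rk ` C"
    then obtain x where x: "x \<in> C" "r = rk x" by blast
    have "x \<in> {y\<in>C. le y x}" using x le_refl flag_sub[OF C] by blast
    then have "card {y\<in>C. le y x} > 0" using flag_card(1)[OF C] by (metis (no_types, lifting) card_gt_0_iff empty_iff finite_subset mem_Collect_eq subsetI)
    moreover have "card {y\<in>C. le y x} \<le> n + 2"
      using card_mono[OF flag_card(1)[OF C], of "{y\<in>C. le y x}"] flag_card(2)[OF C] by auto
    ultimately show "r \<in> ranks" using rk_flag[OF C x(1)] x(2) by simp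
  qed
  moreover have "card (rk ` C) = card ranks" using card_image[OF inj] flag_card(2)[OF C] by simp
  ultimately have "rk ` C = ranks" by (simp add: card_subset_eq)
  then show ?thesis using inj by (simp add: bij_betw_def)
qed

definition at :: "'a set \<Rightarrow> int \<Rightarrow> 'a" where "at C i = (THE x. x \<in> C \<and> rk x = i)"

lemma at_eq:
  assumes "C \<in> flags F le" "x \<in> C"
  shows "at C (rk x) = x"
  unfolding at_def using assms rk_bij[OF assms(1)] by (intro the_equality) (auto simp: bij_betw_def inj_on_def)

lemma at_props:
  assumes "C \<in> flags F le" "i \<in> ranks"
  shows "at C i \<in> C \<and> rk (at C i) = i"
proof -
  have "i \<in> rk ` C" using rk_bij[OF assms(1)] assms(2) by (simp add: bij_betw_def)
  then obtain x where "x \<in> C" "i = rk x" by blast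
  then show ?thesis using at_eq[OF assms(1)] by simp
qed

lemma at_in: "C \<in> flags F le \<Longrightarrow> i \<in> ranks \<Longrightarrow> at C i \<in> C"
  and rk_at: "C \<in> flags F le \<Longrightarrow> i \<in> ranks \<Longrightarrow> rk (at C i) = i"
  using at_props by simp_all

lemma at_F: "C \<in> flags F le \<Longrightarrow> i \<in> ranks \<Longrightarrow> at C i \<in> F"
  using at_in flag_sub by blast

lemma in_flag:
  assumes "x \<in> F"
  shows "\<exists>C\<in>flags F le. x \<in> C"
proof -
  obtain C where "C \<in> flags F le" "{x} \<subseteq> C"
    using extend_flag[of "{x}"] assms le_refl[OF assms] by auto
  then show ?thesis by blast
qed

lemma rk_in_ranks: "C \<in> flags F le \<Longrightarrow> x \<in> C \<Longrightarrow> rk x \<in> ranks"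
  using rk_bij[of C] unfolding bij_betw_def by blast

lemma rk_range: "x \<in> F \<Longrightarrow> rk x \<in> ranks"
  using in_flag rk_in_ranks by blast

lemma flag_image:
  assumes "C \<in> flags F le"
  shows "C = at C ` ranks"
proof
  show "C \<subseteq> at C ` ranks"
    using at_eq[OF assms] rk_in_ranks[OF assms] by (metis imageI subsetI)
  show "at C ` ranks \<subseteq> C" using at_in[OF assms] by blast
qed

lemma flag_eqI:
  assumes "C \<in> flags F le" "D \<in> flags F le" "\<And>i. i \<in> ranks \<Longrightarrow> at C i = at D i"
  shows "C = D"
  using flag_image[OF assms(1)] flag_image[OF assms(2)] assms(3) by (metis image_cong)

lemma at_le:
  assumes "C \<in> flags F le" "i \<in> ranks" "j \<in> ranks" "i \<le> j"
  shows "le (at C i) (at C j)"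
proof -
  have "le (at C i) (at C j) \<or> le (at C j) (at C i)" using flag_total[OF assms(1)] at_in assms by blast
  moreover have "le (at C j) (at C i) \<Longrightarrow> at C i = at C j"
    using rk_less[of "at C j" "at C i"] rk_at at_F assms by fastforce
  ultimately show ?thesis by metis
qed

lemma flag_with:
  assumes "\<And>i. i \<in> J \<Longrightarrow> f i \<in> F \<and> rk (f i) = i"
    and "\<And>i j. i \<in> J \<Longrightarrow> j \<in> J \<Longrightarrow> i \<le> j \<Longrightarrow> le (f i) (f j)"
  obtains C where "C \<in> flags F le" "\<And>i. i \<in> J \<Longrightarrow> at C i = f i"
proof -
  have "le a b \<or> le b a" if "a \<in> f ` J" "b \<in> f ` J" for a b
    using that assms(2) by (metis imageE linear)
  then obtain C where C: "C \<in> flags F le" "f ` J \<subseteq> C" using extend_flag[of "f ` J"] assms(1) by blast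
  then show ?thesis using that[of C] at_eq assms(1) by (metis image_subset_iff)
qed

lemma at_least: "C \<in> flags F le \<Longrightarrow> D \<in> flags F le \<Longrightarrow> at C (-1) = at D (-1)"
proof -
  obtain m where m: "m \<in> F" "\<And>x. x \<in> F \<Longrightarrow> le m x"
    using poly unfolding abstract_polytope_def by blast
  have "at C (-1) = m" if C: "C \<in> flags F le" for C
    using at_F[OF C, of "-1"] rk_at[OF C, of "-1"] m rk_less[of m "at C (-1)"] rk_range[of m] by fastforce
  then show "C \<in> flags F le \<Longrightarrow> D \<in> flags F le \<Longrightarrow> ?thesis" by simp
qed

lemma at_greatest: "C \<in> flags F le \<Longrightarrow> D \<in> flags F le \<Longrightarrow> at C (int n) = at D (int n)"
proof -
  obtain m where m: "m \<in> F" "\<And>x. x \<in> F \<Longrightarrow> le x m"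
    using poly unfolding abstract_polytope_def by blast
  have "at C (int n) = m" if C: "C \<in> flags F le" for C
    using at_F[OF C, of "int n"] rk_at[OF C, of "int n"] m rk_less[of "at C (int n)" m] rk_range[of m] by fastforce
  then show "C \<in> flags F le \<Longrightarrow> D \<in> flags F le \<Longrightarrow> ?thesis" by simp
qed

section \<open>The diamond condition and adjacent flags\<close>

lemma diamond:
  assumes "C \<in> flags F le" "0 \<le> i" "i < int n"
  shows "card (open_section F le (at C (i - 1)) (at C (i + 1))) = 2"
proof -
  have "i - 1 \<in> ranks" "i + 1 \<in> ranks" using assms by auto
  then have "at C (i - 1) \<in> F" "at C (i + 1) \<in> F" "le (at C (i - 1)) (at C (i + 1))"
    "rk (at C (i + 1)) = rk (at C (i - 1)) + 2"
    using at_F at_le rk_at assms by auto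
  then show ?thesis using poly unfolding abstract_polytope_def by blast
qed

lemma section_mem:
  assumes "C \<in> flags F le" "D \<in> flags F le" "0 \<le> i" "i < int n"
    "at D (i - 1) = at C (i - 1)" "at D (i + 1) = at C (i + 1)"
  shows "at D i \<in> open_section F le (at C (i - 1)) (at C (i + 1))"
proof -
  have r: "i - 1 \<in> ranks" "i + 1 \<in> ranks" "i \<in> ranks" using assms by auto
  have "le (at D (i - 1)) (at D i)" "le (at D i) (at D (i + 1))"
    using at_le[OF assms(2)] r by auto
  moreover have "at D i \<noteq> at D (i - 1)" "at D i \<noteq> at D (i + 1)"
    using rk_at[OF assms(2)] r by (metis add_cancel_left_right zero_neq_one diff_add_cancel)+
  ultimately show ?thesis unfolding open_section_def using at_F[OF assms(2) r(3)] assms by auto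
qed

lemma section_two:
  assumes "card A = 2" "a \<in> A" "b \<in> A" "c \<in> A" "a \<noteq> b" "a \<noteq> c"
  shows "b = c"
  using assms by (metis card_2_iff doubleton_eq_iff insert_iff singletonD)

definition adj :: "int \<Rightarrow> 'a set \<Rightarrow> 'a set"
  where "adj i C = (THE D. D \<in> flags F le \<and> D \<noteq> C \<and> (\<forall>j\<in>ranks. j \<noteq> i \<longrightarrow> at D j = at C j))"

lemma adj_ex1:
  assumes C: "C \<in> flags F le" and i: "0 \<le> i" "i < int n"
  shows "\<exists>!D. D \<in> flags F le \<and> D \<noteq> C \<and> (\<forall>j\<in>ranks. j \<noteq> i \<longrightarrow> at D j = at C j)"
proof -
  let ?A = "open_section F le (at C (i - 1)) (at C (i + 1))"
  have r: "i - 1 \<in> ranks" "i + 1 \<in> ranks" "i \<in> ranks" using i by auto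
  have A2: "card ?A = 2" using diamond[OF C i] .
  have aA: "at C i \<in> ?A" using section_mem[OF C C i] by simp
  obtain z where z: "z \<in> ?A" "z \<noteq> at C i" using A2 aA by (metis card_2_iff insertCI)
  have zF: "z \<in> F" "le (at C (i - 1)) z" "le z (at C (i + 1))" "z \<noteq> at C (i - 1)" "z \<noteq> at C (i + 1)"
    using z(1) unfolding open_section_def by auto
  have "rk z = i"
    using rk_less[of "at C (i - 1)" z] rk_less[of z "at C (i + 1)"] zF at_F[OF C] rk_at[OF C] r by fastforce
  define f where "f j = (if j = i then z else at C j)" for j
  have below: "le (at C j) z" if "j \<in> ranks" "j < i" for j
    using le_trans[of "at C j" "at C (i - 1)" z] at_le[OF C that(1) r(1)] that at_F[OF C] r zF by simp
  have above: "le z (at C j)" if "j \<in> ranks" "i < j" for j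
    using le_trans[of z "at C (i + 1)" "at C j"] at_le[OF C r(2) that(1)] that at_F[OF C] r zF by simp
  obtain D where D: "D \<in> flags F le" "\<And>j. j \<in> ranks \<Longrightarrow> at D j = f j"
  proof (rule flag_with[of ranks f])
    show "f j \<in> F \<and> rk (f j) = j" if "j \<in> ranks" for j
      using that at_F[OF C] rk_at[OF C] zF \<open>rk z = i\<close> by (simp add: f_def)
    show "le (f j) (f k)" if "j \<in> ranks" "k \<in> ranks" "j \<le> k" for j k
      using that at_le[OF C] below above le_refl[OF zF(1)] by (auto simp: f_def)
  qed (use that in blast)
  show ?thesis
  proof (rule ex1I[of _ D])
    have "D \<noteq> C" using D(2)[OF r(3)] z(2) by (auto simp: f_def)
    then show "D \<in> flags F le \<and> D \<noteq> C \<and> (\<forall>j\<in>ranks. j \<noteq> i \<longrightarrow> at D j = at C j)"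
      using D by (simp add: f_def)
    fix E assume E: "E \<in> flags F le \<and> E \<noteq> C \<and> (\<forall>j\<in>ranks. j \<noteq> i \<longrightarrow> at E j = at C j)"
    then have "at E i \<in> ?A" using section_mem[OF C, of E i] i r by simp
    moreover have "at E i \<noteq> at C i" using E flag_eqI[of E C] C by metis
    ultimately have "at E i = z" using section_two[OF A2 aA] z by metis
    then show "E = D" using E D by (intro flag_eqI) (auto simp: f_def)
  qed
qed

lemma adj_props:
  assumes "C \<in> flags F le" "0 \<le> i" "i < int n"
  shows "adj i C \<in> flags F le \<and> adj i C \<noteq> C \<and> (\<forall>j\<in>ranks. j \<noteq> i \<longrightarrow> at (adj i C) j = at C j)"
  unfolding adj_def by (rule theI'[OF adj_ex1[OF assms]])

lemma adj_flag [simp]: "C \<in> flags F le \<Longrightarrow> 0 \<le> i \<Longrightarrow> i < int n \<Longrightarrow> adj i C \<in> flags F le"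
  and adj_neq: "C \<in> flags F le \<Longrightarrow> 0 \<le> i \<Longrightarrow> i < int n \<Longrightarrow> adj i C \<noteq> C"
  and at_adj: "C \<in> flags F le \<Longrightarrow> 0 \<le> i \<Longrightarrow> i < int n \<Longrightarrow> j \<in> ranks \<Longrightarrow> j \<noteq> i \<Longrightarrow> at (adj i C) j = at C j"
  using adj_props by blast+

lemma adj_unique:
  assumes "C \<in> flags F le" "0 \<le> i" "i < int n" "D \<in> flags F le"
    "\<And>j. j \<in> ranks \<Longrightarrow> j \<noteq> i \<Longrightarrow> at D j = at C j" "D \<noteq> C"
  shows "D = adj i C"
  unfolding adj_def by (rule the1_equality[OF adj_ex1[OF assms(1-3)], symmetric]) (use assms(4-6) in simp)

lemma adj_adj [simp]:
  assumes "C \<in> flags F le" "0 \<le> i" "i < int n"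
  shows "adj i (adj i C) = C"
proof -
  have "C = adj i (adj i C)"
    by (rule adj_unique) (use assms at_adj[OF assms] adj_neq[OF assms] adj_flag[OF assms] in auto)
  then show ?thesis by simp
qed

lemma at_adj_neq:
  assumes "C \<in> flags F le" "0 \<le> i" "i < int n"
  shows "at (adj i C) i \<noteq> at C i"
proof
  assume "at (adj i C) i = at C i"
  then have "adj i C = C" using at_adj[OF assms] by (intro flag_eqI adj_flag assms) metis
  then show False using adj_neq[OF assms] by simp
qed

lemma adj_commute:
  assumes C: "C \<in> flags F le" and i: "0 \<le> i" "i < int n" and j: "0 \<le> j" "j < int n"
    and ij: "i + 1 < j \<or> j + 1 < i"
  shows "adj i (adj j C) = adj j (adj i C)"
proof -
  define C' X Q where "C' = adj i C" and "X = adj j C'" and "Q = adj i X"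
  have fl: "C' \<in> flags F le" "X \<in> flags F le" "Q \<in> flags F le"
    unfolding Q_def X_def C'_def using C i j by simp_all
  let ?A = "open_section F le (at C (i - 1)) (at C (i + 1))"
  have r: "i - 1 \<in> ranks" "i + 1 \<in> ranks" "i \<in> ranks" "j \<in> ranks" using i j by auto
  have X: "at X k = at C k" if "k \<in> ranks" "k \<noteq> i" "k \<noteq> j" for k
    using that at_adj[OF C i] at_adj[OF fl(1) j] unfolding X_def C'_def by simp
  have Q: "at Q k = at C k" if "k \<in> ranks" "k \<noteq> i" "k \<noteq> j" for k
    using that at_adj[OF fl(2) i] X unfolding Q_def by simp
  have ne: "i - 1 \<noteq> j" "i + 1 \<noteq> j" "i \<noteq> j" using ij by auto
  \<comment> \<open>The \<open>i\<close>-faces of \<open>C\<close>, \<open>C'\<close> and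
    \<open>Q\<close> lie in one section with two elements. That of \<open>C'\<close> differs from
    the other two, so these coincide and the two changes at rank \<open>i\<close> cancel.\<close>
  have "at Q i = at C i"
  proof (rule section_two[OF diamond[OF C i]])
    have C': "at C' k = at C k" if "k \<in> ranks" "k \<noteq> i" for k
      using that at_adj[OF C i] unfolding C'_def by simp
    show "at C' i \<in> ?A" using section_mem[OF C fl(1) i] C' r by simp
    show "at Q i \<in> ?A" using section_mem[OF C fl(3) i] Q r ne by simp
    show "at C i \<in> ?A" using section_mem[OF C C i] by simp
    have "at X i = at C' i" unfolding X_def using at_adj[OF fl(1) j] r ne by simp
    then show "at C' i \<noteq> at Q i" unfolding Q_def using at_adj_neq[OF fl(2) i] by simp
    show "at C' i \<noteq> at C i" unfolding C'_def by (rule at_adj_neq[OF C i])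
  qed
  then have "at Q k = at C k" if "k \<in> ranks" "k \<noteq> j" for k using Q that by metis
  moreover have "Q \<noteq> C"
  proof -
    have "at Q j = at X j" unfolding Q_def using at_adj[OF fl(2) i] r ne by simp
    also have "\<dots> \<noteq> at C' j" unfolding X_def by (rule at_adj_neq[OF fl(1) j])
    also have "at C' j = at C j" unfolding C'_def using at_adj[OF C i] r ne by simp
    finally show ?thesis by blast
  qed
  ultimately have "Q = adj j C" using adj_unique[OF C j fl(3)] by blast
  then have "adj i (adj j C) = X" unfolding Q_def using adj_adj[OF fl(2) i] by simp
  then show ?thesis by (simp add: X_def C'_def)
qed

end

section \<open>Flag connectivity\<close>

context polytope
begin

definition conn :: "int set \<Rightarrow> 'a set \<Rightarrow> 'a set \<Rightarrow> bool"
  where "conn J = (\<lambda>C D. \<exists>i\<in>J. D = adj i C)\<^sup>*\<^sup>*"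

lemma conn_trans: "conn J C D \<Longrightarrow> conn J D E \<Longrightarrow> conn J C E"
  unfolding conn_def by (rule rtranclp_trans)

lemma conn_mono: "J \<subseteq> K \<Longrightarrow> conn J C D \<Longrightarrow> conn K C D"
  unfolding conn_def by (rule rtranclp_mono[THEN predicate2D, rotated]) auto

text \<open>Flags of the section between ranks \<open>a\<close> and \<open>b\<close>, represented by
  full flags that coincide outside it, so that one operation \<open>adj\<close> serves all
  sections.\<close>

definition agree :: "int \<Rightarrow> int \<Rightarrow> 'a set \<Rightarrow> 'a set \<Rightarrow> bool"
  where "agree a b C D \<longleftrightarrow> C \<in> flags F le \<and> D \<in> flags F le \<and> (\<forall>k\<in>ranks. k \<le> a \<or> b \<le> k \<longrightarrow> at C k = at D k)"

lemma agree_sym: "agree a b C D \<Longrightarrow> agree a b D C"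
  and agree_trans: "agree a b C D \<Longrightarrow> agree a b D E \<Longrightarrow> agree a b C E"
  and agree_refl: "C \<in> flags F le \<Longrightarrow> agree a b C C"
  unfolding agree_def by simp_all

lemma agree_flags: "agree a b C D \<Longrightarrow> C \<in> flags F le" "agree a b C D \<Longrightarrow> D \<in> flags F le"
  and agree_at: "agree a b C D \<Longrightarrow> k \<in> ranks \<Longrightarrow> k \<le> a \<or> b \<le> k \<Longrightarrow> at C k = at D k"
  unfolding agree_def by blast+

lemma merge:
  assumes CD: "agree a b C D" and c: "a < c" "c < b" "c \<in> ranks" "at C c = at D c"
  obtains E where "agree c b C E" "agree a c E D"
proof -
  note C = agree_flags(1)[OF CD] and D = agree_flags(2)[OF CD]
  define f where "f k = (if k \<le> c then at C k else at D k)" for k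
  obtain E where E: "E \<in> flags F le" "\<And>k. k \<in> ranks \<Longrightarrow> at E k = f k"
  proof (rule flag_with[of ranks f])
    show "f i \<in> F \<and> rk (f i) = i" if "i \<in> ranks" for i
      using that at_F rk_at C D by (simp add: f_def)
    show "le (f i) (f j)" if ij: "i \<in> ranks" "j \<in> ranks" "i \<le> j" for i j
    proof (cases "i \<le> c \<and> c < j")
      case True
      have "le (at C i) (at C c)" using at_le[OF C ij(1) c(3)] True by simp
      then have "le (at C i) (at D c)" by (simp only: c(4))
      moreover have "le (at D c) (at D j)" using at_le[OF D c(3) ij(2)] True by simp
      ultimately have "le (at C i) (at D j)"
        using le_trans[OF at_F[OF C ij(1)] at_F[OF D c(3)] at_F[OF D ij(2)]] by blast
      then show ?thesis using True by (simp add: f_def)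
    next
      case False
      then show ?thesis using at_le C D ij by (auto simp: f_def)
    qed
  qed blast
  have "agree c b C E" unfolding agree_def
    using E C agree_at[OF CD] c by (auto simp: f_def)
  moreover have "agree a c E D" unfolding agree_def
    using E D agree_at[OF CD] c by (auto simp: f_def)
  ultimately show ?thesis by (rule that)
qed

text \<open>Strong connectivity provides paths of faces; here they become paths of flags.
  Consecutive faces of a path lie in a common flag, and two flags sharing a face of the section are
  joined via \<open>merge\<close> inside the two shorter sections that this face cuts off; hence the
  induction on \<open>b - a\<close>.\<close>

lemma agree_conn:
  assumes "-1 \<le> a" "a < b" "b \<le> int n" "agree a b C D"
  shows "conn {a<..<b} C D"
  using assms
proof (induction "nat (b - a)" arbitrary: a b C D rule: less_induct)
  case less
  note C = agree_flags(1)[OF less(5)] and D = agree_flags(2)[OF less(5)]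
  consider "b = a + 1" | "b = a + 2" | "a + 3 \<le> b" using less(3) by linarith
  then show ?case
  proof cases
    case 1
    have "at C k = at D k" if "k \<in> ranks" for k using agree_at[OF less(5) that] 1 by linarith
    then have "C = D" using flag_eqI C D by blast
    then show ?thesis by (simp add: conn_def)
  next
    case 2
    have "at D k = at C k" if "k \<in> ranks" "k \<noteq> a + 1" for k
      using agree_at[OF less(5) that(1)] that(2) 2 by fastforce
    then have "D = C \<or> D = adj (a + 1) C"
      using adj_unique[of C "a + 1" D] C D less(2-4) 2 by auto
    then show ?thesis
    proof
      assume "D = adj (a + 1) C"
      moreover have "a + 1 \<in> {a<..<b}" using 2 by simp
      ultimately show ?thesis unfolding conn_def by blast
    qed (simp add: conn_def)
  next
    case 3
    have same: "conn {a<..<b} C' D'"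
      if CD: "agree a b C' D'" and c: "a < c" "c < b" "at C' c = at D' c" for C' D' c
    proof -
      have cr: "c \<in> ranks" using c less(2-4) by simp
      obtain E where E: "agree c b C' E" "agree a c E D'"
        using merge[OF CD c(1,2) cr c(3)] by blast
      have cn: "conn {c<..<b} C' E" "conn {a<..<c} E D'"
        using less(1)[of b c C' E] less(1)[of c a E D'] E c less(2-4) by auto
      have "{c<..<b} \<subseteq> {a<..<b}" "{a<..<c} \<subseteq> {a<..<b}" using c by auto
      from conn_trans[OF conn_mono[OF this(1) cn(1)] conn_mono[OF this(2) cn(2)]] show ?thesis .
    qed
    define x y where "x = at C a" and "y = at C b"
    define Os where "Os = open_section F le x y"
    have ab: "a \<in> ranks" "b \<in> ranks" "a + 1 \<in> ranks" using less(2-4) 3 by auto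
    have xy: "x \<in> F" "y \<in> F" "le x y" "rk x = a" "rk y = b"
      unfolding x_def y_def using at_F[OF C] at_le[OF C] rk_at[OF C] ab 3 by auto
    have mem: "at E k \<in> Os" if E: "agree a b C E" and k: "a < k" "k < b" for E k
    proof -
      have kr: "k \<in> ranks" using k less(2-4) by simp
      have Ef: "E \<in> flags F le" using agree_flags[OF E] by simp
      have "at E a = x" "at E b = y" using agree_at[OF E] ab by (simp_all add: x_def y_def)
      moreover have "le (at E a) (at E k)" "le (at E k) (at E b)"
        using at_le[OF Ef ab(1) kr] at_le[OF Ef kr ab(2)] k by simp_all
      ultimately have "le x (at E k)" "le (at E k) y" by simp_all
      moreover have "at E k \<noteq> x" "at E k \<noteq> y" using rk_at[OF Ef kr] xy k by auto
      ultimately show ?thesis unfolding Os_def open_section_def using at_F[OF Ef kr] by simp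
    qed
    have rkO: "v \<in> F \<and> le x v \<and> le v y \<and> a < rk v \<and> rk v < b" if "v \<in> Os" for v
      using that rk_less[of x v] rk_less[of v y] xy unfolding Os_def open_section_def by auto
    have path: "(\<lambda>u v. u \<in> Os \<and> v \<in> Os \<and> (le u v \<or> le v u))\<^sup>*\<^sup>* p q" if "p \<in> Os" "q \<in> Os" for p q
    proof -
      have "strongly_connected F le" using poly unfolding abstract_polytope_def by blast
      then show ?thesis using xy 3 that unfolding strongly_connected_def Os_def by auto
    qed
    have incident: "\<exists>E. agree a b C E \<and> at E (rk u) = u \<and> at E (rk v) = v"
      if u: "u \<in> Os" and v: "v \<in> Os" and uv: "le u v \<or> le v u" for u v
    proof -
      define B where "B = {at C k | k. k \<in> ranks \<and> (k \<le> a \<or> b \<le> k)}"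
      have BO: "le p q \<or> le q p" if pq: "p \<in> B" "q \<in> Os" for p q
      proof -
        obtain k where k: "p = at C k" "k \<in> ranks" "k \<le> a \<or> b \<le> k" using pq(1) unfolding B_def by blast
        have pF: "p \<in> F" using k at_F[OF C] by simp
        from k(3) show ?thesis
        proof
          assume "k \<le> a"
          then have "le p x" unfolding x_def k(1) using at_le[OF C k(2) ab(1)] by simp
          then show ?thesis using le_trans[OF pF xy(1)] rkO[OF pq(2)] by blast
        next
          assume "b \<le> k"
          then have "le y p" unfolding y_def k(1) using at_le[OF C ab(2) k(2)] by simp
          then show ?thesis using le_trans[OF _ xy(2) pF] rkO[OF pq(2)] by blast
        qed
      qed
      have BB: "le p q \<or> le q p" if "p \<in> B" "q \<in> B" for p q
        using that flag_total[OF C] at_in[OF C] unfolding B_def by blast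
      have BF: "B \<subseteq> F" using at_F[OF C] unfolding B_def by blast
      have uvF: "u \<in> F" "v \<in> F" using rkO u v by blast+
      have "\<exists>E. E \<in> flags F le \<and> B \<union> {u, v} \<subseteq> E"
      proof (rule extend_flag[of "B \<union> {u, v}"])
        show "B \<union> {u, v} \<subseteq> F" using BF uvF by simp
        show "le p q \<or> le q p" if pq: "p \<in> B \<union> {u, v}" "q \<in> B \<union> {u, v}" for p q
          using pq BO[of p] BO[of q] BB u v uv le_refl uvF by auto
      qed auto
      then obtain E where E: "E \<in> flags F le" "B \<subseteq> E" "u \<in> E" "v \<in> E" by auto
      have "at C k = at E k" if "k \<in> ranks" "k \<le> a \<or> b \<le> k" for k
      proof -
        have "at C k \<in> E" using that E(2) unfolding B_def by blast
        then show ?thesis using at_eq[OF E(1)] rk_at[OF C that(1)] by metis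
      qed
      then have "agree a b C E" unfolding agree_def using C E by blast
      then show ?thesis using at_eq[OF E(1)] E(3,4) by blast
    qed
    define p where "p = at C (a + 1)"
    have pO: "p \<in> Os" unfolding p_def using mem[OF agree_refl[OF C]] 3 by simp
    have rp: "rk p = a + 1" unfolding p_def by (rule rk_at[OF C ab(3)])
    have claim: "\<forall>E. agree a b C E \<longrightarrow> at E (rk q) = q \<longrightarrow> conn {a<..<b} C E"
      if "(\<lambda>u v. u \<in> Os \<and> v \<in> Os \<and> (le u v \<or> le v u))\<^sup>*\<^sup>* p q" for q
      using that
    proof (induction rule: rtranclp_induct)
      case base
      show ?case using same[of C _ "a + 1"] 3 rp p_def by simp
    next
      case (step u v)
      obtain E where E: "agree a b C E" "at E (rk u) = u" "at E (rk v) = v"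
        using incident[of u v] step(2) by blast
      then have CE: "conn {a<..<b} C E" using step(3) by blast
      show ?case
      proof (intro allI impI)
        fix G assume G: "agree a b C G" "at G (rk v) = v"
        have "agree a b E G" using agree_trans[OF agree_sym[OF E(1)] G(1)] .
        then have "conn {a<..<b} E G" using same[of E G "rk v"] E(3) G(2) rkO step(2) by simp
        then show "conn {a<..<b} C G" by (rule conn_trans[OF CE])
      qed
    qed
    define q where "q = at D (a + 1)"
    have "q \<in> Os" unfolding q_def using mem[OF less(5)] 3 by simp
    moreover have "at D (rk q) = q" unfolding q_def using rk_at[OF D ab(3)] by simp
    ultimately show ?thesis using claim[OF path[OF pO]] less(5) by blast
  qed
qed

lemma flags_conn:
  assumes "C \<in> flags F le" "D \<in> flags F le"
  shows "conn {0..<int n} C D"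
proof -
  have "at C k = at D k" if "k \<in> ranks" "k \<le> -1 \<or> int n \<le> k" for k
    using that at_least[OF assms] at_greatest[OF assms] by (metis atLeastAtMost_iff order_antisym)
  then have "agree (-1) (int n) C D" using assms unfolding agree_def by blast
  then have "conn {-1<..<int n} C D" by (intro agree_conn) auto
  moreover have "{-1<..<int n} = {0..<int n}" by auto
  ultimately show ?thesis by simp
qed

text \<open>Flags through a common face are joined without moving it, so a map on flags that
  respects adjacency induces a map on faces; \<open>mirror_at\<close> depends on this.\<close>

lemma flags_conn_fixed_rank:
  assumes "C \<in> flags F le" "D \<in> flags F le" "0 \<le> i" "i < int n" "at C i = at D i"
  shows "conn ({0..<int n} - {i}) C D"
proof -
  have "at C k = at D k" if "k \<in> ranks" "k \<le> -1 \<or> int n \<le> k" for k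
    using that at_least[OF assms(1,2)] at_greatest[OF assms(1,2)] by (metis atLeastAtMost_iff order_antisym)
  then have "agree (-1) (int n) C D" using assms unfolding agree_def by blast
  then obtain E where E: "agree i (int n) C E" "agree (-1) i E D"
    using merge[of "-1" "int n" C D i] assms by auto
  have cn: "conn {i<..<int n} C E" "conn {-1<..<i} E D"
    using E assms by (intro agree_conn; simp)+
  have "{i<..<int n} \<subseteq> {0..<int n} - {i}" "{-1<..<i} \<subseteq> {0..<int n} - {i}" using assms by auto
  from conn_trans[OF conn_mono[OF this(1) cn(1)] conn_mono[OF this(2) cn(2)]] show ?thesis .
qed

end

section \<open>Automorphisms\<close>

context polytope
begin

text \<open>Fixing everything outside \<open>F\<close> gives each automorphism a single
  representative, so that group equations are equations of automorphisms.\<close>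

definition Aut :: "'a bij set"
  where "Aut = {g. is_automorphism F le (app g) \<and> (\<forall>x. x \<notin> F \<longrightarrow> app g x = x)}"

definition ap :: "'a bij \<Rightarrow> 'a set \<Rightarrow> 'a set" where "ap g C = app g ` C"

lemma AutD: "g \<in> Aut \<Longrightarrow> bij_betw (app g) F F"
  "g \<in> Aut \<Longrightarrow> x \<in> F \<Longrightarrow> y \<in> F \<Longrightarrow> le (app g x) (app g y) \<longleftrightarrow> le x y"
  "g \<in> Aut \<Longrightarrow> x \<notin> F \<Longrightarrow> app g x = x"
  unfolding Aut_def is_automorphism_def by blast+

lemma Aut_F: "g \<in> Aut \<Longrightarrow> x \<in> F \<Longrightarrow> app g x \<in> F"
  using AutD(1) bij_betwE by blast

lemma Aut_one: "1 \<in> Aut"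
  unfolding Aut_def is_automorphism_def by simp

lemma Aut_times:
  assumes "g \<in> Aut" "h \<in> Aut"
  shows "g * h \<in> Aut"
  unfolding Aut_def is_automorphism_def mem_Collect_eq app_times
proof (intro conjI ballI allI impI)
  show "bij_betw (app g \<circ> app h) F F"
    by (rule bij_betw_trans[OF AutD(1)[OF assms(2)] AutD(1)[OF assms(1)]])
  show "le x y = le ((app g \<circ> app h) x) ((app g \<circ> app h) y)" if "x \<in> F" "y \<in> F" for x y
    using that by (simp add: AutD(2)[OF assms(1)] AutD(2)[OF assms(2)] Aut_F[OF assms(2)])
  show "(app g \<circ> app h) x = x" if "x \<notin> F" for x
    using that by (simp add: AutD(3)[OF assms(1)] AutD(3)[OF assms(2)])
qed

lemma app_ginv [simp]: "app (ginv g) (app g x) = x" "app g (app (ginv g) x) = x"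
  by (metis app_one app_times comp_apply ginv_left id_apply)
    (metis app_one app_times comp_apply ginv_right id_apply)

lemma Aut_ginv:
  assumes g: "g \<in> Aut"
  shows "ginv g \<in> Aut"
proof -
  have out: "app (ginv g) x = x" if "x \<notin> F" for x
    using AutD(3)[OF g that] by (metis app_ginv(1))
  have F: "app (ginv g) x \<in> F" if "x \<in> F" for x
    using out that by (metis app_ginv(2))
  have "bij_betw (app (ginv g)) F F"
    by (rule bij_betw_byWitness[where f' = "app g"]) (use F Aut_F[OF g] in auto)
  moreover have "le x y \<longleftrightarrow> le (app (ginv g) x) (app (ginv g) y)" if "x \<in> F" "y \<in> F" for x y
    using AutD(2)[OF g F[OF that(1)] F[OF that(2)]] by simp
  ultimately show ?thesis using out unfolding Aut_def is_automorphism_def by blast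
qed

lemma Aut_gpow: "g \<in> Aut \<Longrightarrow> g \<up> k \<in> Aut"
  by (rule gpow_closed) (auto intro: Aut_one Aut_times Aut_ginv)

lemma ap_one [simp]: "ap 1 C = C" and ap_times: "ap (g * h) C = ap g (ap h C)"
  unfolding ap_def by (auto simp: app_times)

lemma ap_ginv [simp]: "ap (ginv g) (ap g C) = C" "ap g (ap (ginv g) C) = C"
  by (simp_all flip: ap_times)

lemma chain_card_flag:
  assumes "C \<subseteq> F" "\<And>x y. x \<in> C \<Longrightarrow> y \<in> C \<Longrightarrow> le x y \<or> le y x" "card C = n + 2"
  shows "C \<in> flags F le"
proof -
  obtain D where "D \<in> flags F le" "C \<subseteq> D" using extend_flag[of C] assms by blast
  then show ?thesis using card_subset_eq[of D C] flag_card[of D] assms(3) by simp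
qed

lemma ap_flag [simp]:
  assumes g: "g \<in> Aut" and C: "C \<in> flags F le"
  shows "ap g C \<in> flags F le"
proof (rule chain_card_flag)
  have "inj_on (app g) C" using app_bij[of g] by (metis bij_is_inj inj_on_subset subset_UNIV)
  then show "card (ap g C) = n + 2" unfolding ap_def using flag_card[OF C] by (simp add: card_image)
  show "ap g C \<subseteq> F" unfolding ap_def using Aut_F[OF g] flag_sub[OF C] by blast
  fix x y assume "x \<in> ap g C" "y \<in> ap g C"
  then obtain a b where "a \<in> C" "b \<in> C" "x = app g a" "y = app g b" unfolding ap_def by blast
  then show "le x y \<or> le y x" using flag_total[OF C] AutD(2)[OF g] flag_sub[OF C] by (meson subsetD)
qed

lemma rk_Aut:
  assumes g: "g \<in> Aut" and x: "x \<in> F"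
  shows "rk (app g x) = rk x"
proof -
  obtain C where C: "C \<in> flags F le" "x \<in> C" using in_flag[OF x] by blast
  have "{y \<in> ap g C. le y (app g x)} = app g ` {y \<in> C. le y x}"
    unfolding ap_def using AutD(2)[OF g _ x] flag_sub[OF C(1)] by blast
  moreover have "inj_on (app g) {y \<in> C. le y x}"
    using app_bij[of g] by (metis bij_is_inj inj_on_subset subset_UNIV)
  ultimately have "card {y \<in> ap g C. le y (app g x)} = card {y \<in> C. le y x}" by (simp add: card_image)
  moreover have "app g x \<in> ap g C" using C(2) by (simp add: ap_def)
  ultimately show ?thesis using rk_flag[OF C] rk_flag[OF ap_flag[OF g C(1)]] by simp
qed

lemma at_ap:
  assumes g: "g \<in> Aut" and C: "C \<in> flags F le" and i: "i \<in> ranks"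
  shows "at (ap g C) i = app g (at C i)"
proof -
  have "app g (at C i) \<in> ap g C" using at_in[OF C i] by (simp add: ap_def)
  then have "at (ap g C) (rk (app g (at C i))) = app g (at C i)" using at_eq[OF ap_flag[OF g C]] by blast
  then show ?thesis using rk_Aut[OF g at_F[OF C i]] rk_at[OF C i] by simp
qed

lemma ap_adj:
  assumes g: "g \<in> Aut" and C: "C \<in> flags F le" and i: "0 \<le> i" "i < int n"
  shows "ap g (adj i C) = adj i (ap g C)"
proof (rule adj_unique[OF ap_flag[OF g C] i])
  show "ap g (adj i C) \<in> flags F le" using ap_flag[OF g] adj_flag[OF C i] by blast
  show "at (ap g (adj i C)) j = at (ap g C) j" if "j \<in> ranks" "j \<noteq> i" for j
    using at_ap[OF g] C adj_flag[OF C i] at_adj[OF C i] that by simp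
  show "ap g (adj i C) \<noteq> ap g C" using adj_neq[OF C i] by (metis ap_ginv(1))
qed

lemma ap_conn:
  assumes g: "g \<in> Aut" and C: "C \<in> flags F le" and f: "ap g C = C"
    and "conn {0..<int n} C D"
  shows "ap g D = D \<and> D \<in> flags F le"
  using assms(4) unfolding conn_def
  by (induction rule: rtranclp_induct) (use f C ap_adj[OF g] in auto)

text \<open>Automorphisms respect adjacency, so by connectivity one fixed flag forces all flags to
  be fixed, and with them all faces.\<close>

lemma Aut_fix_one:
  assumes g: "g \<in> Aut" and C: "C \<in> flags F le" and f: "ap g C = C"
  shows "g = 1"
proof -
  have "app g x = x" for x
  proof (cases "x \<in> F")
    case True
    then obtain D where D: "D \<in> flags F le" "x \<in> D" using in_flag by blast
    have "ap g D = D" using ap_conn[OF g C f flags_conn[OF C D(1)]] by simp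
    then have "app g (at D (rk x)) = at D (rk x)"
      using at_ap[OF g D(1) rk_in_ranks[OF D]] by simp
    then show ?thesis using at_eq[OF D] by simp
  next
    case False
    then show ?thesis using AutD(3)[OF g] by blast
  qed
  then show ?thesis by (simp add: app_inject[symmetric] fun_eq_iff)
qed

lemma ap_inj:
  assumes "g \<in> Aut" "h \<in> Aut" "C \<in> flags F le" "ap g C = ap h C"
  shows "g = h"
proof -
  have "ap (ginv g * h) C = C" using assms(4) by (simp add: ap_times flip: assms(4))
  then have "ginv g * h = 1" using Aut_fix_one Aut_times Aut_ginv assms by blast
  then show ?thesis by (metis ginv_right_assoc mult_1_right)
qed

lemma automorphism_Aut:
  assumes "is_automorphism F le \<phi>"
  obtains g where "g \<in> Aut" "\<And>x. x \<in> F \<Longrightarrow> app g x = \<phi> x"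
proof -
  define f where "f x = (if x \<in> F then \<phi> x else x)" for x
  have b: "bij_betw \<phi> F F" using assms unfolding is_automorphism_def by blast
  then have "bij_betw f F F" by (rule bij_betw_cong[THEN iffD1, rotated]) (simp add: f_def)
  moreover have "bij_betw f (- F) (- F)" by (rule bij_betw_byWitness[where f' = id]) (auto simp: f_def)
  ultimately have "bij_betw f (F \<union> - F) (F \<union> - F)" by (rule bij_betw_combine) auto
  then have "bij f" by simp
  then have app: "app (Abs_bij f) = f" by (simp add: Abs_bij_inverse)
  have "is_automorphism F le f"
    using \<open>bij_betw f F F\<close> assms unfolding is_automorphism_def by (simp add: f_def)
  then have "Abs_bij f \<in> Aut" unfolding Aut_def by (simp add: app) (simp add: f_def)
  then show ?thesis by (rule that) (simp add: app f_def)
qed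

lemma flag_orbit_Aut:
  assumes "C \<in> flags F le"
  shows "flag_orbit F le C = (\<lambda>g. ap g C) ` Aut"
proof
  show "flag_orbit F le C \<subseteq> (\<lambda>g. ap g C) ` Aut"
  proof
    fix D assume "D \<in> flag_orbit F le C"
    then obtain \<phi> where \<phi>: "is_automorphism F le \<phi>" "D = \<phi> ` C" unfolding flag_orbit_def by blast
    then obtain g where g: "g \<in> Aut" "\<And>x. x \<in> F \<Longrightarrow> app g x = \<phi> x" using automorphism_Aut by blast
    have "D = ap g C" unfolding \<phi>(2) ap_def using g(2) flag_sub[OF assms] by (intro image_cong) auto
    then show "D \<in> (\<lambda>g. ap g C) ` Aut" using g(1) by blast
  qed
  show "(\<lambda>g. ap g C) ` Aut \<subseteq> flag_orbit F le C"
    unfolding flag_orbit_def ap_def Aut_def by blast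
qed

lemma orbit_eqI:
  assumes "C \<in> flags F le" "g \<in> Aut"
  shows "flag_orbit F le (ap g C) = flag_orbit F le C"
proof
  show "flag_orbit F le (ap g C) \<subseteq> flag_orbit F le C"
    unfolding flag_orbit_Aut[OF assms(1)] flag_orbit_Aut[OF ap_flag[OF assms(2,1)]]
    using Aut_times assms(2) by (auto simp flip: ap_times)
  have "ap h C = ap (h * ginv g) (ap g C)" for h by (simp add: ap_times)
  then show "flag_orbit F le C \<subseteq> flag_orbit F le (ap g C)"
    unfolding flag_orbit_Aut[OF assms(1)] flag_orbit_Aut[OF ap_flag[OF assms(2,1)]]
    using Aut_times Aut_ginv assms(2) by blast
qed

lemma orbit_eqD:
  assumes "C \<in> flags F le" "D \<in> flags F le" "flag_orbit F le D = flag_orbit F le C"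
  obtains g where "g \<in> Aut" "D = ap g C"
proof -
  have "D \<in> flag_orbit F le D" unfolding flag_orbit_Aut[OF assms(2)] using Aut_one by (metis ap_one imageI)
  then show ?thesis using assms(3) that unfolding flag_orbit_Aut[OF assms(1)] by blast
qed

lemma adj_diff:
  assumes C: "C \<in> flags F le" and i: "0 \<le> i" "i < int n"
  shows "card (C - adj i C) = 1"
proof -
  have ir: "i \<in> ranks" using i by auto
  have "C - adj i C = {at C i}"
  proof
    show "C - adj i C \<subseteq> {at C i}"
    proof
      fix x assume x: "x \<in> C - adj i C"
      have "rk x = i"
      proof (rule ccontr)
        assume "rk x \<noteq> i"
        then have "at (adj i C) (rk x) = x" using at_adj[OF C i rk_in_ranks[OF C]] at_eq[OF C] x by simp
        then have "x \<in> adj i C" using at_in[OF adj_flag[OF C i] rk_in_ranks[OF C]] x by fastforce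
        then show False using x by blast
      qed
      then show "x \<in> {at C i}" using at_eq[OF C] x by auto
    qed
    have "at C i \<notin> adj i C"
      using at_eq[OF adj_flag[OF C i], of "at C i"] rk_at[OF C ir] at_adj_neq[OF C i] by auto
    then show "{at C i} \<subseteq> C - adj i C" using at_in[OF C ir] by blast
  qed
  then show ?thesis by simp
qed

end

section \<open>Consequences of having two flag orbits\<close>

locale chiral_polytope = polytope +
  assumes chiral: "chiral F le"
begin

lemma adj_orbit:
  assumes "C \<in> flags F le" "0 \<le> i" "i < int n"
  shows "flag_orbit F le (adj i C) \<noteq> flag_orbit F le C"
  using chiral adj_diff[OF assms] adj_diff[OF adj_flag[OF assms] assms(2,3)] assms adj_flag[OF assms]
  unfolding chiral_def by auto

lemma not_ap_adj: "g \<in> Aut \<Longrightarrow> C \<in> flags F le \<Longrightarrow> 0 \<le> i \<Longrightarrow> i < int n \<Longrightarrow> ap g C \<noteq> adj i C"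
  using adj_orbit orbit_eqI by metis

lemma third_orbit:
  assumes "C \<in> flags F le" "D \<in> flags F le" "0 \<le> i" "i < int n"
    "flag_orbit F le D \<noteq> flag_orbit F le (adj i C)"
  obtains g where "g \<in> Aut" "D = ap g C"
proof -
  let ?S = "flag_orbit F le ` flags F le"
  have "card ?S = 2" using chiral unfolding chiral_def by blast
  moreover have "flag_orbit F le (adj i C) \<in> ?S" "flag_orbit F le C \<in> ?S" "flag_orbit F le D \<in> ?S"
    using assms adj_flag by auto
  ultimately have "flag_orbit F le D = flag_orbit F le C"
    using section_two[of ?S "flag_orbit F le (adj i C)"] adj_orbit[OF assms(1,3,4)] assms(5) by metis
  then show ?thesis using orbit_eqD assms(1,2) that by blast
qed

lemma ap_adj_adj:
  assumes C: "C \<in> flags F le" and i: "0 \<le> i" "i < int n" and j: "0 \<le> j" "j < int n"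
  obtains g where "g \<in> Aut" "ap g C = adj j (adj i C)"
  using third_orbit[OF C adj_flag[OF adj_flag[OF C i] j] i adj_orbit[OF adj_flag[OF C i] j]] by metis

text \<open>The image of \<open>C\<close> is \<open>C\<close> or its \<open>i\<close>-adjacent flag,
  and the latter lies in the other orbit.\<close>

lemma fixes_all_but_one:
  assumes g: "g \<in> Aut" and C: "C \<in> flags F le" and i: "0 \<le> i" "i < int n"
    and f: "\<And>k. k \<in> ranks \<Longrightarrow> k \<noteq> i \<Longrightarrow> app g (at C k) = at C k"
  shows "g = 1"
proof -
  have "at (ap g C) k = at C k" if "k \<in> ranks" "k \<noteq> i" for k
    using at_ap[OF g C that(1)] f[OF that] by simp
  then have "ap g C = C" using adj_unique[OF C i ap_flag[OF g C]] not_ap_adj[OF g C i] by blast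
  then show ?thesis using Aut_fix_one[OF g C] by blast
qed

end

section \<open>The automorphism group of a tight chiral 5-polytope\<close>

lemma cj_eqI: "g * a = b * g \<Longrightarrow> cj g a = (b::'a::mult_group)"
  by (metis cj_mult_left group_cancel_right)

lemma finite_cyc_order:
  assumes "finite (cyc a)"
  shows "\<exists>n::nat. 0 < n \<and> a ^ n = 1"
proof -
  have "(\<lambda>n::nat. a ^ n) ` UNIV \<subseteq> cyc a" by (auto simp: cyc_def simp flip: gpow_of_nat)
  then have "\<not> inj (\<lambda>n::nat. a ^ n)" using assms finite_subset finite_imageD infinite_UNIV_nat by metis
  then obtain m n where mn: "m < n" "a ^ m = a ^ n" by (metis injI linorder_neqE_nat)
  have "a ^ n = a ^ m * a ^ (n - m)" using mn(1) by (simp flip: power_add)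
  then have "a ^ m * a ^ (n - m) = a ^ m * 1" using mn(2) by simp
  then have "a ^ (n - m) = 1" by (simp only: group_cancel_left)
  then show ?thesis using mn(1) by (metis zero_less_diff)
qed

locale tight_chiral = chiral_polytope F le 5 for F :: "'a set" and le +
  fixes ps :: "nat list" and \<Phi> :: "'a set"
  assumes tight: "tight F le 5 ps" and base: "\<Phi> \<in> flags F le"
begin

text \<open>\<open>rot i j\<close> is the automorphism \<open>\<rho>\<^sub>i\<rho>\<^sub>j\<close>; the \<open>\<rho>\<^sub>i\<close> themselves need not exist. Composition of
  such automorphisms corresponds to concatenation of the words acting on the base flag.\<close>

definition rot :: "int \<Rightarrow> int \<Rightarrow> 'a bij"
  where "rot i j = (SOME g. g \<in> Aut \<and> ap g \<Phi> = adj j (adj i \<Phi>))"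

lemma rot_props:
  assumes "0 \<le> i" "i < 5" "0 \<le> j" "j < 5"
  shows "rot i j \<in> Aut \<and> ap (rot i j) \<Phi> = adj j (adj i \<Phi>)"
proof -
  obtain g where "g \<in> Aut" "ap g \<Phi> = adj j (adj i \<Phi>)"
    using ap_adj_adj[OF base, of i j] assms by auto
  then show ?thesis unfolding rot_def by (intro someI) blast
qed

lemmas rot_Aut = conjunct1[OF rot_props] and ap_rot = conjunct2[OF rot_props]

abbreviation "x \<equiv> rot 0 1"
abbreviation "y \<equiv> rot 1 2"
abbreviation "z \<equiv> rot 2 3"
abbreviation "w \<equiv> rot 3 4"

lemma Aut_eqI: "g \<in> Aut \<Longrightarrow> h \<in> Aut \<Longrightarrow> ap g \<Phi> = ap h \<Phi> \<Longrightarrow> g = h"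
  using ap_inj base by blast

lemma adj_swap:
  assumes "C \<in> flags F le"
  shows "adj 0 (adj 2 C) = adj 2 (adj 0 C)" "adj 0 (adj 3 C) = adj 3 (adj 0 C)"
    "adj 0 (adj 4 C) = adj 4 (adj 0 C)" "adj 1 (adj 3 C) = adj 3 (adj 1 C)"
    "adj 1 (adj 4 C) = adj 4 (adj 1 C)" "adj 2 (adj 4 C) = adj 4 (adj 2 C)"
  using adj_commute[OF assms] by simp_all

lemma ap_adj5:
  assumes "g \<in> Aut" "C \<in> flags F le" "0 \<le> i" "i < 5"
  shows "ap g (adj i C) = adj i (ap g C)"
  using ap_adj[of g C i] assms by simp

lemma adj5: "C \<in> flags F le \<Longrightarrow> 0 \<le> i \<Longrightarrow> i < 5 \<Longrightarrow> adj i C \<in> flags F le"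
  "C \<in> flags F le \<Longrightarrow> 0 \<le> i \<Longrightarrow> i < 5 \<Longrightarrow> adj i (adj i C) = C"
  by simp_all

lemmas word_simps = rot_Aut ap_rot ap_adj5 adj_swap adj5 base Aut_times Aut_ginv Aut_one ap_times

text \<open>The action on flags is free, so a relation is checked at \<open>\<Phi>\<close> alone.
  There both sides become words in the operations \<open>adj\<close>, which cancellation and the
  exchange of distant indices reduce to the same word.\<close>

lemma word_relations:
  "x * y * x * y = 1" "y * z * y * z = 1" "z * w * z * w = 1"
  "x * y * z * x * y * z = 1" "y * z * w * y * z * w = 1"
  "x * w = w * x" "(x * y * y) * (z * z * w) = (z * z * w) * (x * y * y)"
  by (rule Aut_eqI; simp add: word_simps)+

lemma word_conjugations:
  "cj (z * w) x = x * y * y" "cj (z * w) y = ginv y"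
  "cj (x * y) w = z * z * w" "cj (x * y) z = ginv z"
  "cj (rot 1 4) x = ginv x" "cj (rot 1 4) y = ginv y"
  "cj (rot 0 3) z = ginv z" "cj (rot 0 3) w = ginv w"
proof -
  have inv: "cj g a = ginv a" if "a * (g * a) = g" for g a :: "'a bij"
    by (rule cj_eqI) (metis ginv_left_assoc that)
  show "cj (z * w) x = x * y * y" "cj (x * y) w = z * z * w"
    by (rule cj_eqI, rule Aut_eqI; simp add: word_simps)+
  show "cj (z * w) y = ginv y" "cj (x * y) z = ginv z" "cj (rot 1 4) x = ginv x"
    "cj (rot 1 4) y = ginv y" "cj (rot 0 3) z = ginv z" "cj (rot 0 3) w = ginv w"
    by (rule inv, rule Aut_eqI; simp add: word_simps)+
qed

section \<open>Stabilizers of base faces and unique normal forms\<close>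

definition fixes_rk :: "'a bij \<Rightarrow> int \<Rightarrow> bool"
  where "fixes_rk g k \<longleftrightarrow> app g (at \<Phi> k) = at \<Phi> k"

lemma fixes_times: "fixes_rk g k \<Longrightarrow> fixes_rk h k \<Longrightarrow> fixes_rk (g * h) k"
  and fixes_one: "fixes_rk 1 k"
  by (simp_all add: fixes_rk_def app_times)

lemma fixes_ginv: "fixes_rk g k \<Longrightarrow> fixes_rk (ginv g) k"
  unfolding fixes_rk_def by (metis app_ginv(1))

lemma fixes_cancel: "fixes_rk g k \<Longrightarrow> fixes_rk (g * h) k \<Longrightarrow> fixes_rk h k"
  using fixes_times[OF fixes_ginv] by (metis ginv_left_assoc)

lemma fixes_gpow: "fixes_rk g k \<Longrightarrow> fixes_rk (g \<up> m) k"
  by (rule gpow_closed) (auto intro: fixes_one fixes_times fixes_ginv)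

lemma fixes_rot:
  assumes "0 \<le> i" "i < 5" "0 \<le> j" "j < 5" "k \<in> {-1..5}" "k \<noteq> i" "k \<noteq> j"
  shows "fixes_rk (rot i j) k"
proof -
  have "app (rot i j) (at \<Phi> k) = at (adj j (adj i \<Phi>)) k"
    using at_ap[OF rot_Aut base, of i j k] ap_rot[of i j] assms by simp
  also have "\<dots> = at \<Phi> k"
    using at_adj[OF base, of i k] at_adj[OF adj_flag[OF base], of i j k] assms by simp
  finally show ?thesis by (simp add: fixes_rk_def)
qed

lemma fixes_outer: "g \<in> Aut \<Longrightarrow> fixes_rk g (-1)" "g \<in> Aut \<Longrightarrow> fixes_rk g 5"
  unfolding fixes_rk_def
  using at_ap[OF _ base, of g "-1"] at_ap[OF _ base, of g 5] at_least[OF _ base] at_greatest[OF _ base] ap_flag[OF _ base]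
  by auto

lemma fixes_all_but:
  assumes "g \<in> Aut" "i \<in> {0,1,2,3,4}" "\<And>k. k \<in> {0,1,2,3,4} - {i} \<Longrightarrow> fixes_rk g k"
  shows "g = 1"
proof (rule fixes_all_but_one[OF assms(1) base])
  show "0 \<le> i" "i < int 5" using assms(2) by auto
  fix k assume "k \<in> {-1..int 5}" "k \<noteq> i"
  then have "k = -1 \<or> k = 5 \<or> k \<in> {0,1,2,3,4} - {i}" by auto
  then show "app g (at \<Phi> k) = at \<Phi> k"
    using fixes_outer[OF assms(1)] assms(3) unfolding fixes_rk_def by blast
qed

lemma cyc_fixes:
  "a \<in> cyc x \<Longrightarrow> fixes_rk a 2" "a \<in> cyc x \<Longrightarrow> fixes_rk a 3" "a \<in> cyc x \<Longrightarrow> fixes_rk a 4"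
  "a \<in> cyc y \<Longrightarrow> fixes_rk a 0" "a \<in> cyc y \<Longrightarrow> fixes_rk a 3" "a \<in> cyc y \<Longrightarrow> fixes_rk a 4"
  "a \<in> cyc z \<Longrightarrow> fixes_rk a 0" "a \<in> cyc z \<Longrightarrow> fixes_rk a 1" "a \<in> cyc z \<Longrightarrow> fixes_rk a 4"
  "a \<in> cyc w \<Longrightarrow> fixes_rk a 0" "a \<in> cyc w \<Longrightarrow> fixes_rk a 1" "a \<in> cyc w \<Longrightarrow> fixes_rk a 2"
  unfolding cyc_def by (auto intro!: fixes_gpow fixes_rot)

lemma cyc_Aut: "g \<in> Aut \<Longrightarrow> cyc g \<subseteq> Aut"
  unfolding cyc_def using Aut_gpow by blast

lemma cyc_in_Aut: "a \<in> cyc x \<Longrightarrow> a \<in> Aut" "a \<in> cyc y \<Longrightarrow> a \<in> Aut" "a \<in> cyc z \<Longrightarrow> a \<in> Aut" "a \<in> cyc w \<Longrightarrow> a \<in> Aut"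
  using cyc_Aut[OF rot_Aut, of 0 1] cyc_Aut[OF rot_Aut, of 1 2] cyc_Aut[OF rot_Aut, of 2 3]
    cyc_Aut[OF rot_Aut, of 3 4] by auto

lemma cyc_trivial:
  "a \<in> cyc x \<Longrightarrow> fixes_rk a 0 \<Longrightarrow> a = 1"
  "a \<in> cyc y \<Longrightarrow> fixes_rk a 1 \<Longrightarrow> a = 1"
  "a \<in> cyc y \<Longrightarrow> fixes_rk a 2 \<Longrightarrow> a = 1"
  "a \<in> cyc z \<Longrightarrow> fixes_rk a 2 \<Longrightarrow> a = 1"
  "a \<in> cyc z \<Longrightarrow> fixes_rk a 3 \<Longrightarrow> a = 1"
  "a \<in> cyc w \<Longrightarrow> fixes_rk a 4 \<Longrightarrow> a = 1"
proof -
  show "a \<in> cyc x \<Longrightarrow> fixes_rk a 0 \<Longrightarrow> a = 1"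
    by (rule fixes_all_but[of a 1]) (auto intro: cyc_fixes cyc_in_Aut)
  show "a \<in> cyc y \<Longrightarrow> fixes_rk a 1 \<Longrightarrow> a = 1"
    by (rule fixes_all_but[of a 2]) (auto intro: cyc_fixes cyc_in_Aut)
  show "a \<in> cyc y \<Longrightarrow> fixes_rk a 2 \<Longrightarrow> a = 1"
    by (rule fixes_all_but[of a 1]) (auto intro: cyc_fixes cyc_in_Aut)
  show "a \<in> cyc z \<Longrightarrow> fixes_rk a 2 \<Longrightarrow> a = 1"
    by (rule fixes_all_but[of a 3]) (auto intro: cyc_fixes cyc_in_Aut)
  show "a \<in> cyc z \<Longrightarrow> fixes_rk a 3 \<Longrightarrow> a = 1"
    by (rule fixes_all_but[of a 2]) (auto intro: cyc_fixes cyc_in_Aut)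
  show "a \<in> cyc w \<Longrightarrow> fixes_rk a 4 \<Longrightarrow> a = 1"
    by (rule fixes_all_but[of a 3]) (auto intro: cyc_fixes cyc_in_Aut)
qed

text \<open>Factors are peeled off from the right: the base faces of ranks 4, 3, 2 are fixed by
  everything to the left of the powers of \<open>w\<close>, \<open>z\<close>, \<open>y\<close>
  respectively, and moved by each nontrivial such power.\<close>

lemma normal_form_unique:
  assumes "a \<in> cyc x" "b \<in> cyc y" "c \<in> cyc z" "d \<in> cyc w"
    and "a' \<in> cyc x" "b' \<in> cyc y" "c' \<in> cyc z" "d' \<in> cyc w"
    and eq: "a * b * c * d = a' * b' * c' * d'"
  shows "a = a' \<and> b = b' \<and> c = c' \<and> d = d'"
proof -
  have mem: "g * ginv h \<in> cyc s" "ginv g * h \<in> cyc s" if "g \<in> cyc s" "h \<in> cyc s" for g h s :: "'a bij"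
    using that by (auto simp: cyc_def simp flip: gpow_minus gpow_add)
  have quot: "g = h" if "g * ginv h = 1" for g h :: "'a bij"
    using that by (metis ginv_ginv ginv_unique)
  have d4: "fixes_rk (a' * b' * c') 4" "fixes_rk (a * b * c) 4"
    using assms(1-8) by (auto intro!: fixes_times intro: cyc_fixes)
  have "ginv (a' * b' * c') * (a * b * c * d) * ginv d = ginv (a' * b' * c') * (a' * b' * c' * d') * ginv d"
    by (simp only: eq)
  then have "ginv (a' * b' * c') * (a * b * c) = d' * ginv d" by (simp add: mult.assoc)
  then have "fixes_rk (d' * ginv d) 4" using fixes_times[OF fixes_ginv[OF d4(1)] d4(2)] by simp
  then have d: "d' = d" using quot cyc_trivial(6) mem assms by metis
  then have eq3: "a * b * c = a' * b' * c'" using eq by (simp only: group_cancel_right)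
  have c3: "fixes_rk (a' * b') 3" "fixes_rk (a * b) 3"
    using assms(1-8) by (auto intro!: fixes_times intro: cyc_fixes)
  have "ginv (a' * b') * (a * b * c) * ginv c = ginv (a' * b') * (a' * b' * c') * ginv c"
    by (simp only: eq3)
  then have "ginv (a' * b') * (a * b) = c' * ginv c" by (simp add: mult.assoc)
  then have "fixes_rk (c' * ginv c) 3" using fixes_times[OF fixes_ginv[OF c3(1)] c3(2)] by simp
  then have c: "c' = c" using quot cyc_trivial(5) mem assms by metis
  then have eq2: "a * b = a' * b'" using eq3 by (simp only: group_cancel_right)
  have b2: "fixes_rk a' 2" "fixes_rk a 2"
    using assms(1-8) by (auto intro!: fixes_times intro: cyc_fixes)
  have "ginv a' * (a * b) * ginv b = ginv a' * (a' * b') * ginv b"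
    by (simp only: eq2)
  then have "ginv a' * a = b' * ginv b" by (simp add: mult.assoc)
  then have "fixes_rk (b' * ginv b) 2" using fixes_times[OF fixes_ginv[OF b2(1)] b2(2)] by simp
  then have b: "b' = b" using quot cyc_trivial(3) mem assms by metis
  then have "a = a'" using eq2 by (simp only: group_cancel_right)
  then show ?thesis using b c d by simp
qed

text \<open>As the action is free, both orbits, represented by \<open>\<Phi>\<close> and
  \<open>adj 2 \<Phi>\<close>, are copies of \<open>Aut\<close>.\<close>

lemma finite_Aut: "finite Aut" and card_Aut: "card (flags F le) = 2 * card Aut"
proof -
  let ?f = "\<lambda>g. ap g \<Phi>" and ?h = "\<lambda>g. ap g (adj 2 \<Phi>)"
  have fin: "finite (flags F le)" using tight unfolding tight_def by blast
  have b2: "adj 2 \<Phi> \<in> flags F le" using base by simp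
  have inj: "inj_on ?f Aut" "inj_on ?h Aut"
    using ap_inj base b2 by (meson inj_onI)+
  have sub: "?f ` Aut \<subseteq> flags F le" "?h ` Aut \<subseteq> flags F le" using ap_flag base b2 by blast+
  then show fA: "finite Aut" using fin inj(1) by (metis finite_subset finite_imageD)
  have disj: "?f ` Aut \<inter> ?h ` Aut = {}"
  proof -
    have False if "g \<in> Aut" "h \<in> Aut" "ap g \<Phi> = ap h (adj 2 \<Phi>)" for g h
    proof -
      have "ap (ginv h * g) \<Phi> = adj 2 \<Phi>" using that(3) by (simp add: ap_times)
      then show False using not_ap_adj[of "ginv h * g" \<Phi> 2] Aut_times Aut_ginv that base by simp
    qed
    then show ?thesis by blast
  qed
  have "flags F le \<subseteq> ?f ` Aut \<union> ?h ` Aut"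
  proof
    fix D assume D: "D \<in> flags F le"
    show "D \<in> ?f ` Aut \<union> ?h ` Aut"
    proof (cases "flag_orbit F le D = flag_orbit F le (adj 2 \<Phi>)")
      case True
      then show ?thesis using orbit_eqD[OF b2 D] by blast
    next
      case False
      then show ?thesis using third_orbit[OF base D, of 2] by auto
    qed
  qed
  then have "flags F le = ?f ` Aut \<union> ?h ` Aut" using sub by blast
  then have "card (flags F le) = card (?f ` Aut) + card (?h ` Aut)"
    using card_Un_disjoint[OF _ _ disj] fA by simp
  then show "card (flags F le) = 2 * card Aut" by (simp add: card_image inj)
qed

text \<open>The flags of the polygon between the base faces of ranks \<open>i - 2\<close> and
  \<open>i + 1\<close> arise from \<open>\<Phi>\<close> by alternating two adjacencies, so each is a
  power of the rotation applied to \<open>\<Phi>\<close> or to \<open>adj (int i) \<Phi>\<close>.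
  These two share their face of rank \<open>i - 1\<close>, whose orbit thus contains every vertex of
  the polygon.\<close>

lemma order_ge:
  assumes i: "i \<in> {1..4::nat}"
  shows "ps ! (i - 1) \<le> card (cyc (rot (int i - 1) (int i)))"
proof -
  define s where "s = rot (int i - 1) (int i)"
  have s: "s \<in> Aut" "ap s \<Phi> = adj (int i) (adj (int i - 1) \<Phi>)"
    using rot_props[of "int i - 1" "int i"] i by (auto simp: s_def)
  have ri: "0 \<le> int i" "int i < int 5" "0 \<le> int i - 1" "int i - 1 < int 5" using i by auto
  have r: "int i - 2 \<in> ranks" "int i + 1 \<in> ranks" "int i - 1 \<in> ranks" using i by auto
  define p q where "p = at \<Phi> (int i - 2)" and "q = at \<Phi> (int i + 1)"
  define V where "V = {v\<in>F. le p v \<and> le v q \<and> rk v = int i - 1}"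
  have pq: "p \<in> F" "q \<in> F" "le p q" "rk p = int i - 2" "rk q = int i + 1"
    unfolding p_def q_def using at_F[OF base] at_le[OF base r(1,2)] rk_at[OF base] r by auto
  have eq: "equivelar F le 5 ps" using tight unfolding tight_def by blast
  have "\<forall>j\<in>{1..5 - 1}. \<forall>a\<in>F. \<forall>b\<in>F. le a b \<and> rk a = int j - 2 \<and> rk b = int j + 1 \<longrightarrow>
        card {v\<in>F. le a v \<and> le v b \<and> rk v = int j - 1} = ps ! (j - 1)"
    using eq unfolding equivelar_def by blast
  moreover have "i \<in> {1..5 - 1}" using i by simp
  ultimately have cV: "card V = ps ! (i - 1)" unfolding V_def using pq by blast
  have sinv: "ap (s \<up> k) (adj (int i - 1) \<Phi>) = ap (s \<up> (k + 1)) (adj (int i) \<Phi>)" for k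
  proof -
    have "ap s (adj (int i) \<Phi>) = adj (int i - 1) \<Phi>"
      using ap_adj[OF s(1) base ri(1,2)] s(2) adj_adj[OF adj_flag[OF base ri(3,4)] ri(1,2)] by simp
    then show ?thesis by (simp add: gpow_add ap_times)
  qed
  have step: "(\<exists>k. D = ap (s \<up> k) \<Phi>) \<or> (\<exists>k. D = ap (s \<up> k) (adj (int i) \<Phi>))"
    if "conn {int i - 2<..<int i + 1} \<Phi> D" for D
    using that unfolding conn_def
  proof (induction rule: rtranclp_induct)
    case base
    have "\<Phi> = ap (s \<up> 0) \<Phi>" by simp
    then show ?case by blast
  next
    case (step C D)
    have A: "s \<up> k \<in> Aut" for k by (rule Aut_gpow[OF s(1)])
    obtain m where "m \<in> {int i - 2<..<int i + 1}" and D: "D = adj m C" using step(2) by blast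
    then have "m = int i \<or> m = int i - 1" by auto
    then consider "D = adj (int i) C" | "D = adj (int i - 1) C" using D by blast
    then show ?case
    proof cases
      case 1
      show ?thesis using step(3)
      proof (elim disjE exE)
        fix k assume "C = ap (s \<up> k) \<Phi>"
        then show ?thesis using 1 ap_adj[OF A base ri(1,2)] by metis
      next
        fix k assume "C = ap (s \<up> k) (adj (int i) \<Phi>)"
        then show ?thesis using 1 ap_adj[OF A adj_flag[OF base ri(1,2)] ri(1,2)] adj_adj[OF base ri(1,2)] by metis
      qed
    next
      case 2
      show ?thesis using step(3)
      proof (elim disjE exE)
        fix k assume "C = ap (s \<up> k) \<Phi>"
        then have "D = ap (s \<up> (k + 1)) (adj (int i) \<Phi>)" using 2 ap_adj[OF A base ri(3,4)] sinv by metis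
        then show ?thesis by blast
      next
        fix k assume C: "C = ap (s \<up> k) (adj (int i) \<Phi>)"
        have "ap (s \<up> k) (adj (int i) \<Phi>) = ap (s \<up> (k - 1)) (adj (int i - 1) \<Phi>)" using sinv[of "k - 1"] by simp
        then have "D = ap (s \<up> (k - 1)) \<Phi>"
          using 2 C ap_adj[OF A adj_flag[OF base ri(3,4)] ri(3,4)] adj_adj[OF base ri(3,4)] by metis
        then show ?thesis by blast
      qed
    qed
  qed
  have sub: "V \<subseteq> (\<lambda>g. app g (at \<Phi> (int i - 1))) ` cyc s"
  proof
    fix v assume "v \<in> V"
    then have v: "v \<in> F" "le p v" "le v q" "rk v = int i - 1" unfolding V_def by auto
    define J where "J = {k \<in> ranks. k \<le> int i - 2 \<or> int i + 1 \<le> k} \<union> {int i - 1}"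
    define f where "f k = (if k = int i - 1 then v else at \<Phi> k)" for k
    have lo: "le (at \<Phi> k) v" if "k \<in> ranks" "k \<le> int i - 2" for k
      using le_trans[OF at_F[OF base that(1)] pq(1) v(1) _ v(2)] at_le[OF base that(1) r(1) that(2)] p_def by simp
    have hi: "le v (at \<Phi> k)" if "k \<in> ranks" "int i + 1 \<le> k" for k
      using le_trans[OF v(1) pq(2) at_F[OF base that(1)] v(3)] at_le[OF base r(2) that] q_def by simp
    obtain D where D: "D \<in> flags F le" "\<And>k. k \<in> J \<Longrightarrow> at D k = f k"
    proof (rule flag_with[of J f])
      show "f k \<in> F \<and> rk (f k) = k" if "k \<in> J" for k
        using that v at_F[OF base] rk_at[OF base] by (auto simp: f_def J_def)
      show "le (f j) (f k)" if "j \<in> J" "k \<in> J" "j \<le> k" for j k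
        using that lo hi at_le[OF base] le_refl[OF v(1)] unfolding f_def J_def by auto
    qed blast
    have "agree (int i - 2) (int i + 1) \<Phi> D"
      unfolding agree_def using base D by (auto simp: J_def f_def)
    then have "conn {int i - 2<..<int i + 1} \<Phi> D" using i by (intro agree_conn) auto
    then have cases: "(\<exists>k. D = ap (s \<up> k) \<Phi>) \<or> (\<exists>k. D = ap (s \<up> k) (adj (int i) \<Phi>))" by (rule step)
    have v_at: "at D (int i - 1) = v" using D(2) by (simp add: J_def f_def)
    have adj_at: "at (adj (int i) \<Phi>) (int i - 1) = at \<Phi> (int i - 1)" using at_adj[OF base ri(1,2) r(3)] by simp
    have "\<exists>k. v = app (s \<up> k) (at \<Phi> (int i - 1))"
      using cases
    proof (elim disjE exE)
      fix k assume "D = ap (s \<up> k) \<Phi>"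
      then show ?thesis using v_at at_ap[OF Aut_gpow[OF s(1)] base r(3)] by auto
    next
      fix k assume "D = ap (s \<up> k) (adj (int i) \<Phi>)"
      then show ?thesis
        using v_at at_ap[OF Aut_gpow[OF s(1)] adj_flag[OF base ri(1,2)] r(3)] adj_at by auto
    qed
    then obtain k where "v = app (s \<up> k) (at \<Phi> (int i - 1))" by blast
    then show "v \<in> (\<lambda>g. app g (at \<Phi> (int i - 1))) ` cyc s"
      using cyc_gpow[of s k] by (rule image_eqI)
  qed
  have fin: "finite (cyc s)" by (rule finite_subset[OF cyc_Aut[OF s(1)] finite_Aut])
  show ?thesis using surj_card_le[OF fin sub] unfolding cV s_def .
qed

text \<open>The products are distinct and, by \<open>order_ge\<close>, at least
  \<open>prod_list ps\<close> in number, while tightness makes this number the size of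
  \<open>Aut\<close>. Here tightness becomes a factorization of the group.\<close>

lemma Aut_product:
  assumes "g \<in> Aut"
  obtains a b c d where "a \<in> cyc x" "b \<in> cyc y" "c \<in> cyc z" "d \<in> cyc w" "g = a * b * c * d"
proof -
  let ?D = "cyc x \<times> cyc y \<times> cyc z \<times> cyc w"
  let ?f = "\<lambda>(a, b, c, d). a * b * c * d"
  have "inj_on ?f ?D"
  proof (rule inj_onI)
    fix p q assume "p \<in> ?D" "q \<in> ?D" and eq: "?f p = ?f q"
    then obtain a b c d a' b' c' d' where pq: "p = (a, b, c, d)" "q = (a', b', c', d')"
      and mem: "a \<in> cyc x" "b \<in> cyc y" "c \<in> cyc z" "d \<in> cyc w"
        "a' \<in> cyc x" "b' \<in> cyc y" "c' \<in> cyc z" "d' \<in> cyc w" by blast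
    from eq have "a * b * c * d = a' * b' * c' * d'" by (simp add: pq)
    from normal_form_unique[OF mem this] show "p = q" by (simp add: pq)
  qed
  then have "card (?f ` ?D) = card ?D" by (rule card_image)
  also have "\<dots> = card (cyc x) * card (cyc y) * card (cyc z) * card (cyc w)"
    by (simp add: card_cartesian_product mult.assoc)
  also have "\<dots> \<ge> ps ! 0 * ps ! 1 * ps ! 2 * ps ! 3"
    using order_ge[of 1] order_ge[of 2] order_ge[of 3] order_ge[of 4] by (intro mult_le_mono) simp_all
  also have "ps ! 0 * ps ! 1 * ps ! 2 * ps ! 3 = prod_list ps"
  proof -
    have "length ps = 4" using tight unfolding tight_def equivelar_def by simp
    then obtain p q r s where "ps = [p, q, r, s]" by (auto simp: length_Suc_conv numeral_eq_Suc)
    then show ?thesis by simp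
  qed
  also have "prod_list ps = card Aut" using card_Aut tight unfolding tight_def by simp
  finally have "card Aut \<le> card (?f ` ?D)" .
  moreover have sub: "?f ` ?D \<subseteq> Aut" using cyc_in_Aut Aut_times by auto
  ultimately have "?f ` ?D = Aut" using card_seteq[OF finite_Aut sub] by blast
  then have "g \<in> ?f ` ?D" using assms by (simp only:)
  then obtain p where p: "g = ?f p" "p \<in> ?D" by (rule imageE)
  then obtain a b c d where "p = (a, b, c, d)" "a \<in> cyc x" "b \<in> cyc y" "c \<in> cyc z" "d \<in> cyc w"
    by blast
  then show ?thesis using that p(1) by simp
qed

lemma fixes_right: "fixes_rk h k \<Longrightarrow> fixes_rk (g * h) k \<Longrightarrow> fixes_rk g k"
  using fixes_times[of "g * h" k "ginv h"] fixes_ginv[of h k] by (simp add: mult.assoc)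

text \<open>Supplies \<open>closed\<close> for the pair \<open>x, y\<close>: products of their
  powers in either order fix the base faces of ranks 3 and 4, and those faces eliminate
  \<open>z\<close> and \<open>w\<close> from the normal form.\<close>

lemma stabilizer_34:
  assumes "g \<in> Aut" "fixes_rk g 3" "fixes_rk g 4"
  obtains a b where "a \<in> cyc x" "b \<in> cyc y" "g = a * b"
proof -
  obtain a b c d where abcd: "a \<in> cyc x" "b \<in> cyc y" "c \<in> cyc z" "d \<in> cyc w" and g: "g = a * b * c * d"
    by (rule Aut_product[OF assms(1)])
  have "fixes_rk (a * b * c) 4" using abcd by (auto intro!: fixes_times intro: cyc_fixes)
  then have "d = 1" using fixes_cancel assms(3) cyc_trivial(6)[OF abcd(4)] unfolding g by blast
  moreover have "fixes_rk (a * b) 3" using abcd by (auto intro!: fixes_times intro: cyc_fixes)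
  ultimately have "c = 1" using fixes_cancel[of "a * b" 3 c] assms(2) cyc_trivial(5)[OF abcd(3)] unfolding g by simp
  then show ?thesis using that abcd g \<open>d = 1\<close> by simp
qed

lemma stabilizer_04:
  assumes "g \<in> Aut" "fixes_rk g 0" "fixes_rk g 4"
  obtains b c where "b \<in> cyc y" "c \<in> cyc z" "g = b * c"
proof -
  obtain a b c d where abcd: "a \<in> cyc x" "b \<in> cyc y" "c \<in> cyc z" "d \<in> cyc w" and g: "g = a * b * c * d"
    by (rule Aut_product[OF assms(1)])
  have "fixes_rk (a * b * c) 4" using abcd by (auto intro!: fixes_times intro: cyc_fixes)
  then have "d = 1" using fixes_cancel assms(3) cyc_trivial(6)[OF abcd(4)] unfolding g by blast
  moreover have "fixes_rk (b * c) 0" using abcd by (auto intro!: fixes_times intro: cyc_fixes)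
  ultimately have "a = 1"
    using fixes_right[of "b * c" 0 a] assms(2) cyc_trivial(1)[OF abcd(1)] unfolding g by (simp add: mult.assoc)
  then show ?thesis using that abcd g \<open>d = 1\<close> by simp
qed

lemma stabilizer_01:
  assumes "g \<in> Aut" "fixes_rk g 0" "fixes_rk g 1"
  obtains c d where "c \<in> cyc z" "d \<in> cyc w" "g = c * d"
proof -
  obtain a b c d where abcd: "a \<in> cyc x" "b \<in> cyc y" "c \<in> cyc z" "d \<in> cyc w" and g: "g = a * b * c * d"
    by (rule Aut_product[OF assms(1)])
  have "fixes_rk (b * c * d) 0" using abcd by (auto intro!: fixes_times intro: cyc_fixes)
  then have "a = 1"
    using fixes_right[of "b * c * d" 0 a] assms(2) cyc_trivial(1)[OF abcd(1)] unfolding g by (simp add: mult.assoc)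
  moreover have "fixes_rk (c * d) 1" using abcd by (auto intro!: fixes_times intro: cyc_fixes)
  ultimately have "b = 1"
    using fixes_right[of "c * d" 1 b] assms(3) cyc_trivial(2)[OF abcd(2)] unfolding g by (simp add: mult.assoc)
  then show ?thesis using that abcd g \<open>a = 1\<close> by (simp add: mult.assoc)
qed

lemma cyc_gpow_Aut: "x \<up> i \<in> Aut" "y \<up> i \<in> Aut" "z \<up> i \<in> Aut" "w \<up> i \<in> Aut"
  by (rule cyc_in_Aut, rule cyc_gpow)+

lemma rot_pair_xy: "rot_pair x y"
proof
  show "x * y * x * y = 1" by (rule word_relations)
  show "\<exists>k l. y \<up> i * x \<up> j = x \<up> k * y \<up> l" for i j
  proof -
    have "fixes_rk (y \<up> i * x \<up> j) 3" "fixes_rk (y \<up> i * x \<up> j) 4"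
      by (auto intro!: fixes_times intro: cyc_fixes cyc_gpow)
    then obtain a b where "a \<in> cyc x" "b \<in> cyc y" "y \<up> i * x \<up> j = a * b"
      using stabilizer_34[OF Aut_times[OF cyc_gpow_Aut(2) cyc_gpow_Aut(1)]] by blast
    then show ?thesis unfolding cyc_def by blast
  qed
  show "x \<up> i = 1" if "x \<up> i = y \<up> j" for i j
    using cyc_trivial(1)[OF cyc_gpow] cyc_fixes(4)[OF cyc_gpow] that by metis
qed

lemma rot_pair_yz: "rot_pair y z"
proof
  show "y * z * y * z = 1" by (rule word_relations)
  show "\<exists>k l. z \<up> i * y \<up> j = y \<up> k * z \<up> l" for i j
  proof -
    have "fixes_rk (z \<up> i * y \<up> j) 0" "fixes_rk (z \<up> i * y \<up> j) 4"
      by (auto intro!: fixes_times intro: cyc_fixes cyc_gpow)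
    then obtain a b where "a \<in> cyc y" "b \<in> cyc z" "z \<up> i * y \<up> j = a * b"
      using stabilizer_04[OF Aut_times[OF cyc_gpow_Aut(3) cyc_gpow_Aut(2)]] by blast
    then show ?thesis unfolding cyc_def by blast
  qed
  show "y \<up> i = 1" if "y \<up> i = z \<up> j" for i j
    using cyc_trivial(2)[OF cyc_gpow] cyc_fixes(8)[OF cyc_gpow] that by metis
qed

lemma rot_pair_zw: "rot_pair z w"
proof
  show "z * w * z * w = 1" by (rule word_relations)
  show "\<exists>k l. w \<up> i * z \<up> j = z \<up> k * w \<up> l" for i j
  proof -
    have "fixes_rk (w \<up> i * z \<up> j) 0" "fixes_rk (w \<up> i * z \<up> j) 1"
      by (auto intro!: fixes_times intro: cyc_fixes cyc_gpow)
    then obtain a b where "a \<in> cyc z" "b \<in> cyc w" "w \<up> i * z \<up> j = a * b"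
      using stabilizer_01[OF Aut_times[OF cyc_gpow_Aut(4) cyc_gpow_Aut(3)]] by blast
    then show ?thesis unfolding cyc_def by blast
  qed
  show "z \<up> i = 1" if "z \<up> i = w \<up> j" for i j
    using cyc_trivial(4)[OF cyc_gpow] cyc_fixes(12)[OF cyc_gpow] that by metis
qed

lemma rot_quad_Aut: "rot_quad x y z w (rot 1 4) (rot 0 3)"
proof (rule rot_quad.intro)
  show "x \<up> i = 1 \<and> y \<up> j = 1 \<and> z \<up> k = 1 \<and> w \<up> l = 1"
    if "x \<up> i * y \<up> j * z \<up> k * w \<up> l = 1" for i j k l
    using normal_form_unique[OF cyc_gpow cyc_gpow cyc_gpow cyc_gpow cyc_one cyc_one cyc_one cyc_one] that by simp
  show "\<exists>n::nat. 0 < n \<and> y ^ n = 1" "\<exists>n::nat. 0 < n \<and> z ^ n = 1"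
    by (rule finite_cyc_order, rule finite_subset[OF cyc_Aut finite_Aut], simp add: rot_Aut)+
qed (fact rot_pair_xy rot_pair_yz rot_pair_zw word_relations word_conjugations)+

end

section \<open>The reflection\<close>

context tight_chiral
begin

sublocale rot_quad x y z w "rot 1 4" "rot 0 3"
  by (rule rot_quad_Aut)

text \<open>With the generators \<open>Y, Z, S, T\<close>, exchanging coordinates inverts the first
  two and fixes the last two; so \<open>R\<close> is visibly symmetric and the reflection an
  involution.\<close>

definition R :: "('a bij \<times> 'a bij) set" where "R = gen {Y, Z, S, T}"

lemma R_Aut: "p \<in> R \<Longrightarrow> fst p \<in> Aut \<and> snd p \<in> Aut"
  unfolding R_def
proof (induction rule: gen.induct)
  case gen_one
  then show ?case by (simp add: one_prod_def Aut_one)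
next
  case (gen_mult s a)
  then show ?case by (cases a) (auto simp: rot_Aut intro!: Aut_times Aut_ginv)
next
  case (gen_inv s a)
  then show ?case by (cases a) (auto simp: rot_Aut intro!: Aut_times Aut_ginv)
qed

lemma R_swap: "(a, b) \<in> R \<Longrightarrow> (b, a) \<in> R"
proof -
  have "prod.swap p \<in> R" if "p \<in> R" for p
    using that unfolding R_def
  proof (induction rule: gen.induct)
    case gen_one
    have "prod.swap 1 = (1 :: 'a bij \<times> 'a bij)" by (simp add: one_prod_def)
    then show ?case using gen.gen_one by (simp only:)
  next
    have g: "prod.swap s \<in> gen {Y, Z, S, T} \<and> prod.swap (ginv s) \<in> gen {Y, Z, S, T}" if "s \<in> {Y, Z, S, T}" for s
    proof -
      have "prod.swap s = ginv s \<or> prod.swap s = s" using that by auto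
      moreover have "prod.swap (ginv s) = ginv (prod.swap s)" by (cases s) simp
      ultimately show ?thesis using gen_incl[OF that] gen_ginv[OF gen_incl[OF that]] by auto
    qed
    have m: "prod.swap (s * a) = prod.swap s * prod.swap a" for s a :: "'a bij \<times> 'a bij"
      by (cases s; cases a) simp
    {
      case (gen_mult s a)
      then show ?case unfolding m using g gen_times by blast
    next
      case (gen_inv s a)
      then show ?case unfolding m using g gen_times by blast
    }
  qed
  then show "(a, b) \<in> R \<Longrightarrow> (b, a) \<in> R" by force
qed

lemma R_times: "(a, b) \<in> R \<Longrightarrow> (c, d) \<in> R \<Longrightarrow> (a * c, b * d) \<in> R"
  unfolding R_def using gen_times[of "(a, b)" _ "(c, d)"] by simp

lemma R_fun:
  assumes "(a, b) \<in> R" "(a, c) \<in> R"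
  shows "b = c"
proof -
  have "ginv (a, b) * (a, c) \<in> gen {Y, Z, S, T}"
    using assms unfolding R_def by (intro gen_times gen_ginv)
  then have "(1, ginv b * c) \<in> gen {Y, Z, S, T}" by simp
  then have "ginv b * c = 1" by (rule reflection_well_defined)
  then show ?thesis by (metis ginv_right_assoc mult_1_right)
qed

text \<open>If \<open>\<rho>\<^sub>2\<close> existed and conjugated \<open>a\<close> to
  \<open>b\<close>, it would send \<open>ap a \<Phi>\<close> to \<open>ap b (adj 2 \<Phi>)\<close>
  and \<open>ap a (adj 2 \<Phi>)\<close> to \<open>ap b \<Phi>\<close>. A relation allows this to be
  stated before single-valuedness is proved.\<close>

definition reflected :: "'a set \<Rightarrow> 'a set \<Rightarrow> bool"
  where "reflected C D \<longleftrightarrow> (\<exists>a b. (a, b) \<in> R \<and>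
    (C = ap a \<Phi> \<and> D = ap b (adj 2 \<Phi>) \<or> C = ap a (adj 2 \<Phi>) \<and> D = ap b \<Phi>))"

lemma base2: "adj 2 \<Phi> \<in> flags F le"
  using base by simp

text \<open>\<open>h\<close> stands for \<open>\<rho>\<^sub>i\<rho>\<^sub>2\<close>, which leads
  from \<open>adj 2 \<Phi>\<close> to \<open>adj i \<Phi>\<close>, and \<open>h'\<close> for its
  conjugate \<open>\<rho>\<^sub>2\<rho>\<^sub>i\<close>.\<close>

lemma adj_reflected_gen:
  assumes "0 \<le> i" "i < 5"
  shows "\<exists>h h'. (h, h') \<in> R \<and> adj i \<Phi> = ap h (adj 2 \<Phi>) \<and> adj i (adj 2 \<Phi>) = ap h' \<Phi>"
proof -
  have inv: "ap (ginv g) C = D" if "ap g D = C" for g and C D :: "'a set" using that by auto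
  have mem: "Y \<in> R" "ginv Z \<in> R" "S \<in> R" "T \<in> R" "1 \<in> R"
    unfolding R_def by (auto intro: gen_incl gen_one intro!: gen_ginv simp del: Pair_ginv)
  consider "i = 0" | "i = 1" | "i = 2" | "i = 3" | "i = 4" using assms by linarith
  then show ?thesis
  proof cases
    case 1
    have "adj 0 \<Phi> = ap (x * y) (adj 2 \<Phi>)" "adj 0 (adj 2 \<Phi>) = ap (x * y) \<Phi>"
      by (simp_all add: word_simps)
    then show ?thesis using mem(3) 1 by blast
  next
    case 2
    have "adj 1 \<Phi> = ap y (adj 2 \<Phi>)" by (simp add: word_simps)
    moreover have "ap (ginv y) \<Phi> = adj 1 (adj 2 \<Phi>)"
      by (rule inv) (simp add: word_simps)
    ultimately show ?thesis using mem(1) 2 by metis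
  next
    case 3
    have "(1, 1) \<in> R" using mem(5) by (simp add: one_prod_def)
    moreover have "adj 2 \<Phi> = ap 1 (adj 2 \<Phi>)" "adj 2 (adj 2 \<Phi>) = ap 1 \<Phi>" by (simp_all add: word_simps)
    ultimately show ?thesis using 3 by blast
  next
    case 4
    have "ap (ginv z) (adj 2 \<Phi>) = adj 3 \<Phi>"
      by (rule inv) (simp add: word_simps)
    moreover have "adj 3 (adj 2 \<Phi>) = ap z \<Phi>" by (simp add: word_simps)
    moreover have "(ginv z, z) \<in> R" using mem(2) by simp
    ultimately show ?thesis using 4 by metis
  next
    case 5
    have "adj 4 \<Phi> = ap (z * w) (adj 2 \<Phi>)" "adj 4 (adj 2 \<Phi>) = ap (z * w) \<Phi>"
      by (simp_all add: word_simps)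
    then show ?thesis using mem(4) 5 by blast
  qed
qed

lemma reflected_flags: "reflected C D \<Longrightarrow> C \<in> flags F le \<and> D \<in> flags F le"
  unfolding reflected_def using R_Aut ap_flag base base2 by fastforce

lemma reflected_sym: "reflected C D \<Longrightarrow> reflected D C"
  unfolding reflected_def using R_swap by blast

lemma reflected_adj:
  assumes r: "reflected C D" and i: "0 \<le> i" "i < 5"
  shows "reflected (adj i C) (adj i D)"
proof -
  obtain a b where ab: "(a, b) \<in> R" and
    c: "C = ap a \<Phi> \<and> D = ap b (adj 2 \<Phi>) \<or> C = ap a (adj 2 \<Phi>) \<and> D = ap b \<Phi>"
    using r unfolding reflected_def by blast
  obtain h h' where h: "(h, h') \<in> R" "adj i \<Phi> = ap h (adj 2 \<Phi>)" "adj i (adj 2 \<Phi>) = ap h' \<Phi>"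
    using adj_reflected_gen[OF i] by blast
  have A: "a \<in> Aut" "b \<in> Aut" using R_Aut[OF ab] by simp_all
  have p: "ap g (adj i \<Phi>) = adj i (ap g \<Phi>)" "ap g (adj i (adj 2 \<Phi>)) = adj i (ap g (adj 2 \<Phi>))" if "g \<in> Aut" for g
    using ap_adj5[OF that base i] ap_adj5[OF that base2 i] by simp_all
  from c show ?thesis
  proof
    assume "C = ap a \<Phi> \<and> D = ap b (adj 2 \<Phi>)"
    then have "adj i C = ap (a * h) (adj 2 \<Phi>)" "adj i D = ap (b * h') \<Phi>"
      using p[OF A(1)] p[OF A(2)] h by (simp_all add: ap_times)
    then show ?thesis unfolding reflected_def using R_times[OF ab h(1)] by blast
  next
    assume "C = ap a (adj 2 \<Phi>) \<and> D = ap b \<Phi>"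
    then have "adj i C = ap (a * h') \<Phi>" "adj i D = ap (b * h) (adj 2 \<Phi>)"
      using p[OF A(1)] p[OF A(2)] h by (simp_all add: ap_times)
    then show ?thesis unfolding reflected_def using R_times[OF ab R_swap[OF h(1)]] by blast
  qed
qed

lemma reflected_base: "reflected \<Phi> (adj 2 \<Phi>)"
proof -
  have "(1, 1) \<in> R" unfolding R_def by (metis gen_one one_prod_def)
  moreover have "\<Phi> = ap 1 \<Phi>" "adj 2 \<Phi> = ap 1 (adj 2 \<Phi>)" by simp_all
  ultimately show ?thesis unfolding reflected_def by blast
qed

lemma reflected_total:
  assumes "C \<in> flags F le"
  shows "\<exists>D. reflected C D"
proof -
  have "conn {0..<int 5} \<Phi> C" by (rule flags_conn[OF base assms])
  then show ?thesis unfolding conn_def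
  proof (induction rule: rtranclp_induct)
    case base
    show ?case using reflected_base by blast
  next
    case (step C D)
    then show ?case using reflected_adj by fastforce
  qed
qed

lemma reflected_fun:
  assumes "reflected C D" "reflected C E"
  shows "D = E"
proof -
  \<comment> \<open>The two alternatives in \<open>reflected\<close> concern different flag orbits,
    so they never apply to the same flag.\<close>
  have mixed: "ap a \<Phi> \<noteq> ap c (adj 2 \<Phi>)" if "a \<in> Aut" "c \<in> Aut" for a c
  proof
    assume "ap a \<Phi> = ap c (adj 2 \<Phi>)"
    then have "ap (ginv c * a) \<Phi> = adj 2 \<Phi>" by (simp add: ap_times)
    then show False using not_ap_adj[of "ginv c * a" \<Phi> 2] Aut_times[OF Aut_ginv] that base by simp
  qed
  obtain a b where ab: "(a, b) \<in> R" and
    c1: "C = ap a \<Phi> \<and> D = ap b (adj 2 \<Phi>) \<or> C = ap a (adj 2 \<Phi>) \<and> D = ap b \<Phi>"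
    using assms(1) unfolding reflected_def by blast
  obtain c d where cd: "(c, d) \<in> R" and
    c2: "C = ap c \<Phi> \<and> E = ap d (adj 2 \<Phi>) \<or> C = ap c (adj 2 \<Phi>) \<and> E = ap d \<Phi>"
    using assms(2) unfolding reflected_def by blast
  have A: "a \<in> Aut" "c \<in> Aut" using R_Aut[OF ab] R_Aut[OF cd] by simp_all
  from c1 show ?thesis
  proof
    assume 1: "C = ap a \<Phi> \<and> D = ap b (adj 2 \<Phi>)"
    with c2 mixed[OF A] have 2: "C = ap c \<Phi> \<and> E = ap d (adj 2 \<Phi>)" by blast
    with 1 have "a = c" using ap_inj[OF A base] by blast
    then show ?thesis using 1 2 R_fun ab cd by blast
  next
    assume 1: "C = ap a (adj 2 \<Phi>) \<and> D = ap b \<Phi>"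
    with c2 mixed[OF A(2,1)] have 2: "C = ap c (adj 2 \<Phi>) \<and> E = ap d \<Phi>" by metis
    with 1 have "a = c" using ap_inj[OF A base2] by blast
    then show ?thesis using 1 2 R_fun ab cd by blast
  qed
qed

definition mirror :: "'a set \<Rightarrow> 'a set" where "mirror C = (THE D. reflected C D)"

lemma mirror_eq: "reflected C D \<Longrightarrow> mirror C = D"
  unfolding mirror_def by (rule the_equality) (simp_all only: reflected_fun[of C _ D])

lemma mirror_reflected: "C \<in> flags F le \<Longrightarrow> reflected C (mirror C)"
proof -
  assume "C \<in> flags F le"
  then obtain D where "reflected C D" using reflected_total by blast
  then show ?thesis using mirror_eq by simp
qed

lemma mirror_flag: "C \<in> flags F le \<Longrightarrow> mirror C \<in> flags F le"
  using mirror_reflected reflected_flags by blast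

lemma mirror_mirror: "C \<in> flags F le \<Longrightarrow> mirror (mirror C) = C"
  using mirror_eq reflected_sym mirror_reflected by blast

lemma mirror_adj: "C \<in> flags F le \<Longrightarrow> 0 \<le> i \<Longrightarrow> i < 5 \<Longrightarrow> mirror (adj i C) = adj i (mirror C)"
  using mirror_eq reflected_adj mirror_reflected by blast

lemma mirror_conn:
  assumes "conn J C D" "J \<subseteq> {0..<5}" "i \<notin> J" "i \<in> ranks" "C \<in> flags F le"
  shows "D \<in> flags F le \<and> at (mirror D) i = at (mirror C) i"
  using assms(1) unfolding conn_def
proof (induction rule: rtranclp_induct)
  case base
  then show ?case using assms by simp
next
  case (step D E)
  then obtain j where j: "j \<in> J" "E = adj j D" by blast
  then have j5: "0 \<le> j" "j < 5" "j \<noteq> i" using assms(2,3) by auto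
  have "at (adj j (mirror D)) i = at (mirror D) i"
    using at_adj[of "mirror D" j i] mirror_flag step(3) j5 assms(4) by simp
  then show ?case using step(3) mirror_adj j j5 by simp
qed

lemma mirror_at:
  assumes C: "C \<in> flags F le" and D: "D \<in> flags F le" and i: "i \<in> ranks" and eq: "at C i = at D i"
  shows "at (mirror C) i = at (mirror D) i"
proof -
  consider "i = -1" | "i = int 5" | "0 \<le> i" "i < int 5" using i by force
  then show ?thesis
  proof cases
    case 1
    then show ?thesis using at_least mirror_flag C D by blast
  next
    case 2
    then show ?thesis using at_greatest mirror_flag C D by blast
  next
    case 3
    then have "conn ({0..<int 5} - {i}) C D" using flags_conn_fixed_rank[OF C D 3 eq] by blast
    then show ?thesis using mirror_conn[of _ C D i] i C by auto
  qed
qed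

section \<open>The induced reflection on faces\<close>

definition reflection :: "'a \<Rightarrow> 'a"
  where "reflection v = at (mirror (SOME C. C \<in> flags F le \<and> v \<in> C)) (rk v)"

lemma reflection_at:
  assumes C: "C \<in> flags F le" and v: "v \<in> C"
  shows "reflection v = at (mirror C) (rk v)"
proof -
  let ?D = "SOME C. C \<in> flags F le \<and> v \<in> C"
  have D: "?D \<in> flags F le" "v \<in> ?D" using someI[of "\<lambda>C. C \<in> flags F le \<and> v \<in> C" C] assms by auto
  show ?thesis unfolding reflection_def
    by (rule mirror_at[OF D(1) C rk_in_ranks[OF assms]]) (simp add: at_eq D assms)
qed

lemma reflection_mem:
  assumes C: "C \<in> flags F le" and v: "v \<in> C"
  shows "reflection v \<in> mirror C" "rk (reflection v) = rk v"
  using reflection_at[OF assms] at_in[OF mirror_flag[OF C] rk_in_ranks[OF assms]]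
    rk_at[OF mirror_flag[OF C] rk_in_ranks[OF assms]] by simp_all

lemma reflection_F: "v \<in> F \<Longrightarrow> reflection v \<in> F"
  using in_flag reflection_mem(1) mirror_flag flag_sub by blast

lemma reflection_reflection:
  assumes "v \<in> F"
  shows "reflection (reflection v) = v"
proof -
  obtain C where C: "C \<in> flags F le" "v \<in> C" using in_flag assms by blast
  have "reflection (reflection v) = at (mirror (mirror C)) (rk (reflection v))"
    by (rule reflection_at[OF mirror_flag[OF C(1)] reflection_mem(1)[OF C]])
  then show ?thesis using mirror_mirror[OF C(1)] reflection_mem(2)[OF C] at_eq[OF C] by simp
qed

lemma reflection_le:
  assumes "u \<in> F" "v \<in> F" "le u v"
  shows "le (reflection u) (reflection v)"
proof -
  obtain C where C: "C \<in> flags F le" "{u, v} \<subseteq> C"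
    using extend_flag[of "{u, v}"] assms le_refl by blast
  then have "reflection u = at (mirror C) (rk u)" "reflection v = at (mirror C) (rk v)"
    using reflection_at by auto
  then show ?thesis
    using at_le[OF mirror_flag[OF C(1)]] rk_range rk_le assms by simp
qed

lemma reflection_automorphism: "is_automorphism F le reflection"
  unfolding is_automorphism_def
proof (intro conjI ballI iffI)
  show "bij_betw reflection F F"
    by (rule bij_betw_byWitness[where f' = reflection])
      (use reflection_F reflection_reflection in auto)
  show "le (reflection u) (reflection v)" if "u \<in> F" "v \<in> F" "le u v" for u v
    by (rule reflection_le[OF that])
  show "le u v" if "u \<in> F" "v \<in> F" "le (reflection u) (reflection v)" for u v
    using reflection_le[OF reflection_F reflection_F that(3)] that reflection_reflection by simp
qed

lemma contradiction: False
proof -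
  obtain g where g: "g \<in> Aut" "\<And>v. v \<in> F \<Longrightarrow> app g v = reflection v"
    using automorphism_Aut[OF reflection_automorphism] by blast
  have "at (ap g \<Phi>) i = at (adj 2 \<Phi>) i" if "i \<in> ranks" for i
    using at_ap[OF g(1) base that] g(2)[OF at_F[OF base that]]
      reflection_at[OF base at_in[OF base that]] rk_at[OF base that] mirror_eq[OF reflected_base] by simp
  then have "ap g \<Phi> = adj 2 \<Phi>" by (rule flag_eqI[OF ap_flag[OF g(1) base] base2])
  then show False using not_ap_adj[OF g(1) base, of 2] by simp
qed

end

theorem theorem1p1:
  fixes F :: "'a set" and le :: "'a \<Rightarrow> 'a \<Rightarrow> bool" and ps :: "nat list"
  shows "\<not> (abstract_polytope F le 5 \<and> equivelar F le 5 ps \<and> chiral F le \<and> tight F le 5 ps)"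
proof
  assume a: "abstract_polytope F le 5 \<and> equivelar F le 5 ps \<and> chiral F le \<and> tight F le 5 ps"
  then interpret chiral_polytope F le 5 by unfold_locales auto
  obtain \<Phi> where "\<Phi> \<in> flags F le" using extend_flag[of "{}"] by auto
  then interpret tight_chiral F le ps \<Phi> using a by unfold_locales auto
  show False by (rule contradiction)
qed

end
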